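(* Let $k>0$, $H>0$, $\theta\in\mathbb{R}$, $\mathbf{h}=(0,H)$ and $\alpha=e^{\mathrm{i}kH\sin\theta}$. Let $\mathcal{D}$ be a cell of the (square or regular-triangle) tree structure with centroid $\mathbf{O}_{\mathcal{D}}$, let $\mathcal{C}$ be a well separated cell of $\mathcal{D}$ with centroid $\mathbf{O}_{\mathcal{C}}$, let $\Delta\Gamma_j\subset\mathcal{C}$ be a boundary element of a scatterer boundary $\Gamma_i$, let $\varphi_i$ be a continuous function on $\Gamma_i$, and let $$\mathbf{M}_n(\mathbf{O}_{\mathcal{C}})=\int_{\Delta\Gamma_j}J_n\big(k|\mathbf{y}-\mathbf{O}_{\mathcal{C}}|\big)e^{-\mathrm{i}n\theta_{\mathbf{y}-\mathbf{O}_{\mathcal{C}}}}\varphi_i(\mathbf{y})\,ds(\mathbf{y}),\qquad n\in\mathbb{Z}.$$ For each source point $\mathbf{x}\in\mathcal{D}$, if $kH(1\pm\sin\theta)\neq 2n\pi$ for all $n\in\{0,1,2,\dots\}$ (for both signs) and $H\geq|\mathbf{O}_{\mathcal{D}}-\mathbf{O}_{\mathcal{C}}|$, then the truncation error $$E_{M2L}(\mathbf{x},\mathbf{O}_{\mathcal{D}},p)=\sum_{n=-p}^{p}\sum_{m=-\infty}^{\infty}\alpha^m R^{H}_{n,p}\big(k(\mathbf{O}_{\mathcal{D}}-\mathbf{O}_{\mathcal{C}}-m\mathbf{h}),\,k(\mathbf{O}_{\mathcal{D}}-\mathbf{x})\big)\mathbf{M}_n(\mathbf{O}_{\mathcal{C}})$$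 satisfies, as $p\to\infty$, $$\big|E_{M2L}(\mathbf{x},\mathbf{O}_{\mathcal{D}},p)\big|=\mathcal{O}\left(\frac{\lambda^p}{p}\right),$$ where $\lambda:=\max\{\lambda_{-1},\lambda_0,\lambda_1\}$ and $$\lambda_m:=\max_{\mathbf{y}\in\Delta\Gamma_j}\ \frac{|\mathbf{x}-\mathbf{O}_{\mathcal{D}}|}{|\mathbf{O}_{\mathcal{D}}-\mathbf{O}_{\mathcal{C}}-m\mathbf{h}|}\exp\left(\frac{3|\mathbf{y}-\mathbf{O}_{\mathcal{C}}|}{2|\mathbf{O}_{\mathcal{D}}-\mathbf{O}_{\mathcal{C}}-m\mathbf{h}|}\right).$$
   Context: Setting. A two-dimensional medium, periodic with period $H$ in the $x_2$-direction, contains scatterers whose boundaries $\Gamma_i$ are closed curves; each $\Gamma_i$ is divided into finitely many elements $\Delta\Gamma_j$ (compact arcs). $ds$ is arc length. Remainder of Graf's addition theorem. For $\mathbf{x}\in\mathbb{R}^2$, $\theta_{\mathbf{x}}$ is the angle between $\mathbf{x}$ and the $x_1$-axis; $J_n$ and $H^{(1)}_n$ are the Bessel function and the Hankel function of the first kind of order $n$. For $|\mathbf{y}|<|\mathbf{x}|$ and $\ell\in\mathbb{Z}$, $$R^{H}_{\ell,p}(\mathbf{x},\mathbf{y}):=\Big(\sum_{n=p+1}^{\infty}+\sum_{n=-\infty}^{-p-1}\Big)H^{(1)}_{\ell+n}(|\mathbf{x}|)e^{\mathrm{i}(\ell+n)\theta_{\mathbf{x}}}J_n(|\mathbf{y}|)e^{-\mathrm{i}n\theta_{\mathbf{y}}},$$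 which is the tail of the expansion $H^{(1)}_\ell(|\mathbf{x}-\mathbf{y}|)e^{\mathrm{i}\ell\theta_{\mathbf{x}-\mathbf{y}}}=\sum_{n\in\mathbb{Z}}H^{(1)}_{\ell+n}(|\mathbf{x}|)e^{\mathrm{i}(\ell+n)\theta_{\mathbf{x}}}J_n(|\mathbf{y}|)e^{-\mathrm{i}n\theta_{\mathbf{y}}}$. Tree structure. For a square unit lattice the level 0 cell is a square, and each cell is recursively divided into four equal squares (its children, at the next level). For a hexagonal unit lattice the level 0 cell is a regular hexagon, divided into six equal regular triangles (level 1), and each triangle is recursively divided into four equal regular triangles. This basic tree is copied by translation to all unit lattices of the periodic medium. Two cells are adjacent if they touch (e.g. share a vertex). Cells $\mathcal{C}$ and $\mathcal{D}$ are well separated if they are not adjacent: for cells of the same level this means they share no vertex; when $\mathcal{D}$ has a larger level number than $\mathcal{C}$ (level difference $1$ or $2$ for squares, $1$ for triangles) it means that $\mathcal{D}$ is not adjacent to any cell of $\mathcal{D}$'s level contained in $\mathcal{C}$. In the periodic setting, well-separatedness of $\mathcal{C}$ from $\mathcal{D}$ is understood for $\mathcal{C}$ and all its periodic translates $\mathcal{C}+m\mathbf{h}$, $m\in\mathbb{Z}$; in particular $|\mathbf{x}-\mathbf{O}_{\mathcal{D}}|<|\mathbf{O}_{\mathcal{D}}-\mathbf{O}_{\mathcal{C}}-m\mathbf{h}|$ for all $m\in\mathbb{Z}$ and $\mathbf{x}\in\mathcal{D}$. The implied constant in $\mathcal{O}$ does not depend on $p$ (it may depend on all other data). *)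

theory Defs
  imports "HOL-Analysis.Analysis" "HOL-Library.Landau_Symbols"
begin

text \<open>
  The plane is identified with the complex numbers: a point with coordinates x1, x2 is
  the number with real part x1 and imaginary part x2, and the angle of a vector to the
  x1-axis is its \<^const>\<open>Arg\<close>. The angle of the zero vector is immaterial: wherever it can
  occur below, its coefficient is \<open>J n 0\<close>, which vanishes for nonzero \<open>n\<close>.
\<close>

section \<open>Bessel and Hankel functions of integer order, real argument\<close>

definition bessel_J_nat :: "nat \<Rightarrow> real \<Rightarrow> real" where
  "bessel_J_nat n x = (\<Sum>j. (-1) ^ j / (fact j * fact (n + j)) * (x / 2) ^ (n + 2 * j))"

text \<open>
  Standard series of the Bessel function of the second kind (Neumann function) of order
  \<open>n \<ge> 0\<close>, for positive argument. With digamma values it reads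
  \<open>\<psi>(j+1) = harm j - euler_mascheroni\<close>; the Euler constants are collected in the first
  summand.
\<close>
definition bessel_Y_nat :: "nat \<Rightarrow> real \<Rightarrow> real" where
  "bessel_Y_nat n x =
     2 / pi * (ln (x / 2) + euler_mascheroni) * bessel_J_nat n x
     - 1 / pi * (\<Sum>j<n. fact (n - 1 - j) / fact j * (x / 2) powi (2 * int j - int n))
     - 1 / pi * (\<Sum>j. (-1) ^ j / (fact j * fact (n + j)) * (harm j + harm (n + j))
                          * (x / 2) ^ (n + 2 * j))"

definition bessel_J :: "int \<Rightarrow> real \<Rightarrow> real" where
  "bessel_J n x = (if n \<ge> 0 then bessel_J_nat (nat n) x
                   else (-1) ^ nat (- n) * bessel_J_nat (nat (- n)) x)"

definition bessel_Y :: "int \<Rightarrow> real \<Rightarrow> real" where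
  "bessel_Y n x = (if n \<ge> 0 then bessel_Y_nat (nat n) x
                   else (-1) ^ nat (- n) * bessel_Y_nat (nat (- n)) x)"

definition hankel1 :: "int \<Rightarrow> real \<Rightarrow> complex" where
  "hankel1 n x = of_real (bessel_J n x) + \<i> * of_real (bessel_Y n x)"

section \<open>Remainder of Graf's addition theorem\<close>

definition graf_term :: "int \<Rightarrow> complex \<Rightarrow> complex \<Rightarrow> int \<Rightarrow> complex" where
  "graf_term l x y n =
     hankel1 (l + n) (cmod x) * cis (of_int (l + n) * Arg x)
     * of_real (bessel_J n (cmod y)) * cis (- (of_int n * Arg y))"

definition graf_remainder :: "int \<Rightarrow> nat \<Rightarrow> complex \<Rightarrow> complex \<Rightarrow> complex" where
  "graf_remainder l p x y =
     (\<Sum>i. graf_term l x y (int p + 1 + int i)) + (\<Sum>i. graf_term l x y (- int p - 1 - int i))"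

section \<open>Conditionally convergent bilateral series\<close>

text \<open>
  The sums over the periodic translates converge only conditionally (the terms decay like
  the inverse square root of the index), so the unordered sum \<^const>\<open>infsum\<close> is not
  applicable; the two one-sided series are taken in their natural order.
\<close>
definition bilateral_summable :: "(int \<Rightarrow> complex) \<Rightarrow> bool" where
  "bilateral_summable f \<longleftrightarrow>
     summable (\<lambda>i::nat. f (int i)) \<and> summable (\<lambda>i::nat. f (- int (Suc i)))"

definition bilateral_suminf :: "(int \<Rightarrow> complex) \<Rightarrow> complex" where
  "bilateral_suminf f = (\<Sum>i. f (int i)) + (\<Sum>i. f (- int (Suc i)))"

section \<open>Tree structure\<close>

text \<open>
  A cell is given by the list of its vertices in cyclic order: three for a triangle, four
  for a square, six for a hexagon. All cells that occur are regular polygons, so the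
  centroid is the mean of the vertices.
\<close>
type_synonym cell = "complex list"

definition region :: "cell \<Rightarrow> complex set" where
  "region c = convex hull (set c)"

definition centroid :: "cell \<Rightarrow> complex" where
  "centroid c = sum_list c / of_nat (length c)"

definition shift :: "complex \<Rightarrow> cell \<Rightarrow> cell" where
  "shift w c = map (\<lambda>z. w + z) c"

fun children :: "cell \<Rightarrow> cell set" where
  "children [a, b, c] =
     {[a, midpoint a b, midpoint a c], [midpoint a b, b, midpoint b c],
      [midpoint a c, midpoint b c, c], [midpoint b c, midpoint a c, midpoint a b]}"
| "children [a, b, c, d] =
     (let z = midpoint a c in
      {[a, midpoint a b, z, midpoint a d], [midpoint a b, b, midpoint b c, z],
       [z, midpoint b c, c, midpoint c d], [midpoint a d, z, midpoint c d, d]})"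
| "children [a, b, c, d, e, f] =
     (let z = midpoint a d in
      {[z, a, b], [z, b, c], [z, c, d], [z, d, e], [z, e, f], [z, f, a]})"
| "children _ = {}"

inductive tree_cell :: "cell \<Rightarrow> nat \<Rightarrow> cell \<Rightarrow> bool" for r where
  base: "tree_cell r 0 r"
| subdivide: "tree_cell r l c \<Longrightarrow> d \<in> children c \<Longrightarrow> tree_cell r (Suc l) d"

text \<open>
  \<open>Square a s\<close> is the lattice tiling by squares, one of which has a vertex \<open>a\<close> and from it
  the side vector \<open>s\<close>; \<open>Hexagonal z v\<close> is the lattice tiling by regular hexagons, one of
  which has centre \<open>z\<close> and a vertex \<open>z + v\<close>.
\<close>
datatype unit_lattice = Square complex complex | Hexagonal complex complex

fun nondegenerate :: "unit_lattice \<Rightarrow> bool" where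
  "nondegenerate (Square a s) \<longleftrightarrow> s \<noteq> 0"
| "nondegenerate (Hexagonal z v) \<longleftrightarrow> v \<noteq> 0"

fun root_cell :: "unit_lattice \<Rightarrow> cell" where
  "root_cell (Square a s) = [a, a + s, a + s + \<i> * s, a + \<i> * s]"
| "root_cell (Hexagonal z v) = map (\<lambda>j. z + v * cis (real j * pi / 3)) [0..<6]"

fun lattice_vectors :: "unit_lattice \<Rightarrow> complex set" where
  "lattice_vectors (Square a s) = {of_int m * s + of_int n * (\<i> * s) | m n. True}"
| "lattice_vectors (Hexagonal z v) =
     {of_int m * (v * (1 + cis (pi / 3))) + of_int n * (v * (cis (pi / 3) + cis (2 * pi / 3)))
      | m n. True}"

definition medium_cell :: "unit_lattice \<Rightarrow> nat \<Rightarrow> cell \<Rightarrow> bool" where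
  "medium_cell U l c \<longleftrightarrow> (\<exists>w\<in>lattice_vectors U. \<exists>c0. tree_cell (root_cell U) l c0 \<and> c = shift w c0)"

definition period_vector :: "real \<Rightarrow> complex" where
  "period_vector H = Complex 0 H"

definition periodic_medium :: "unit_lattice \<Rightarrow> real \<Rightarrow> bool" where
  "periodic_medium U H \<longleftrightarrow> nondegenerate U \<and> H > 0 \<and> period_vector H \<in> lattice_vectors U"

definition adjacent :: "cell \<Rightarrow> cell \<Rightarrow> bool" where
  "adjacent c d \<longleftrightarrow> region c \<inter> region d \<noteq> {}"

fun max_level_difference :: "unit_lattice \<Rightarrow> nat" where
  "max_level_difference (Square a s) = 2"
| "max_level_difference (Hexagonal z v) = 1"

text \<open>
  The cell \<open>c\<close> of level \<open>lc\<close>, with all its periodic translates, is well separated from the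
  cell \<open>d\<close> of level \<open>ld\<close>. For \<open>lc = ld\<close> the only cell of level \<open>ld\<close> inside a translate of
  \<open>c\<close> is that translate itself.
\<close>
definition well_separated :: "unit_lattice \<Rightarrow> real \<Rightarrow> nat \<Rightarrow> cell \<Rightarrow> nat \<Rightarrow> cell \<Rightarrow> bool" where
  "well_separated U H lc c ld d \<longleftrightarrow>
     lc \<le> ld \<and> ld - lc \<le> max_level_difference U \<and>
     (\<forall>m::int. \<forall>e. medium_cell U ld e \<and> region e \<subseteq> region (shift (of_int m * period_vector H) c)
        \<longrightarrow> \<not> adjacent d e)"

section \<open>Boundary curves, elements and arc length\<close>

definition curve_length :: "(real \<Rightarrow> complex) \<Rightarrow> real \<Rightarrow> real \<Rightarrow> ereal" where
  "curve_length g a b =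
     (SUP \<P>\<in>{\<P>. \<P> division_of {a..b}}. ereal (\<Sum>K\<in>\<P>. dist (g (Inf K)) (g (Sup K))))"

text \<open>
  A simple closed rectifiable curve of length \<open>L\<close>, parametrized by arc length. Every simple
  closed rectifiable curve has such a parametrization, started at any of its points, and
  then integration with respect to arc length over \<open>g ` {a..b}\<close> is integration over
  \<open>{a..b}\<close>.
\<close>
definition closed_curve :: "(real \<Rightarrow> complex) \<Rightarrow> real \<Rightarrow> bool" where
  "closed_curve g L \<longleftrightarrow>
     L > 0 \<and> g L = g 0 \<and> inj_on g {0..<L} \<and>
     (\<forall>a b. 0 \<le> a \<longrightarrow> a \<le> b \<longrightarrow> b \<le> L \<longrightarrow> curve_length g a b = ereal (b - a))"

text \<open>The elements are the arcs \<open>g ` {t j..t (Suc j)}\<close> for \<open>j < N\<close>.\<close>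
definition subdivision :: "real \<Rightarrow> nat \<Rightarrow> (nat \<Rightarrow> real) \<Rightarrow> bool" where
  "subdivision L N t \<longleftrightarrow> t 0 = 0 \<and> t N = L \<and> (\<forall>j<N. t j < t (Suc j))"

section \<open>Multipole moments and the truncation error\<close>

definition multipole_moment ::
  "real \<Rightarrow> (real \<Rightarrow> complex) \<Rightarrow> real \<Rightarrow> real \<Rightarrow> (complex \<Rightarrow> complex) \<Rightarrow> complex \<Rightarrow> int \<Rightarrow> complex"
where
  "multipole_moment k g a b \<phi> z n =
     integral {a..b} (\<lambda>s. of_real (bessel_J n (k * cmod (g s - z)))
                          * cis (- (of_int n * Arg (g s - z))) * \<phi> (g s))"

definition m2l_summand ::
  "real \<Rightarrow> real \<Rightarrow> real \<Rightarrow> complex \<Rightarrow> complex \<Rightarrow> complex \<Rightarrow> nat \<Rightarrow> int \<Rightarrow> int \<Rightarrow> complex" where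
  "m2l_summand k H \<theta> x zD zC p n m =
     cis (k * H * sin \<theta>) powi m
     * graf_remainder n p (of_real k * (zD - zC - of_int m * period_vector H))
                          (of_real k * (zD - x))"

definition m2l_error ::
  "real \<Rightarrow> real \<Rightarrow> real \<Rightarrow> complex \<Rightarrow> complex \<Rightarrow> complex \<Rightarrow> (int \<Rightarrow> complex) \<Rightarrow> nat \<Rightarrow> complex"
where
  "m2l_error k H \<theta> x zD zC M p =
     (\<Sum>n\<in>{- int p..int p}. bilateral_suminf (m2l_summand k H \<theta> x zD zC p n) * M n)"

text \<open>
  The supremum is over a compact arc and a continuous function of \<open>y\<close>, hence a maximum.
\<close>
definition m2l_rate ::
  "real \<Rightarrow> complex \<Rightarrow> complex \<Rightarrow> complex \<Rightarrow> complex set \<Rightarrow> int \<Rightarrow> real" where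
  "m2l_rate H x zD zC \<Delta> m =
     (let r = cmod (zD - zC - of_int m * period_vector H) in
      SUP y\<in>\<Delta>. cmod (x - zD) / r * exp (3 * cmod (y - zC) / (2 * r)))"

end

theory Submission
  imports Defs
begin

text \<open>
  The recurrence in the order bounds \<open>H n x\<close>, uniformly for \<open>x \<ge> X\<close>, by a constant times
  \<open>(n - 1)! (2 / X)\<^sup>n / sqrt x\<close>. For points on a vertical lattice the square of the phase
  \<open>z / \<bar>z\<bar>\<close> is \<open>-1\<close> up to \<open>O (1 / \<bar>z\<bar>)\<close>, so by the same recurrence the lattice sums of
  order \<open>n + 2\<close> and of order \<open>n\<close> differ by an absolutely convergent series. Hence all lattice
  sums converge and obey the bound above without the square root, once those of orders 0 and 1
  converge; for these, a solution of Bessel's equation combines \<open>exp (\<i> x) / sqrt x\<close> and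
  \<open>exp (- \<i> x) / sqrt x\<close> up to \<open>O (x powr (-3 / 2))\<close>, and neither part resonates with the
  quasi-periodic phases. With \<open>X\<close> equal to \<open>k\<close> times the smallest distance of
  the translated centroids, which is attained for \<open>m \<in> {-1, 0, 1}\<close>, summation over \<open>n\<close> of the bounds for
  \<open>H (n + q)\<close>, \<open>J q\<close> and the moments gives \<open>\<lambda>\<^sup>q / q\<close> for each \<open>q > p\<close>, since
  \<open>q (q + 1) \<dots> (q + n - 1) \<le> (3 q / 2)\<^sup>n\<close> for \<open>n \<le> q\<close>. The geometry of the
  well separated cells forces a rate below 1, so that these bounds can be summed over \<open>q\<close>.
\<close>

section \<open>Bessel functions\<close>

text \<open>The lattice terms decay only like the inverse square root of the index, so no bound on
  absolute values survives the sum over \<open>m\<close>. The lattice sums are therefore controlled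
  through their partial sums, uniformly in the length, and the exchange with Graf's tail has to work
  with such bounds alone. A second obstacle is that \<open>lam\<close> enters with exponent
  \<open>p\<close>: a factor \<open>c ^ n\<close> with \<open>c > 1\<close>, lost in the bound for
  the order \<open>n\<close>, would spoil the base. The induction over the order must thus reproduce
  the recurrence itself, which is why the sequence \<open>growth\<close> is carried along and
  compared with \<open>growth_model\<close> by a constant independent of the order. The factor
  \<open>1 / p\<close> and the exponential in the rate have one source:
  \<open>(n + q - 1)! / q!\<close> is at most \<open>(3 q / 2) ^ n / q\<close>, and summing this
  against the moments gives an exponential whose exponent is proportional to \<open>q\<close>. That
  the rate is below 1 does not follow from \<open>cmod (x - centroid D)\<close> being smaller than
  the distance of the centroids, since the exponential exceeds 1. It needs quantitative distances,
  obtained from integer coordinates of the cells.\<close>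

definition phi_coeff :: "nat \<Rightarrow> nat \<Rightarrow> real" where
  "phi_coeff n j = (-1) ^ j / (fact j * fact (n + j))"

definition psi_coeff :: "nat \<Rightarrow> nat \<Rightarrow> real" where
  "psi_coeff n j = phi_coeff n j * (harm j + harm (n + j))"

text \<open>With \<open>s = (x / 2)^2\<close> the series of \<open>J n x\<close> is
  \<open>(x / 2) ^ n\<close> times this everywhere convergent power series, so termwise
  differentiation and comparison of coefficients apply. \<open>bessel_psi\<close> is its companion,
  weighted by the harmonic numbers of the Neumann series.\<close>

definition bessel_phi :: "nat \<Rightarrow> real \<Rightarrow> real" where
  "bessel_phi n s = (\<Sum>j. phi_coeff n j * s ^ j)"

definition bessel_psi :: "nat \<Rightarrow> real \<Rightarrow> real" where
  "bessel_psi n s = (\<Sum>j. psi_coeff n j * s ^ j)"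

lemma norm_phi_coeff_le: "norm (phi_coeff n j) \<le> inverse (fact n) * inverse (fact j)"
proof -
  have "(fact n :: real) \<le> fact (n + j)" by (simp add: fact_mono)
  then show ?thesis by (simp add: phi_coeff_def field_simps)
qed

lemma summable_phi: "summable (\<lambda>j. phi_coeff n j * s ^ j)"
proof (rule summable_comparison_test)
  show "\<exists>N. \<forall>j\<ge>N. norm (phi_coeff n j * s ^ j) \<le> inverse (fact n) * (inverse (fact j) * norm s ^ j)"
  proof (intro exI allI impI)
    fix j show "norm (phi_coeff n j * s ^ j) \<le> inverse (fact n) * (inverse (fact j) * norm s ^ j)"
      using mult_right_mono[OF norm_phi_coeff_le[of n j], of "norm s ^ j"]
      by (simp add: norm_mult norm_power mult.assoc abs_mult power_abs)
  qed
  show "summable (\<lambda>j. inverse (fact n) * (inverse (fact j) * norm s ^ j))"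
    by (intro summable_mult summable_exp)
qed

lemma bessel_phi_bound:
  assumes "s \<ge> 0" shows "\<bar>bessel_phi n s\<bar> \<le> exp s / fact n"
proof -
  have le: "norm (phi_coeff n j * s ^ j) \<le> inverse (fact n) * (inverse (fact j) * s ^ j)" for j
    using mult_right_mono[OF norm_phi_coeff_le[of n j], of "s ^ j"] assms
    by (simp add: norm_mult norm_power mult.assoc abs_mult power_abs)
  have sm: "summable (\<lambda>j. inverse (fact n) * (inverse (fact j) * s ^ j))"
    by (intro summable_mult summable_exp)
  have "norm (bessel_phi n s) \<le> (\<Sum>j. inverse (fact n) * (inverse (fact j) * s ^ j))"
    unfolding bessel_phi_def by (rule norm_suminf_le[OF le sm]) 
  also have "\<dots> = inverse (fact n) * exp s"
    by (subst suminf_mult[OF summable_exp]) (simp add: exp_def field_simps)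
  finally show ?thesis by (simp add: field_simps)
qed

text \<open>A crude bound suffices: one of the two factorials in \<open>psi_coeff\<close> absorbs
  the harmonic numbers, the other leaves an exponential series.\<close>

lemma harm_le_fact: "harm n \<le> (fact n :: real)"
proof (induction n)
  case (Suc n)
  have "harm (Suc n) \<le> harm n + (1::real)" by (simp add: harm_Suc field_simps)
  show ?case
  proof (cases n)
    case (Suc m)
    have "harm (Suc n) \<le> (fact n + 1 :: real)" using \<open>harm (Suc n) \<le> harm n + (1::real)\<close> Suc.IH by simp
    also have "\<dots> \<le> 2 * fact n" by (simp add: fact_ge_1)
    also have "\<dots> \<le> real (Suc n) * fact n" using Suc by (intro mult_right_mono) auto
    finally show ?thesis by (simp add: algebra_simps)
  qed (simp add: harm_expand)
qed (simp add: harm_expand)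

lemma summable_psi: "summable (\<lambda>j. psi_coeff n j * s ^ j)"
proof (rule summable_comparison_test)
  show "\<exists>N. \<forall>j\<ge>N. norm (psi_coeff n j * s ^ j) \<le> 2 * (inverse (fact j) * norm s ^ j)"
  proof (intro exI allI impI)
    fix j
    have "harm j \<le> (harm (n + j) :: real)" by (intro harm_mono) auto
    then have "harm j + harm (n + j) \<le> (2 * fact (n + j) :: real)"
      using harm_le_fact[of "n + j"] by simp
    moreover have "0 \<le> (harm j + harm (n + j) :: real)" by (intro add_nonneg_nonneg harm_nonneg)
    moreover have "norm (psi_coeff n j) = \<bar>harm j + harm (n + j)\<bar> / (fact j * fact (n + j))"
      by (simp only: psi_coeff_def phi_coeff_def norm_mult norm_divide) (simp add: abs_mult)
    ultimately have "norm (psi_coeff n j) \<le> 2 * fact (n + j) / (fact j * fact (n + j))"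
      by (simp only: abs_of_nonneg) (intro divide_right_mono, auto)
    then have "norm (psi_coeff n j) \<le> 2 * inverse (fact j)"
      by (simp add: inverse_eq_divide)
    from mult_right_mono[OF this, of "norm s ^ j"]
    show "norm (psi_coeff n j * s ^ j) \<le> 2 * (inverse (fact j) * norm s ^ j)"
      by (simp add: norm_mult norm_power mult.assoc abs_mult power_abs)
  qed
  show "summable (\<lambda>j. 2 * (inverse (fact j) * norm s ^ j))"
    by (intro summable_mult summable_exp)
qed

section \<open>Three-term recurrences of the power series\<close>

lemma powser_recurrence:
  fixes c d e :: "nat \<Rightarrow> real"
  assumes "summable (\<lambda>j. d j * s ^ j)" "summable (\<lambda>j. e j * s ^ j)"
    and "c 0 = d 0" "\<And>j. c (Suc j) = d (Suc j) + e j"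
  shows "(\<lambda>j. c j * s ^ j) sums ((\<Sum>j. d j * s ^ j) + s * (\<Sum>j. e j * s ^ j))"
proof -
  have e: "(\<lambda>j. (case j of 0 \<Rightarrow> 0 | Suc i \<Rightarrow> e i) * s ^ j) sums (s * (\<Sum>j. e j * s ^ j))"
    (is "?e sums _")
  proof (subst sums_Suc_iff[of ?e "s * (\<Sum>j. e j * s ^ j)", simplified, symmetric])
    show "(\<lambda>i. e i * (s * s ^ i)) sums (s * (\<Sum>j. e j * s ^ j))"
      using sums_mult[OF summable_sums[OF assms(2)], of s] by (simp add: algebra_simps)
  qed
  have "(\<lambda>j. d j * s ^ j + ?e j) = (\<lambda>j. c j * s ^ j)"
  proof
    fix j show "d j * s ^ j + ?e j = c j * s ^ j"
      using assms(3,4) by (cases j) (auto simp: algebra_simps)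
  qed
  then show ?thesis using sums_add[OF summable_sums[OF assms(1)] e] by simp
qed

text \<open>The recurrence of \<open>J\<close> solved for the lowest order, the form in which all
  divisions by \<open>x\<close> have disappeared; multiplication by \<open>s\<close> shifts the
  coefficients by one place.\<close>

lemma bessel_phi_recurrence:
  "bessel_phi n s = real (Suc n) * bessel_phi (Suc n) s - s * bessel_phi (Suc (Suc n)) s"
proof -
  have "(\<lambda>j. phi_coeff n j * s ^ j) sums
    ((\<Sum>j. (real (Suc n) * phi_coeff (Suc n) j) * s ^ j)
      + s * (\<Sum>j. (- phi_coeff (Suc (Suc n)) j) * s ^ j))"
  proof (rule powser_recurrence)
    show "summable (\<lambda>j. (real (Suc n) * phi_coeff (Suc n) j) * s ^ j)"
      using summable_mult[OF summable_phi[of "Suc n" s], of "real (Suc n)"] by (simp add: mult.assoc)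
    show "summable (\<lambda>j. (- phi_coeff (Suc (Suc n)) j) * s ^ j)"
      using summable_minus[OF summable_phi[of "Suc (Suc n)" s]] by simp
    show "phi_coeff n (Suc j) = real (Suc n) * phi_coeff (Suc n) (Suc j) + (- phi_coeff (Suc (Suc n)) j)" for j
      by (simp add: phi_coeff_def divide_simps) (simp add: algebra_simps)
    show "phi_coeff n 0 = real (Suc n) * phi_coeff (Suc n) 0"
      by (simp add: phi_coeff_def divide_simps)
  qed
  from sums_unique[OF this] show ?thesis
    using suminf_mult[OF summable_phi[of "Suc n" s], of "real (Suc n)"]
      suminf_minus[OF summable_phi[of "Suc (Suc n)" s]]
    by (simp add: bessel_phi_def mult.assoc)
qed

lemma psi_coeff_recurrence:
  "psi_coeff n (Suc j) = real (Suc n) * psi_coeff (Suc n) (Suc j) + (- psi_coeff (Suc (Suc n)) j)"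
proof -
  define h1 h2 :: real where "h1 = harm j" and "h2 = harm (Suc (n + j))"
  have 1: "harm (Suc j) = h1 + inverse (real (Suc j))"
     "harm (n + Suc j) = h2" "harm (Suc n + Suc j) = h2 + inverse (real (n + j + 2))"
     "harm (Suc (Suc n) + j) = h2 + inverse (real (n + j + 2))"
    by (simp_all add: h1_def h2_def harm_Suc)
  define F G :: real where "F = fact j" and "G = fact (Suc (n + j))"
  have 2: "fact (Suc j) = real (Suc j) * F" "fact (n + Suc j) = G"
    "fact (Suc n + Suc j) = real (n + j + 2) * G" "fact (Suc (Suc n) + j) = real (n + j + 2) * G"
    by (simp_all add: F_def G_def algebra_simps)
  have nz: "F \<noteq> 0" "G \<noteq> 0" by (simp_all add: F_def G_def)
  show ?thesis
    unfolding psi_coeff_def phi_coeff_def 1 2 h1_def[symmetric] F_def[symmetric]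
    using nz apply (simp add: divide_simps del: of_nat_Suc of_nat_add) apply (simp add: algebra_simps)
    done
qed

lemma bessel_psi_recurrence:
  "bessel_psi n s = real (Suc n) * bessel_psi (Suc n) s - s * bessel_psi (Suc (Suc n)) s
     - inverse (fact (Suc n))"
proof -
  \<comment> \<open>At index 0 the shifted series contributes nothing, and
    \<open>harm (Suc n)\<close> exceeds \<open>harm n\<close> by \<open>1 / (n + 1)\<close>. This
    leaves the defect \<open>1 / fact (Suc n)\<close>, which later cancels against the finite part
    of \<open>Y\<close>.\<close>
  let ?d = "\<lambda>j. real (Suc n) * psi_coeff (Suc n) j - (if j = 0 then inverse (fact (Suc n)) else 0)"
  have s1: "(\<lambda>j. (real (Suc n) * psi_coeff (Suc n) j) * s ^ j) sums (real (Suc n) * bessel_psi (Suc n) s)"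
    using sums_mult[OF summable_sums[OF summable_psi[of "Suc n" s]], of "real (Suc n)"]
    by (simp add: mult.assoc bessel_psi_def)
  have "(\<lambda>j. (if j = 0 then inverse (fact (Suc n)) else 0) * s ^ j) sums (inverse (fact (Suc n)) * s ^ 0)"
    using sums_single[of 0 "\<lambda>j. inverse (fact (Suc n)) * s ^ j"]
    by (rule sums_cong[THEN iffD1, rotated]) auto
  from sums_diff[OF s1 this]
  have s2: "(\<lambda>j. ?d j * s ^ j) sums (real (Suc n) * bessel_psi (Suc n) s - inverse (fact (Suc n)))"
    by (simp add: left_diff_distrib)
  have s3: "(\<lambda>j. (- psi_coeff (Suc (Suc n)) j) * s ^ j) sums (- bessel_psi (Suc (Suc n)) s)"
    using sums_minus[OF summable_sums[OF summable_psi[of "Suc (Suc n)" s]]] by (simp add: bessel_psi_def)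
  have "(\<lambda>j. psi_coeff n j * s ^ j) sums
    ((\<Sum>j. ?d j * s ^ j) + s * (\<Sum>j. (- psi_coeff (Suc (Suc n)) j) * s ^ j))"
  proof (rule powser_recurrence)
    show "summable (\<lambda>j. ?d j * s ^ j)" using s2 by (rule sums_summable)
    show "summable (\<lambda>j. (- psi_coeff (Suc (Suc n)) j) * s ^ j)" using s3 by (rule sums_summable)
    show "psi_coeff n (Suc j) = ?d (Suc j) + (- psi_coeff (Suc (Suc n)) j)" for j
      using psi_coeff_recurrence[of n j] by simp
    show "psi_coeff n 0 = ?d 0"
      by (simp add: psi_coeff_def phi_coeff_def harm_Suc divide_simps) (simp add: algebra_simps harm_expand)
  qed
  from sums_unique[OF this] show ?thesis
    unfolding sums_unique[OF s2, symmetric] sums_unique[OF s3, symmetric]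
    by (simp add: bessel_psi_def)
qed

section \<open>Derivatives of the power series\<close>

lemma bessel_phi_deriv:
  "(bessel_phi n has_real_derivative - bessel_phi (Suc n) s) (at s)"
proof -
  have "diffs (phi_coeff n) = (\<lambda>j. - phi_coeff (Suc n) j)"
    by (rule ext) (simp add: diffs_def phi_coeff_def divide_simps)
  moreover have "(\<Sum>j. - phi_coeff (Suc n) j * s ^ j) = - bessel_phi (Suc n) s"
    using suminf_minus[OF summable_phi[of "Suc n" s]] by (simp add: bessel_phi_def)
  ultimately show ?thesis
    using termdiffs_strong_converges_everywhere[OF summable_phi[of n], of s]
    by (simp add: bessel_phi_def[abs_def])
qed

lemma bessel_psi_deriv:
  "(bessel_psi n has_real_derivative (\<Sum>j. diffs (psi_coeff n) j * s ^ j)) (at s)"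
  using termdiffs_strong_converges_everywhere[OF summable_psi[of n], of s]
  by (simp add: bessel_psi_def[abs_def])

lemma summable_diffs_psi: "summable (\<lambda>j. diffs (psi_coeff n) j * s ^ j)"
  by (rule termdiff_converges_all) (rule summable_psi)

text \<open>The harmonic weights of the two series differ by one increment
  \<open>1 / (j + 1)\<close>, which produces \<open>bessel_phi 0\<close> without its constant term.
  In the derivative of \<open>Y 0\<close> this cancels the contribution of the logarithm, and the
  constant supplies the polar term \<open>2 / x\<close> of \<open>Y 1\<close>.\<close>

lemma bessel_psi_0_deriv:
  "s * ((\<Sum>j. diffs (psi_coeff 0) j * s ^ j) + bessel_psi 1 s) = bessel_phi 0 s - 1"
proof -
  have c: "diffs (psi_coeff 0) j + psi_coeff 1 j = phi_coeff 0 (Suc j)" for j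
    by (simp add: diffs_def psi_coeff_def phi_coeff_def harm_Suc divide_simps) (simp add: algebra_simps)
  have "(\<lambda>j. diffs (psi_coeff 0) j * s ^ j + psi_coeff 1 j * s ^ j) sums
      ((\<Sum>j. diffs (psi_coeff 0) j * s ^ j) + bessel_psi 1 s)"
    unfolding bessel_psi_def
    by (intro sums_add summable_sums summable_diffs_psi summable_psi)
  from sums_mult[OF this, of s]
  have "(\<lambda>j. phi_coeff 0 (Suc j) * s ^ Suc j) sums
      (s * ((\<Sum>j. diffs (psi_coeff 0) j * s ^ j) + bessel_psi 1 s))"
    unfolding c[symmetric] by (simp add: algebra_simps)
  moreover have "(\<lambda>j. phi_coeff 0 (Suc j) * s ^ Suc j) sums (bessel_phi 0 s - phi_coeff 0 0 * s ^ 0)"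
    unfolding bessel_phi_def
    using summable_sums[OF summable_phi[of 0 s]]
    by (subst sums_Suc_iff[of "\<lambda>j. phi_coeff 0 j * s ^ j"]) simp
  ultimately show ?thesis using sums_unique2 by (fastforce simp: phi_coeff_def)
qed

text \<open>The left side is the derivative of \<open>s * bessel_psi 1 s\<close>: the factor
  \<open>j + 1\<close> lowers \<open>fact (1 + j)\<close> to \<open>fact j\<close>, and the surplus
  \<open>1 / (j + 1)\<close> in the harmonic numbers gives \<open>bessel_phi 1\<close>.\<close>

lemma bessel_psi_1_deriv:
  "bessel_psi 1 s + s * (\<Sum>j. diffs (psi_coeff 1) j * s ^ j) = bessel_phi 1 s + bessel_psi 0 s"
proof -
  have c: "psi_coeff 1 j + real j * psi_coeff 1 j = phi_coeff 1 j + psi_coeff 0 j" for j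
    by (simp add: psi_coeff_def phi_coeff_def harm_Suc divide_simps) (simp add: algebra_simps)
  have "(\<lambda>j. real j * psi_coeff 1 j * s ^ (j - Suc 0)) sums (\<Sum>j. diffs (psi_coeff 1) j * s ^ j)"
    by (rule diffs_equiv[OF summable_diffs_psi])
  from sums_mult[OF this, of s]
  have "(\<lambda>j. real j * psi_coeff 1 j * s ^ j) sums (s * (\<Sum>j. diffs (psi_coeff 1) j * s ^ j))"
  proof (rule sums_cong[THEN iffD1, rotated])
    fix j show "s * (real j * psi_coeff 1 j * s ^ (j - Suc 0)) = real j * psi_coeff 1 j * s ^ j"
      by (cases j) auto
  qed
  from sums_add[OF summable_sums[OF summable_psi[of 1 s]] this]
  have "(\<lambda>j. (phi_coeff 1 j + psi_coeff 0 j) * s ^ j) sums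
     (bessel_psi 1 s + s * (\<Sum>j. diffs (psi_coeff 1) j * s ^ j))"
    unfolding c[symmetric] by (simp add: bessel_psi_def algebra_simps)
  moreover have "(\<lambda>j. (phi_coeff 1 j + psi_coeff 0 j) * s ^ j) sums (bessel_phi 1 s + bessel_psi 0 s)"
    using sums_add[OF summable_sums[OF summable_phi[of 1 s]] summable_sums[OF summable_psi[of 0 s]]]
    by (simp add: bessel_phi_def bessel_psi_def algebra_simps)
  ultimately show ?thesis by (rule sums_unique2)
qed

lemma bessel_J_nat_phi: "bessel_J_nat n x = (x / 2) ^ n * bessel_phi n ((x / 2)\<^sup>2)"
  unfolding bessel_J_nat_def bessel_phi_def
  by (subst suminf_mult[OF summable_phi, symmetric])
    (simp add: phi_coeff_def power_add power_mult mult.assoc mult.left_commute)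

lemma bessel_Y_nat_psi:
  "bessel_Y_nat n x = 2 / pi * (ln (x / 2) + euler_mascheroni) * bessel_J_nat n x
     - 1 / pi * (\<Sum>j<n. fact (n - 1 - j) / fact j * (x / 2) powi (2 * int j - int n))
     - 1 / pi * ((x / 2) ^ n * bessel_psi n ((x / 2)\<^sup>2))"
  unfolding bessel_Y_nat_def bessel_psi_def
  by (subst suminf_mult[OF summable_psi, symmetric])
    (simp add: psi_coeff_def phi_coeff_def power_add power_mult mult.assoc mult.left_commute)

lemma bessel_J_nat_bound:
  assumes "x \<ge> 0" shows "\<bar>bessel_J_nat n x\<bar> \<le> exp ((x / 2)\<^sup>2) * (x / 2) ^ n / fact n"
  using mult_left_mono[OF bessel_phi_bound[of "(x / 2)\<^sup>2" n], of "(x / 2) ^ n"] assms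
  by (simp add: bessel_J_nat_phi abs_mult mult.commute)

lemma bessel_J_nat_recurrence:
  assumes "x > 0"
  shows "bessel_J_nat (Suc (Suc n)) x = 2 * real (Suc n) / x * bessel_J_nat (Suc n) x - bessel_J_nat n x"
proof -
  define u where "u = x / 2"
  have x: "x = 2 * u" and "u \<noteq> 0" using assms by (auto simp: u_def)
  show ?thesis
    unfolding bessel_J_nat_phi bessel_phi_recurrence[of n] unfolding x
    using \<open>u \<noteq> 0\<close> by (simp add: field_simps power2_eq_square)
qed

text \<open>The finite sums obey the recurrence except for the top term
  \<open>u ^ n / fact (Suc n)\<close>, which has no partner in \<open>P n\<close>. This is the
  defect of \<open>bessel_psi_recurrence\<close> with the opposite sign.\<close>

lemma bessel_Y_finite_part_recurrence:
  fixes u :: real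
  assumes "u \<noteq> 0"
  defines "P \<equiv> \<lambda>n. \<Sum>j<n. fact (n - 1 - j) / fact j * u powi (2 * int j - int n)"
  shows "P (Suc (Suc n)) + P n = real (Suc n) / u * P (Suc n) + u ^ n / fact (Suc n)"
proof -
  have "P (Suc (Suc n)) = fact (Suc n) * u powi (- int (Suc (Suc n)))
     + (\<Sum>j<Suc n. fact (n - j) / fact (Suc j) * u powi (2 * int j - int n))"
    unfolding P_def by (subst sum.lessThan_Suc_shift) (simp add: algebra_simps)
  also have "\<dots> = fact (Suc n) * u powi (- int (Suc (Suc n)))
     + (\<Sum>j<n. fact (n - j) / fact (Suc j) * u powi (2 * int j - int n)) + u ^ n / fact (Suc n)"
    by (simp add: power_int_def)
  finally have 1: "P (Suc (Suc n)) + P n = fact (Suc n) * u powi (- int (Suc (Suc n)))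
     + (\<Sum>j<n. (fact (n - j) / fact (Suc j) + fact (n - 1 - j) / fact j) * u powi (2 * int j - int n))
     + u ^ n / fact (Suc n)"
    unfolding P_def by (simp add: sum.distrib algebra_simps)
  have "P (Suc n) = fact n * u powi (- int (Suc n))
     + (\<Sum>j<n. fact (n - 1 - j) / fact (Suc j) * u powi (2 * int j - int n + 1))"
    unfolding P_def by (subst sum.lessThan_Suc_shift) (simp add: algebra_simps)
  then have 2: "real (Suc n) / u * P (Suc n) = fact (Suc n) * (u powi (- int (Suc n)) / u)
     + (\<Sum>j<n. real (Suc n) * (fact (n - 1 - j) / fact (Suc j)) * (u powi (2 * int j - int n + 1) / u))"
    by (simp add: sum_distrib_left algebra_simps add_divide_distrib sum_divide_distrib)
  have 3: "u powi (- int (Suc n)) / u = u powi (- int (Suc (Suc n)))"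
    unfolding power_int_minus power_int_of_nat using assms(1) by (simp add: field_simps)
  have 4: "u powi (2 * int j - int n + 1) / u = u powi (2 * int j - int n)" for j
    using assms(1) by (subst power_int_diff[of u _ 1, simplified, symmetric]) auto
  have 5: "fact (n - j) / fact (Suc j) + fact (n - 1 - j) / fact j
      = (real (Suc n) * (fact (n - 1 - j) / fact (Suc j)) :: real)" if "j < n" for j
  proof -
    have "fact (n - j) = real (n - j) * fact (n - 1 - j)"
      using that by (subst fact_reduce) auto
    then show ?thesis using that by (simp add: divide_simps of_nat_diff) (simp add: algebra_simps)
  qed
  show ?thesis unfolding 1 2 3 4 using 5 by simp
qed

lemma bessel_Y_nat_recurrence:
  assumes "x > 0"
  shows "bessel_Y_nat (Suc (Suc n)) x = 2 * real (Suc n) / x * bessel_Y_nat (Suc n) x - bessel_Y_nat n x"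
proof -
  define u where "u = x / 2"
  have x: "x = 2 * u" and u: "u \<noteq> 0" using assms by (auto simp: u_def)
  define P where "P = (\<lambda>n. \<Sum>j<n. fact (n - 1 - j) / fact j * u powi (2 * int j - int n))"
  define l where "l = 2 / pi * (ln u + euler_mascheroni)"
  have Y: "bessel_Y_nat n x = l * bessel_J_nat n x - 1 / pi * P n - 1 / pi * (u ^ n * bessel_psi n (u\<^sup>2))" for n
    by (simp add: bessel_Y_nat_psi P_def l_def u_def)
  have P: "P (Suc (Suc n)) = real (Suc n) / u * P (Suc n) + u ^ n / fact (Suc n) - P n"
    using bessel_Y_finite_part_recurrence[OF u, of n] by (simp add: P_def)
  have psi: "u ^ n * bessel_psi n (u\<^sup>2) = real (Suc n) / u * (u ^ Suc n * bessel_psi (Suc n) (u\<^sup>2))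
      - u ^ Suc (Suc n) * bessel_psi (Suc (Suc n)) (u\<^sup>2) - u ^ n / fact (Suc n)"
    unfolding bessel_psi_recurrence[of n] using u by (simp add: field_simps power2_eq_square)
  define q where "q = real (Suc n) / u"
  have c: "2 * real (Suc n) / x = q" unfolding x q_def by (rule mult_divide_mult_cancel_left) simp
  have J: "bessel_J_nat (Suc (Suc n)) x = q * bessel_J_nat (Suc n) x - bessel_J_nat n x"
    using bessel_J_nat_recurrence[OF assms, of n] by (simp only: c)
  show ?thesis
    unfolding Y P[folded q_def] J psi[folded q_def] c by (simp add: algebra_simps diff_divide_distrib add_divide_distrib)
qed

section \<open>First-order systems for the orders 0 and 1\<close>

lemma half_square_deriv: "((\<lambda>x. (x / 2)\<^sup>2) has_real_derivative x / 2) (at x)"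
  by (auto intro!: derivative_eq_intros)

lemma bessel_phi_half_deriv: "((\<lambda>x. bessel_phi n ((x / 2)\<^sup>2)) has_real_derivative
    - bessel_phi (Suc n) ((x / 2)\<^sup>2) * (x / 2)) (at x)"
  by (rule DERIV_chain2[OF bessel_phi_deriv half_square_deriv])

lemma bessel_psi_half_deriv: "((\<lambda>x. bessel_psi n ((x / 2)\<^sup>2)) has_real_derivative
    (\<Sum>j. diffs (psi_coeff n) j * ((x / 2)\<^sup>2) ^ j) * (x / 2)) (at x)"
  by (rule DERIV_chain2[OF bessel_psi_deriv half_square_deriv])

lemma bessel_J_nat_0_deriv:
  "(bessel_J_nat 0 has_real_derivative - bessel_J_nat 1 x) (at x)"
  using bessel_phi_half_deriv[of 0 x] by (simp add: bessel_J_nat_phi[abs_def] mult.commute)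

lemma bessel_J_nat_1_deriv:
  assumes "x > 0"
  shows "(bessel_J_nat 1 has_real_derivative bessel_J_nat 0 x - bessel_J_nat 1 x / x) (at x)"
proof -
  have "((\<lambda>x. x / 2 * bessel_phi 1 ((x / 2)\<^sup>2)) has_real_derivative
     1 / 2 * bessel_phi 1 ((x / 2)\<^sup>2) + (- bessel_phi 2 ((x / 2)\<^sup>2) * (x / 2)) * (x / 2)) (at x)"
    using bessel_phi_half_deriv[of 1 x] 
    by (intro DERIV_mult DERIV_cdivide DERIV_ident) (simp add: numeral_2_eq_2)
  then show ?thesis
    unfolding bessel_J_nat_phi[abs_def] bessel_phi_recurrence[of 0]
    by (simp only: power_one_right, elim DERIV_cong)
      (use assms in \<open>simp add: field_simps power2_eq_square numeral_2_eq_2\<close>)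
qed

lemma bessel_Y_nat_0: "bessel_Y_nat 0 x = 2 / pi * (ln (x / 2) + euler_mascheroni) * bessel_J_nat 0 x
     - 1 / pi * bessel_psi 0 ((x / 2)\<^sup>2)"
  by (simp add: bessel_Y_nat_psi)

lemma bessel_Y_nat_1: "bessel_Y_nat 1 x = 2 / pi * (ln (x / 2) + euler_mascheroni) * bessel_J_nat 1 x
     - 1 / pi * (2 / x) - 1 / pi * (x / 2 * bessel_psi 1 ((x / 2)\<^sup>2))"
  by (simp add: bessel_Y_nat_psi power_int_minus)

lemma bessel_Y_nat_0_deriv:
  assumes "x > 0"
  shows "(bessel_Y_nat 0 has_real_derivative - bessel_Y_nat 1 x) (at x)"
proof -
  define d where "d = (\<Sum>j. diffs (psi_coeff 0) j * ((x / 2)\<^sup>2) ^ j)"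
  have D: "(bessel_Y_nat 0 has_real_derivative
      2 / pi * (1 / x) * bessel_J_nat 0 x
      + (- bessel_J_nat 1 x) * (2 / pi * (ln (x / 2) + euler_mascheroni)) - 1 / pi * (d * (x / 2))) (at x)"
    unfolding bessel_Y_nat_0[abs_def] d_def
    by (intro DERIV_diff DERIV_mult DERIV_cmult bessel_J_nat_0_deriv bessel_psi_half_deriv)
      (use assms in \<open>auto intro!: derivative_eq_intros\<close>)
  have "(x / 2)\<^sup>2 * d = bessel_J_nat 0 x - 1 - (x / 2)\<^sup>2 * bessel_psi 1 ((x / 2)\<^sup>2)"
    using bessel_psi_0_deriv[of "(x / 2)\<^sup>2"]
    by (simp add: d_def bessel_J_nat_phi algebra_simps)
  then have d: "d * (x / 2) = (2 / x) * (bessel_J_nat 0 x - 1) - (x / 2) * bessel_psi 1 ((x / 2)\<^sup>2)"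
    using assms by (simp add: field_simps power2_eq_square)
  have gen: "2 / pi * (1 / x) * j0 + (- j1) * (2 / pi * l) - 1 / pi * (2 / x * (j0 - 1) - x / 2 * p1)
    = - (2 / pi * l * j1 - 1 / pi * (2 / x) - 1 / pi * (x / 2 * p1))" for l j0 j1 p1 :: real
    using assms by (simp add: field_simps)
  show ?thesis
    by (rule DERIV_cong[OF D]) (simp only: d gen bessel_Y_nat_1)
qed

lemma bessel_Y_nat_1_deriv:
  assumes "x > 0"
  shows "(bessel_Y_nat 1 has_real_derivative bessel_Y_nat 0 x - bessel_Y_nat 1 x / x) (at x)"
proof -
  define d where "d = (\<Sum>j. diffs (psi_coeff 1) j * ((x / 2)\<^sup>2) ^ j)"
  have D: "(bessel_Y_nat 1 has_real_derivative
      2 / pi * (1 / x) * bessel_J_nat 1 x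
      + (bessel_J_nat 0 x - bessel_J_nat 1 x / x) * (2 / pi * (ln (x / 2) + euler_mascheroni))
      - 1 / pi * (- 2 / x\<^sup>2)
      - 1 / pi * (1 / 2 * bessel_psi 1 ((x / 2)\<^sup>2) + d * (x / 2) * (x / 2))) (at x)"
    unfolding bessel_Y_nat_1[abs_def] d_def
    by (intro DERIV_diff DERIV_mult DERIV_cmult bessel_J_nat_1_deriv bessel_psi_half_deriv DERIV_cdivide DERIV_ident)
      (use assms in \<open>auto intro!: derivative_eq_intros simp: power2_eq_square\<close>)
  have d: "d * (x / 2) * (x / 2) = 2 / x * bessel_J_nat 1 x + bessel_psi 0 ((x / 2)\<^sup>2) - bessel_psi 1 ((x / 2)\<^sup>2)"
    using bessel_psi_1_deriv[of "(x / 2)\<^sup>2"] assms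
    by (simp add: d_def bessel_J_nat_phi algebra_simps power2_eq_square)
  have gen: "2 / pi * (1 / x) * j1 + (j0 - j1 / x) * (2 / pi * l) - 1 / pi * (- 2 / x\<^sup>2)
      - 1 / pi * (1 / 2 * p1 + (2 / x * j1 + p0 - p1))
    = (2 / pi * l * j0 - 1 / pi * p0) - (2 / pi * l * j1 - 1 / pi * (2 / x) - 1 / pi * (x / 2 * p1)) / x"
    for l j0 j1 p0 p1 :: real
    using assms by (simp add: field_simps power2_eq_square)
  show ?thesis
    by (rule DERIV_cong[OF D]) (simp only: d gen bessel_Y_nat_0 bessel_Y_nat_1)
qed

section \<open>Quasi-periodic sums of cylinder functions of orders 0 and 1\<close>

lemma norm_diff_le_of_vector_derivative:
  fixes f :: "real \<Rightarrow> complex"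
  assumes "\<And>x. x \<in> S \<Longrightarrow> (f has_vector_derivative f' x) (at x within S)"
    and "convex S" "\<And>x. x \<in> S \<Longrightarrow> norm (f' x) \<le> B" "x \<in> S" "y \<in> S"
  shows "norm (f x - f y) \<le> B * \<bar>x - y\<bar>"
proof -
  have B: "0 \<le> B" using assms(3,4) norm_ge_zero order_trans by blast
  have "norm (f x - f y) \<le> B * norm (x - y)"
  proof (rule differentiable_bound[OF assms(2)])
    fix x assume x: "x \<in> S"
    show "(f has_derivative (\<lambda>h. h *\<^sub>R f' x)) (at x within S)"
      using assms(1)[OF x] by (simp add: has_vector_derivative_def)
    show "onorm (\<lambda>h. h *\<^sub>R f' x) \<le> B"
      using assms(3)[OF x] B
      by (intro onorm_bound) (auto simp: mult.commute[of B] intro: mult_left_mono)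
  qed (use assms in auto)
  then show ?thesis by simp
qed

lemma cis_has_vector_derivative: "(cis has_vector_derivative \<i> * cis x) (at x within S)"
proof -
  have "(cis has_derivative (\<lambda>h. h *\<^sub>R (\<i> * cis x))) (at x within S)"
    by (intro has_derivative_eq_rhs[OF has_derivative_cis[OF has_derivative_ident]])
      (simp add: scaleR_conv_of_real algebra_simps)
  then show ?thesis by (simp add: has_vector_derivative_def)
qed

lemma norm_cis_diff_le: "norm (cis a - cis b) \<le> \<bar>a - b\<bar>"
  using norm_diff_le_of_vector_derivative[where S = UNIV and f = cis and B = 1,
      OF cis_has_vector_derivative] by (simp add: norm_mult)

text \<open>The function \<open>u = sqrt x * f\<close> solves
  \<open>u'' + (1 + 1 / (4 x^2)) u = 0\<close>. Its energy decreases because the coefficient does,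
  and it controls \<open>x * (f^2 + g^2)\<close>; the decay is thus obtained without asymptotic
  expansions.\<close>

lemma cylinder_decay:
  fixes f g :: "real \<Rightarrow> real"
  assumes f: "\<And>x. x > 0 \<Longrightarrow> (f has_real_derivative - g x) (at x)"
    and g: "\<And>x. x > 0 \<Longrightarrow> (g has_real_derivative f x - g x / x) (at x)"
    and X: "X > 0"
  shows "\<exists>B\<ge>0. \<forall>x\<ge>X. \<bar>f x\<bar> \<le> B / sqrt x \<and> \<bar>g x\<bar> \<le> B / sqrt x"
proof -
  \<comment> \<open>This is the energy \<open>u'\<^sup>2 + (1 + 1 / (4 x\<^sup>2)) u\<^sup>2\<close> of \<open>u = sqrt x * f\<close>.\<close>
  define E where "E = (\<lambda>x. x * ((f x)\<^sup>2 + (g x)\<^sup>2) - f x * g x + (f x)\<^sup>2 / (2 * x))"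
  have dE: "(E has_real_derivative - ((f x)\<^sup>2 / (2 * x\<^sup>2))) (at x)" if "x > 0" for x
    unfolding E_def using that
    by (auto intro!: derivative_eq_intros f g simp: field_simps power2_eq_square)
  have mono: "E x \<le> E X" if "x \<ge> X" for x
  proof (rule DERIV_nonpos_imp_nonincreasing[OF that])
    fix y assume "X \<le> y" "y \<le> x"
    then have "(E has_real_derivative - ((f y)\<^sup>2 / (2 * y\<^sup>2))) (at y)" using X by (intro dE) auto
    then show "\<exists>d. (E has_real_derivative d) (at y) \<and> d \<le> 0" by (intro exI conjI) auto
  qed
  have lower: "x * ((f x)\<^sup>2 + (g x)\<^sup>2) \<le> 2 * E x" if "x > 0" for x
  proof -
    \<comment> \<open>Completing the square absorbs the indefinite cross term
      \<open>f x * g x\<close>.\<close>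
    have "2 * E x - x * ((f x)\<^sup>2 + (g x)\<^sup>2) = x * (f x)\<^sup>2 + (x * g x - f x)\<^sup>2 / x"
      using that by (simp add: E_def field_simps power2_eq_square)
    moreover have "\<dots> \<ge> 0" using that by simp
    ultimately show ?thesis by linarith
  qed
  define B where "B = sqrt (2 * E X)"
  have "0 \<le> E X" using lower[OF X] X by (smt (verit) mult_nonneg_nonneg zero_le_power2)
  have bound: "\<bar>c\<bar> \<le> B / sqrt x" if "x \<ge> X" "x * c\<^sup>2 \<le> 2 * E X" for x c
  proof -
    have x: "x > 0" using X that by simp
    have "\<bar>c\<bar> * sqrt x = sqrt (x * c\<^sup>2)" by (simp add: real_sqrt_mult mult.commute)
    also have "\<dots> \<le> B" unfolding B_def using that by simp
    finally show ?thesis using x by (simp add: field_simps)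
  qed
  have "\<bar>f x\<bar> \<le> B / sqrt x \<and> \<bar>g x\<bar> \<le> B / sqrt x" if "x \<ge> X" for x
  proof -
    have x: "x > 0" using X that by simp
    have "x * ((f x)\<^sup>2 + (g x)\<^sup>2) \<le> 2 * E X" using lower[OF x] mono[OF that] by simp
    moreover have "0 \<le> x * (f x)\<^sup>2" "0 \<le> x * (g x)\<^sup>2" using x by auto
    ultimately have "x * (f x)\<^sup>2 \<le> 2 * E X" "x * (g x)\<^sup>2 \<le> 2 * E X" by (auto simp: distrib_left)
    then show ?thesis using bound[OF that] by blast
  qed
  moreover have "B \<ge> 0" using \<open>0 \<le> E X\<close> by (simp add: B_def)
  ultimately show ?thesis by blast
qed

text \<open>Summation by parts: multiplying a partial sum by \<open>1 - \<beta> * \<zeta>\<close>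
  leaves boundary terms, which converge because \<open>v\<close> tends to 0, and an absolutely
  convergent series. The hypothesis \<open>\<beta> * \<zeta> \<noteq> 1\<close> is the absence of
  resonance.\<close>

lemma summable_perturbed_geometric:
  fixes v :: "nat \<Rightarrow> complex"
  assumes "norm \<beta> = 1" "\<beta> * \<zeta> \<noteq> 1" "v \<longlonglongrightarrow> 0" "summable (\<lambda>i. norm (v (Suc i) - \<zeta> * v i))"
  shows "summable (\<lambda>i. \<beta> ^ i * v i)"
proof -
  have eq: "(1 - \<beta> * \<zeta>) * (\<Sum>i<M. \<beta> ^ i * v i)
      = v 0 - \<beta> ^ M * v M + (\<Sum>i<M. \<beta> ^ Suc i * (v (Suc i) - \<zeta> * v i))" for M
  proof (induction M)
    case (Suc M)
    show ?case
      by (simp only: sum.lessThan_Suc distrib_left Suc.IH) (simp add: algebra_simps)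
  qed simp
  have "summable (\<lambda>i. \<beta> ^ Suc i * (v (Suc i) - \<zeta> * v i))"
    by (rule summable_comparison_test[OF _ assms(4)]) (auto simp: norm_mult norm_power assms(1))
  then have "convergent (\<lambda>M. \<Sum>i<M. \<beta> ^ Suc i * (v (Suc i) - \<zeta> * v i))"
    by (simp add: summable_iff_convergent)
  moreover have "(\<lambda>M. \<beta> ^ M * v M) \<longlonglongrightarrow> 0"
    using assms(3) by (subst tendsto_norm_zero_iff[symmetric])
      (simp add: norm_mult norm_power assms(1) tendsto_norm_zero_iff)
  then have "convergent (\<lambda>M. v 0 - \<beta> ^ M * v M)"
    by (intro convergent_diff convergent_const) (auto simp: convergent_def)
  ultimately have "convergent (\<lambda>M. (1 - \<beta> * \<zeta>) * (\<Sum>i<M. \<beta> ^ i * v i))"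
    unfolding eq by (intro convergent_add)
  then have "convergent (\<lambda>M. inverse (1 - \<beta> * \<zeta>) * ((1 - \<beta> * \<zeta>) * (\<Sum>i<M. \<beta> ^ i * v i)))"
    by (rule convergent_mult[OF convergent_const])
  moreover have "inverse (1 - \<beta> * \<zeta>) * ((1 - \<beta> * \<zeta>) * y) = y" for y
    using assms(2) by simp
  ultimately show ?thesis by (simp only: summable_iff_convergent)
qed

text \<open>The difference and the sum of \<open>cmod z\<close> and \<open>\<bar>Im z\<bar>\<close>
  multiply to \<open>(Re z)^2\<close>. On a vertical lattice \<open>Re z\<close> is constant, so
  norm and height differ by \<open>O(1 / cmod z)\<close>.\<close>

lemma cmod_minus_Im_le:
  assumes "z \<noteq> 0" shows "\<bar>cmod z - \<bar>Im z\<bar>\<bar> \<le> (Re z)\<^sup>2 / cmod z"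
proof -
  have "(cmod z - \<bar>Im z\<bar>) * cmod z \<le> (cmod z - \<bar>Im z\<bar>) * (cmod z + \<bar>Im z\<bar>)"
    using abs_Im_le_cmod[of z] by (intro mult_left_mono) auto
  also have "\<dots> = (Re z)\<^sup>2" by (simp add: algebra_simps cmod_def power2_eq_square[symmetric])
  finally show ?thesis using assms abs_Im_le_cmod[of z] by (simp add: field_simps)
qed

lemma inverse_three_halves_antimono:
  fixes a b :: real assumes "0 < a" "a \<le> b" shows "1 / (b * sqrt b) \<le> 1 / (a * sqrt a)"
  using assms by (intro divide_left_mono mult_mono mult_pos_pos) auto

lemma summable_inverse_three_halves:
  assumes "c > 0" shows "summable (\<lambda>i. 1 / (c * real i * sqrt (c * real i)))"
proof -
  have "1 / (c * real i * sqrt (c * real i)) = 1 / (c * sqrt c) * real i powr (- (3 / 2))" for i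
  proof (cases "i = 0")
    case False
    have "real i powr (3 / 2) = real i powr (1 + 1 / 2)" by simp
    also have "\<dots> = real i * sqrt (real i)" using False by (simp only: powr_add powr_half_sqrt) simp
    finally show ?thesis by (simp add: powr_minus real_sqrt_mult field_simps)
  qed simp
  moreover have "summable (\<lambda>i. 1 / (c * sqrt c) * real i powr (- (3 / 2)))"
    by (intro summable_mult) (simp add: summable_real_powr_iff)
  ultimately show ?thesis by simp
qed

section \<open>Points on a vertical half-lattice\<close>

definition vertical_pt :: "complex \<Rightarrow> real \<Rightarrow> nat \<Rightarrow> complex" where
  "vertical_pt w \<delta> i = w + of_nat i * (\<i> * of_real \<delta>)"

lemma Re_vertical_pt [simp]: "Re (vertical_pt w \<delta> i) = Re w" and Im_vertical_pt: "Im (vertical_pt w \<delta> i) = Im w + real i * \<delta>"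
  by (simp_all add: vertical_pt_def)

context
  fixes w :: complex and \<delta> :: real
  assumes delta: "\<delta> \<noteq> 0"
begin

lemma vertical_pt_lower: "eventually (\<lambda>i. cmod (vertical_pt w \<delta> i) \<ge> \<bar>\<delta>\<bar> / 2 * real i) sequentially"
proof -
  have "eventually (\<lambda>i. real i \<ge> 2 * \<bar>Im w\<bar> / \<bar>\<delta>\<bar>) sequentially" using filterlim_real_sequentially by (simp add: filterlim_at_top)
  then show ?thesis
  proof eventually_elim
    case (elim i)
    have "\<bar>Im w\<bar> \<le> \<bar>\<delta>\<bar> / 2 * real i" using elim delta by (simp add: field_simps)
    moreover have "\<bar>real i * \<delta>\<bar> \<le> \<bar>Im (vertical_pt w \<delta> i)\<bar> + \<bar>Im w\<bar>" unfolding Im_vertical_pt by linarith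
    moreover have "\<bar>real i * \<delta>\<bar> = \<bar>\<delta>\<bar> * real i" by (simp add: abs_mult mult.commute)
    ultimately have "\<bar>\<delta>\<bar> / 2 * real i \<le> \<bar>Im (vertical_pt w \<delta> i)\<bar>" by linarith
    then show ?case using abs_Im_le_cmod order_trans by blast
  qed
qed

lemma vertical_pt_sign: "eventually (\<lambda>i. Im (vertical_pt w \<delta> i) * sgn \<delta> > 0) sequentially"
proof -
  have "eventually (\<lambda>i. real i > \<bar>Im w\<bar> / \<bar>\<delta>\<bar>) sequentially"
    using filterlim_real_sequentially by (simp add: filterlim_at_top_dense)
  then show ?thesis
  proof eventually_elim
    case (elim i)
    then have "\<bar>Im w\<bar> < real i * \<bar>\<delta>\<bar>" using delta by (simp add: field_simps)
    then show ?case unfolding Im_vertical_pt using delta by (cases "\<delta> > 0") (auto simp: sgn_if)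
  qed
qed

lemma vertical_pt_norm_step: "\<bar>cmod (vertical_pt w \<delta> (Suc i)) - cmod (vertical_pt w \<delta> i)\<bar> \<le> \<bar>\<delta>\<bar>"
proof -
  have "vertical_pt w \<delta> (Suc i) - vertical_pt w \<delta> i = \<i> * of_real \<delta>" by (simp add: vertical_pt_def algebra_simps)
  then have "cmod (vertical_pt w \<delta> (Suc i) - vertical_pt w \<delta> i) = \<bar>\<delta>\<bar>" by (simp add: norm_mult)
  then show ?thesis using norm_triangle_ineq3[of "vertical_pt w \<delta> (Suc i)" "vertical_pt w \<delta> i"] by simp
qed

lemma vertical_pt_summable: "summable (\<lambda>i. 1 / (cmod (vertical_pt w \<delta> i) * sqrt (cmod (vertical_pt w \<delta> i))))"
proof (rule summable_comparison_test_ev[OF _ summable_inverse_three_halves[of "\<bar>\<delta>\<bar> / 2"]])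
  show "eventually (\<lambda>i. norm (1 / (cmod (vertical_pt w \<delta> i) * sqrt (cmod (vertical_pt w \<delta> i))))
      \<le> 1 / (\<bar>\<delta>\<bar> / 2 * real i * sqrt (\<bar>\<delta>\<bar> / 2 * real i))) sequentially"
    using vertical_pt_lower eventually_gt_at_top[of 0]
  proof eventually_elim
    case (elim i)
    have "norm (1 / (cmod (vertical_pt w \<delta> i) * sqrt (cmod (vertical_pt w \<delta> i)))) = 1 / (cmod (vertical_pt w \<delta> i) * sqrt (cmod (vertical_pt w \<delta> i)))"
      by (auto intro!: abs_of_nonneg)
    also have "\<dots> \<le> 1 / (\<bar>\<delta>\<bar> / 2 * real i * sqrt (\<bar>\<delta>\<bar> / 2 * real i))"
      using elim delta by (intro inverse_three_halves_antimono) auto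
    finally show ?case .
  qed
qed (use delta in auto)

lemma vertical_pt_norm_at_top: "filterlim (\<lambda>i. cmod (vertical_pt w \<delta> i)) at_top sequentially"
proof (rule filterlim_at_top_mono[OF _ vertical_pt_lower])
  have "\<bar>\<delta>\<bar> / 2 > 0" using delta by simp
  then show "filterlim (\<lambda>i. \<bar>\<delta>\<bar> / 2 * real i) at_top sequentially"
    by (intro filterlim_tendsto_pos_mult_at_top[OF tendsto_const]) (auto intro: filterlim_real_sequentially)
qed

text \<open>Once the imaginary part has the sign of \<open>\<delta>\<close>, its modulus grows by
  exactly \<open>\<bar>\<delta>\<bar>\<close> per step; replacing it by the norm costs
  \<open>cmod_minus_Im_le\<close> at both ends.\<close>

lemma vertical_pt_norm_step_asymp:
  assumes nz: "\<And>i. vertical_pt w \<delta> i \<noteq> 0"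
  shows "eventually (\<lambda>i. \<bar>cmod (vertical_pt w \<delta> (Suc i)) - cmod (vertical_pt w \<delta> i) - \<bar>\<delta>\<bar>\<bar>
     \<le> 2 * (Re w)\<^sup>2 / (\<bar>\<delta>\<bar> / 2 * real i)) sequentially"
proof -
  have ev: "eventually (\<lambda>i. P (Suc i)) sequentially" if "eventually P sequentially" for P
    using that by (simp add: eventually_sequentially_Suc)
  show ?thesis using vertical_pt_lower ev[OF vertical_pt_lower] vertical_pt_sign ev[OF vertical_pt_sign] eventually_gt_at_top[of 0]
  proof eventually_elim
    case (elim i)
    have m: "\<bar>\<delta>\<bar> / 2 * real i > 0" using elim delta by simp
    have *: "\<bar>cmod (vertical_pt w \<delta> k) - \<bar>Im (vertical_pt w \<delta> k)\<bar>\<bar> \<le> (Re w)\<^sup>2 / (\<bar>\<delta>\<bar> / 2 * real i)"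
      if "cmod (vertical_pt w \<delta> k) \<ge> \<bar>\<delta>\<bar> / 2 * real i" for k
    proof -
      have "\<bar>cmod (vertical_pt w \<delta> k) - \<bar>Im (vertical_pt w \<delta> k)\<bar>\<bar> \<le> (Re w)\<^sup>2 / cmod (vertical_pt w \<delta> k)"
        using cmod_minus_Im_le[OF nz[of k]] by simp
      also have "\<dots> \<le> (Re w)\<^sup>2 / (\<bar>\<delta>\<bar> / 2 * real i)" by (rule divide_left_mono[OF that]) (simp, rule mult_pos_pos[OF less_le_trans[OF m that] m])
      finally show ?thesis .
    qed
    have "\<bar>\<delta>\<bar> / 2 * real i \<le> \<bar>\<delta>\<bar> / 2 * real (Suc i)" by (intro mult_left_mono) auto
    then have 2: "\<bar>cmod (vertical_pt w \<delta> (Suc i)) - \<bar>Im (vertical_pt w \<delta> (Suc i))\<bar>\<bar> \<le> (Re w)\<^sup>2 / (\<bar>\<delta>\<bar> / 2 * real i)"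
      using elim by (intro *) linarith
    have 1: "\<bar>cmod (vertical_pt w \<delta> i) - \<bar>Im (vertical_pt w \<delta> i)\<bar>\<bar> \<le> (Re w)\<^sup>2 / (\<bar>\<delta>\<bar> / 2 * real i)"
      using elim by (intro *) linarith
    have "Im (vertical_pt w \<delta> (Suc i)) = Im (vertical_pt w \<delta> i) + \<delta>" by (simp add: Im_vertical_pt algebra_simps)
    then have "\<bar>Im (vertical_pt w \<delta> (Suc i))\<bar> - \<bar>Im (vertical_pt w \<delta> i)\<bar> = \<bar>\<delta>\<bar>"
      using elim(3,4) delta by (cases "\<delta> > 0") (auto simp: sgn_if)
    with 1 2 have "\<bar>cmod (vertical_pt w \<delta> (Suc i)) - cmod (vertical_pt w \<delta> i) - \<bar>\<delta>\<bar>\<bar>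
      \<le> (Re w)\<^sup>2 / (\<bar>\<delta>\<bar> / 2 * real i) + (Re w)\<^sup>2 / (\<bar>\<delta>\<bar> / 2 * real i)" by linarith
    then show ?case by simp
  qed
qed

text \<open>The horizontal part and the defect of the height against the norm are each at most
  \<open>\<bar>Re w\<bar>\<close>, hence the constant 2.\<close>

lemma vertical_pt_sgn_asymp:
  assumes nz: "\<And>i. vertical_pt w \<delta> i \<noteq> 0"
  shows "eventually (\<lambda>i. norm (sgn (vertical_pt w \<delta> i) - \<i> * of_real (sgn \<delta>)) \<le> 2 * \<bar>Re w\<bar> / cmod (vertical_pt w \<delta> i)) sequentially"
  using vertical_pt_sign
proof eventually_elim
  case (elim i)
  let ?z = "vertical_pt w \<delta> i"
  have z: "cmod ?z > 0" using nz by simp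
  define d where "d = sgn \<delta> * (\<bar>Im ?z\<bar> - cmod ?z)"
  have d: "\<bar>d\<bar> = \<bar>\<bar>Im ?z\<bar> - cmod ?z\<bar>" using delta by (simp add: d_def abs_mult abs_sgn_eq)
  have "Im ?z - sgn \<delta> * cmod ?z = d"
    using elim delta by (cases "\<delta> > 0") (auto simp: sgn_if d_def)
  then have "?z - \<i> * of_real (sgn \<delta>) * of_real (cmod ?z) = of_real (Re w) + \<i> * of_real d"
    by (intro complex_eqI) simp_all
  also have "norm \<dots> \<le> \<bar>Re w\<bar> + \<bar>\<bar>Im ?z\<bar> - cmod ?z\<bar>"
    by (rule order_trans[OF norm_triangle_ineq]) (simp add: norm_mult d)
  also have "\<bar>\<bar>Im ?z\<bar> - cmod ?z\<bar> \<le> \<bar>Re w\<bar>" using cmod_le[of ?z] abs_Im_le_cmod[of ?z] by simp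
  finally have "norm (?z - \<i> * of_real (sgn \<delta>) * of_real (cmod ?z)) \<le> 2 * \<bar>Re w\<bar>" by simp
  moreover have "sgn ?z - \<i> * of_real (sgn \<delta>) = (?z - \<i> * of_real (sgn \<delta>) * of_real (cmod ?z)) / of_real (cmod ?z)"
    using z by (simp add: sgn_eq diff_divide_distrib)
  ultimately show ?case using z by (simp add: norm_divide divide_right_mono)
qed

text \<open>
  Both non-resonance conditions are assumed, so no knowledge of the behaviour at infinity is
  needed that would single out the outgoing solution \<open>J + \<i> Y\<close>.
\<close>
lemma cylinder_lattice_sum:
  fixes f g :: "real \<Rightarrow> real"
  assumes f: "\<And>x. x > 0 \<Longrightarrow> (f has_real_derivative - g x) (at x)"
    and g: "\<And>x. x > 0 \<Longrightarrow> (g has_real_derivative f x - g x / x) (at x)"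
    and nz: "\<And>i. vertical_pt w \<delta> i \<noteq> 0"
    and beta: "norm \<beta> = 1" "\<beta> * cis \<bar>\<delta>\<bar> \<noteq> 1" "\<beta> * cis (- \<bar>\<delta>\<bar>) \<noteq> 1"
  shows "summable (\<lambda>i. \<beta> ^ i * of_real (f (cmod (vertical_pt w \<delta> i))))"
    and "summable (\<lambda>i. \<beta> ^ i * (of_real (g (cmod (vertical_pt w \<delta> i))) * sgn (vertical_pt w \<delta> i)))"
proof -
  \<comment> \<open>The system gives \<open>F' = \<i> * F - g / x\<close>, so
    \<open>cis (- x) * F x\<close> has a derivative of size \<open>O(x powr (-3 / 2))\<close>: up to
    an integrable error, \<open>F\<close> rotates like \<open>cis x\<close>.\<close>
  define F where "F = (\<lambda>x. complex_of_real (g x) - \<i> * of_real (f x))"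
  obtain B where B: "B \<ge> 0" "\<And>x. x \<ge> 1 \<Longrightarrow> \<bar>f x\<bar> \<le> B / sqrt x" "\<And>x. x \<ge> 1 \<Longrightarrow> \<bar>g x\<bar> \<le> B / sqrt x"
    using cylinder_decay[OF f g, of 1] by auto
  have F_bound: "norm (F x) \<le> 2 * B / sqrt x" if "x \<ge> 1" for x
    using norm_triangle_ineq4[of "complex_of_real (g x)" "\<i> * of_real (f x)"] B(2,3)[OF that]
    by (simp add: F_def norm_mult)
  define c where "c = \<bar>\<delta>\<bar> / 2"
  have c: "c > 0" using delta by (simp add: c_def)
  define G where "G = (\<lambda>x. cis (- x) * F x)"
  have dG: "(G has_vector_derivative - (cis (- x) * of_real (g x / x))) (at x within S)" if "x > 0" for x S
  proof -
    have 1: "((\<lambda>x. cis (- x)) has_vector_derivative (- 1) *\<^sub>R (\<i> * cis (- x))) (at x within S)"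
      by (rule vector_diff_chain_within[where f = uminus and g = cis, unfolded o_def])
        (auto intro!: derivative_eq_intros cis_has_vector_derivative)
    have 2: "(F has_vector_derivative of_real (f x - g x / x) - \<i> * of_real (- g x)) (at x within S)"
      unfolding F_def
      by (intro has_vector_derivative_diff has_vector_derivative_mult_right has_vector_derivative_of_real)
        (use f[OF that] g[OF that] in \<open>auto simp: has_real_derivative_iff_has_vector_derivative intro: has_vector_derivative_at_within\<close>)
    show ?thesis unfolding G_def
      by (rule has_vector_derivative_eq_rhs[OF has_vector_derivative_mult[OF 1 2]])
        (simp add: F_def algebra_simps)
  qed
  have F_step: "norm (F y - cis (y - x) * F x) \<le> B / (m * sqrt m) * \<bar>y - x\<bar>"
    if "m \<ge> 1" "x \<ge> m" "y \<ge> m" for m x y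
  proof -
    have "norm (G y - G x) \<le> B / (m * sqrt m) * \<bar>y - x\<bar>"
    proof (rule norm_diff_le_of_vector_derivative[where S = "{m..}", OF dG])
      fix t assume t: "t \<in> {m..}"
      then have t1: "t \<ge> 1" using that by simp
      have "norm (- (cis (- t) * of_real (g t / t))) = \<bar>g t\<bar> / t"
        using t1 by (simp add: norm_mult norm_divide)
      also have "\<dots> \<le> B / sqrt t / t" using B(3)[OF t1] t1 by (intro divide_right_mono) auto
      also have "\<dots> = B * (1 / (t * sqrt t))" by simp
      also have "\<dots> \<le> B * (1 / (m * sqrt m))"
        using t that B(1) by (intro mult_left_mono inverse_three_halves_antimono) auto
      finally show "norm (- (cis (- t) * of_real (g t / t))) \<le> B / (m * sqrt m)" by simp
    qed (use that in auto)
    moreover have "F y - cis (y - x) * F x = cis y * (G y - G x)"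
      by (simp add: G_def right_diff_distrib mult.assoc[symmetric] cis_mult)
    ultimately show ?thesis by (simp add: norm_mult)
  qed
  define v where "v = (\<lambda>i. F (cmod (vertical_pt w \<delta> i)))"
  have ge1: "eventually (\<lambda>i. cmod (vertical_pt w \<delta> i) \<ge> 1) sequentially"
    using vertical_pt_norm_at_top by (auto simp: filterlim_at_top)
  have sqrt_lim: "(\<lambda>i. K / sqrt (cmod (vertical_pt w \<delta> i))) \<longlonglongrightarrow> 0" for K :: real
    by (intro tendsto_divide_0[OF tendsto_const] filterlim_at_top_imp_at_infinity
        filterlim_compose[OF sqrt_at_top vertical_pt_norm_at_top])
  have v0: "v \<longlonglongrightarrow> 0"
  proof (rule Lim_null_comparison[OF _ sqrt_lim])
    show "eventually (\<lambda>i. norm (v i) \<le> 2 * B / sqrt (cmod (vertical_pt w \<delta> i))) sequentially"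
      using ge1 by eventually_elim (auto simp: v_def intro: F_bound)
  qed
  have ev1: "eventually (\<lambda>i. c * real i \<ge> 1) sequentially"
  proof -
    have "eventually (\<lambda>i. real i \<ge> 1 / c) sequentially" using filterlim_real_sequentially by (simp add: filterlim_at_top)
    then show ?thesis by eventually_elim (use c in \<open>simp add: field_simps\<close>)
  qed
  have vs: "summable (\<lambda>i. norm (v (Suc i) - cis \<bar>\<delta>\<bar> * v i))"
  proof (rule summable_comparison_test_ev)
    let ?K = "B * \<bar>\<delta>\<bar> + 2 * (Re w)\<^sup>2 * (2 * B)"
    show "summable (\<lambda>i. ?K * (1 / (c * real i * sqrt (c * real i))))"
      by (intro summable_mult summable_inverse_three_halves c)
    have ev: "eventually (\<lambda>i. P (Suc i)) sequentially" if "eventually P sequentially" for P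
      using that by (simp add: eventually_sequentially_Suc)
    show "eventually (\<lambda>i. norm (norm (v (Suc i) - cis \<bar>\<delta>\<bar> * v i))
        \<le> ?K * (1 / (c * real i * sqrt (c * real i)))) sequentially"
      using vertical_pt_lower ev[OF vertical_pt_lower] vertical_pt_norm_step_asymp[OF nz] ev1
      unfolding c_def[symmetric]
    proof eventually_elim
      case (elim i)
      define m where "m = c * real i"
      let ?x = "cmod (vertical_pt w \<delta> i)" and ?y = "cmod (vertical_pt w \<delta> (Suc i))"
      have m: "m \<ge> 1" "?x \<ge> m" using elim by (auto simp: m_def)
      have "m \<le> c * real (Suc i)" unfolding m_def using c by (intro mult_left_mono) auto
      then have y: "?y \<ge> m" using elim by linarith
      have sm: "sqrt m > 0" using m by simp
      \<comment> \<open>Two sources of error: the drift of \<open>F\<close> along the step, and the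
        deviation of the norm step from \<open>\<bar>\<delta>\<bar>\<close>. Both are
        \<open>O(m powr (-3 / 2))\<close>.\<close>
      have "v (Suc i) - cis \<bar>\<delta>\<bar> * v i = (F ?y - cis (?y - ?x) * F ?x) + (cis (?y - ?x) - cis \<bar>\<delta>\<bar>) * F ?x"
        by (simp add: v_def algebra_simps)
      also have "norm \<dots> \<le> B / (m * sqrt m) * \<bar>\<delta>\<bar> + (2 * (Re w)\<^sup>2 / m) * (2 * B / sqrt m)"
      proof (intro norm_triangle_le add_mono)
        have "norm (F ?y - cis (?y - ?x) * F ?x) \<le> B / (m * sqrt m) * \<bar>?y - ?x\<bar>"
          by (rule F_step[OF m y])
        also have "\<dots> \<le> B / (m * sqrt m) * \<bar>\<delta>\<bar>"
          using vertical_pt_norm_step B(1) m sm by (intro mult_left_mono) auto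
        finally show "norm (F ?y - cis (?y - ?x) * F ?x) \<le> B / (m * sqrt m) * \<bar>\<delta>\<bar>" .
        have "norm (cis (?y - ?x) - cis \<bar>\<delta>\<bar>) \<le> 2 * (Re w)\<^sup>2 / m"
          using norm_cis_diff_le[of "?y - ?x" "\<bar>\<delta>\<bar>"] elim(3) by (simp add: m_def)
        moreover have "norm (F ?x) \<le> 2 * B / sqrt m"
        proof -
          have "norm (F ?x) \<le> 2 * B / sqrt ?x" using m by (intro F_bound) simp
          also have "\<dots> \<le> 2 * B / sqrt m" using m sm B(1) by (intro divide_left_mono mult_pos_pos) (auto intro: less_le_trans)
          finally show ?thesis .
        qed
        ultimately show "norm ((cis (?y - ?x) - cis \<bar>\<delta>\<bar>) * F ?x) \<le> (2 * (Re w)\<^sup>2 / m) * (2 * B / sqrt m)"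
          unfolding norm_mult using m by (intro mult_mono) auto
      qed
      also have "\<dots> = ?K * (1 / (m * sqrt m))" by (simp add: algebra_simps add_divide_distrib)
      finally show ?case by (simp add: m_def)
    qed
  qed
  have s1: "summable (\<lambda>i. \<beta> ^ i * v i)"
    by (rule summable_perturbed_geometric[OF beta(1,2) v0 vs])
  \<comment> \<open>As \<open>f\<close> and \<open>g\<close> are real, conjugation gives the part
    that rotates the other way, to which the second non-resonance condition applies;
    \<open>f\<close> and \<open>g\<close> are then combinations of both parts.\<close>
  have s2: "summable (\<lambda>i. \<beta> ^ i * cnj (v i))"
  proof (rule summable_perturbed_geometric[OF beta(1,3)])
    show "(\<lambda>i. cnj (v i)) \<longlonglongrightarrow> 0" using tendsto_cnj[OF v0] by simp
    have "norm (cnj (v (Suc i)) - cis (- \<bar>\<delta>\<bar>) * cnj (v i)) = norm (v (Suc i) - cis \<bar>\<delta>\<bar> * v i)" for i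
    proof -
      have "cnj (v (Suc i)) - cis (- \<bar>\<delta>\<bar>) * cnj (v i) = cnj (v (Suc i) - cis \<bar>\<delta>\<bar> * v i)"
        by (simp add: cis_cnj)
      then show ?thesis by (metis complex_mod_cnj)
    qed
    then show "summable (\<lambda>i. norm (cnj (v (Suc i)) - cis (- \<bar>\<delta>\<bar>) * cnj (v i)))" using vs by simp
  qed
  have "(\<lambda>i. \<beta> ^ i * of_real (f (cmod (vertical_pt w \<delta> i)))) = (\<lambda>i. (\<i> / 2) * (\<beta> ^ i * v i - \<beta> ^ i * cnj (v i)))"
    by (rule ext) (simp add: v_def F_def algebra_simps)
  moreover have "summable (\<lambda>i. (\<i> / 2) * (\<beta> ^ i * v i - \<beta> ^ i * cnj (v i)))"
    by (intro summable_mult summable_diff s1 s2)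
  ultimately show "summable (\<lambda>i. \<beta> ^ i * of_real (f (cmod (vertical_pt w \<delta> i))))" by simp
  have "(\<lambda>i. \<beta> ^ i * of_real (g (cmod (vertical_pt w \<delta> i)))) = (\<lambda>i. (1 / 2) * (\<beta> ^ i * v i + \<beta> ^ i * cnj (v i)))"
    by (rule ext) (simp add: v_def F_def algebra_simps)
  moreover have "summable (\<lambda>i. (1 / 2) * (\<beta> ^ i * v i + \<beta> ^ i * cnj (v i)))"
    by (intro summable_mult summable_add s1 s2)
  ultimately have sg: "summable (\<lambda>i. \<beta> ^ i * of_real (g (cmod (vertical_pt w \<delta> i))))" by simp
  let ?s = "\<i> * complex_of_real (sgn \<delta>)"
  \<comment> \<open>The direction is replaced by its limit, which reduces the claim to
    \<open>sg\<close>; the error of the replacement is absolutely summable.\<close>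
  have "summable (\<lambda>i. \<beta> ^ i * (of_real (g (cmod (vertical_pt w \<delta> i))) * (sgn (vertical_pt w \<delta> i) - ?s)))"
  proof (rule summable_comparison_test_ev[OF _ summable_mult[OF vertical_pt_summable]])
    show "eventually (\<lambda>i. norm (\<beta> ^ i * (of_real (g (cmod (vertical_pt w \<delta> i))) * (sgn (vertical_pt w \<delta> i) - ?s)))
        \<le> 2 * \<bar>Re w\<bar> * B * (1 / (cmod (vertical_pt w \<delta> i) * sqrt (cmod (vertical_pt w \<delta> i))))) sequentially"
      using ge1 vertical_pt_sgn_asymp[OF nz]
    proof eventually_elim
      case (elim i)
      have "norm (\<beta> ^ i * (of_real (g (cmod (vertical_pt w \<delta> i))) * (sgn (vertical_pt w \<delta> i) - ?s)))
        = \<bar>g (cmod (vertical_pt w \<delta> i))\<bar> * norm (sgn (vertical_pt w \<delta> i) - ?s)"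
        by (simp add: norm_mult norm_power beta)
      also have "\<dots> \<le> (B / sqrt (cmod (vertical_pt w \<delta> i))) * (2 * \<bar>Re w\<bar> / cmod (vertical_pt w \<delta> i))"
        using elim B(3) B(1) by (intro mult_mono) auto
      finally show ?case by (simp add: mult_ac)
    qed
  qed
  from summable_add[OF this summable_mult[OF sg, of ?s]]
  show "summable (\<lambda>i. \<beta> ^ i * (of_real (g (cmod (vertical_pt w \<delta> i))) * sgn (vertical_pt w \<delta> i)))"
    by (simp add: algebra_simps)
qed

end

section \<open>Quasi-periodic sums of Hankel functions\<close>

text \<open>The solution of the recurrence that dominates \<open>\<bar>H n x\<bar> * sqrt x\<close> for \<open>x \<ge> X\<close>, up to a constant.\<close>
fun growth :: "real \<Rightarrow> nat \<Rightarrow> real" where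
  "growth X 0 = 1"
| "growth X (Suc 0) = 1"
| "growth X (Suc (Suc n)) = 2 * real (Suc n) / X * growth X (Suc n) + growth X n"

lemma growth_pos: "X > 0 \<Longrightarrow> growth X n > 0"
proof (induction X n rule: growth.induct)
  case (3 X n)
  then have "2 * real (Suc n) / X * growth X (Suc n) > 0"
    by (intro mult_pos_pos divide_pos_pos) auto
  with 3 show ?case by (simp only: growth.simps add_pos_pos)
qed simp_all

text \<open>For \<open>n > 0\<close> this is, up to the factor \<open>- 1 / pi\<close>, the leading
  term of \<open>Y n X\<close>; it solves the recurrence of \<open>growth\<close> with the
  lower-order summand dropped. At \<open>n = 0\<close> truncated subtraction gives the value
  1.\<close>

definition growth_model :: "real \<Rightarrow> nat \<Rightarrow> real" where
  "growth_model X n = fact (n - 1) * (2 / X) ^ n"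

lemma growth_model_pos: "X > 0 \<Longrightarrow> growth_model X n > 0"
  by (simp add: growth_model_def)

lemma growth_model_Suc: "n > 0 \<Longrightarrow> growth_model X (Suc n) = 2 * real n / X * growth_model X n"
  by (simp add: growth_model_def fact_reduce[of n])

lemma growth_le_model:
  assumes X: "X > 0"
  shows "\<exists>K>0. \<forall>n. growth X n \<le> K * growth_model X n"
proof -
  let ?e = "growth_model X"
  define \<kappa> where "\<kappa> = (X / 2)\<^sup>2"
  \<comment> \<open>These weights absorb the factors \<open>1 + \<kappa> / (n (n + 1))\<close>, whose product converges.\<close>
  define w where "w = (\<lambda>n. exp (- 3 * \<kappa> / real n))"
  have k: "\<kappa> \<ge> 0" by (simp add: \<kappa>_def)
  define K where "K = 1 + 1 / (?e 1 * w 1) + growth X 2 / (?e 2 * w 2)"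
  have pos: "?e n * w n > 0" for n using growth_model_pos[OF X, of n] by (simp add: w_def)
  have g2: "growth X 2 \<ge> 0" using growth_pos[OF X] less_imp_le by blast
  have K: "K \<ge> 1" "K \<ge> 1 / (?e 1 * w 1)" "K \<ge> growth X 2 / (?e 2 * w 2)"
    using pos[of 1] pos[of 2] g2 by (auto simp: K_def)
  \<comment> \<open>The induction runs over orders from 1 on, because
    \<open>growth_model_Suc\<close> fails at order 0. The orders 1 and 2 are its base cases, and
    \<open>K\<close> is built to cover them.\<close>
  have main: "growth X (Suc n) \<le> K * (?e (Suc n) * w (Suc n))" for n
  proof (induction n rule: less_induct)
    case (less n)
    consider "n = 0" | "n = 1" | m where "n = Suc (Suc m)"
      by (metis One_nat_def not0_implies_Suc)
    then show ?case
    proof cases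
      case 1
      then show ?thesis using K(2) pos[of 1] by (simp add: field_simps)
    next
      case 2
      have "growth X 2 \<le> K * (?e 2 * w 2)" using K(3) pos[of 2] by (simp only: pos_divide_le_eq)
      then show ?thesis using 2 by (simp add: numeral_2_eq_2)
    next
      case (3 m)
      define N where "N = Suc m"
      have N: "N \<ge> 1" "real N > 0" by (auto simp: N_def)
      have e1: "?e (Suc (Suc N)) = 2 * real (Suc N) / X * ?e (Suc N)"
        by (rule growth_model_Suc) simp
      have e2: "?e N = \<kappa> / (real N * real (Suc N)) * ?e (Suc (Suc N))"
      proof -
        have gen: "e = (X / 2)\<^sup>2 / (a * b) * (2 * b / X * (2 * a / X * e))"
          if "a \<noteq> 0" "b \<noteq> 0" for a b e :: real
          using that X by (simp add: field_simps power2_eq_square)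
        have "?e (Suc N) = 2 * real N / X * ?e N" by (rule growth_model_Suc) (simp add: N_def)
        then show ?thesis unfolding e1 \<kappa>_def using gen[of "real N" "real (Suc N)" "?e N"] N by simp
      qed
      have ep: "?e (Suc (Suc N)) > 0" by (rule growth_model_pos[OF X])
      have wle: "w N \<le> w (Suc N)"
        using k N by (simp add: w_def divide_left_mono)
      have "growth X (Suc (Suc N)) = 2 * real (Suc N) / X * growth X (Suc N) + growth X N" by simp
      also have "\<dots> \<le> 2 * real (Suc N) / X * (K * (?e (Suc N) * w (Suc N))) + K * (?e N * w N)"
        using less.IH[of m] less.IH[of "Suc m"] X 3
        by (intro add_mono mult_left_mono) (auto simp: N_def)
      also have "\<dots> = K * ?e (Suc (Suc N)) * (w (Suc N) + \<kappa> / (real N * real (Suc N)) * w N)"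
      proof -
        have "q * (K * (a * b)) = K * (q * a) * b" "K * (q * a * b) = K * a * (q * b)" for q a b :: real
          by (simp_all add: mult_ac)
        note eqs = this
        show ?thesis unfolding eqs(1) e1[symmetric] e2 eqs(2) by (simp only: distrib_left)
      qed
      also have "\<dots> \<le> K * ?e (Suc (Suc N)) * (w (Suc N) + \<kappa> / (real N * real (Suc N)) * w (Suc N))"
        using K(1) ep wle k by (intro mult_left_mono add_left_mono) auto
      also have "\<dots> = K * ?e (Suc (Suc N)) * (w (Suc N) * (1 + \<kappa> / (real N * real (Suc N))))"
        by (simp add: algebra_simps)
      also have "\<dots> \<le> K * ?e (Suc (Suc N)) * (w (Suc N) * exp (\<kappa> / (real N * real (Suc N))))"
        using K(1) ep by (intro mult_left_mono exp_ge_add_one_self) (auto simp: w_def)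
      also have "\<dots> \<le> K * ?e (Suc (Suc N)) * w (Suc (Suc N))"
      proof -
        \<comment> \<open>The origin of the 3 in the weights:
          \<open>1 / (N (N + 1)) \<le> 3 / ((N + 1) (N + 2))\<close> amounts to
          \<open>N + 2 \<le> 3 N\<close>, true from \<open>N = 1\<close>, and the right side
          telescopes.\<close>
        have "\<kappa> * (1 / (real N * real (Suc N))) \<le> \<kappa> * (3 / real (Suc N) - 3 / real (Suc (Suc N)))"
        proof (rule mult_left_mono[OF _ k])
          have gen: "1 / (a * (a + 1)) \<le> 3 / (a + 1) - 3 / (a + 2)" if "a \<ge> 1" for a :: real
          proof -
            have "3 / (a + 1) - 3 / (a + 2) - 1 / (a * (a + 1)) = (2 * a - 2) / (a * (a + 1) * (a + 2))"
              using that by (simp add: divide_simps)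
            moreover have "0 \<le> (2 * a - 2) / (a * (a + 1) * (a + 2))"
              using that by (intro divide_nonneg_nonneg mult_nonneg_nonneg) auto
            ultimately show ?thesis by linarith
          qed
          have Suc_eq: "real (Suc N) = real N + 1" "real (Suc (Suc N)) = real N + 2" by simp_all
          show "1 / (real N * real (Suc N)) \<le> 3 / real (Suc N) - 3 / real (Suc (Suc N))"
            unfolding Suc_eq by (rule gen) (use N in simp)
        qed
        then have "- 3 * \<kappa> / real (Suc N) + \<kappa> / (real N * real (Suc N)) \<le> - 3 * \<kappa> / real (Suc (Suc N))"
          by (simp add: algebra_simps)
        then have "w (Suc N) * exp (\<kappa> / (real N * real (Suc N))) \<le> w (Suc (Suc N))"
          unfolding w_def by (simp only: exp_add[symmetric] exp_le_cancel_iff)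
        then show ?thesis using K(1) ep by (intro mult_left_mono) auto
      qed
      finally show ?thesis using 3 by (simp add: N_def mult.assoc)
    qed
  qed
  have "growth X n \<le> K * ?e n" for n
  proof (cases n)
    case 0
    then show ?thesis using K(1) by (simp add: growth_model_def)
  next
    case (Suc m)
    have "?e n * w n \<le> ?e n * 1"
      using growth_model_pos[OF X, of n] k by (intro mult_left_mono) (auto simp: w_def)
    then have "K * (?e n * w n) \<le> K * ?e n" using K(1) by (intro mult_left_mono) auto
    then show ?thesis using main[of m] Suc by simp
  qed
  then show ?thesis using K(1) by (intro exI[of _ K]) auto
qed

text \<open>In the recurrence of the lattice sums the real part of the points brings in an error of
  order \<open>n\<close>; this inequality charges it to the order \<open>n + 1\<close>, which
  carries the dominant coefficient.\<close>

lemma growth_le_Suc: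
  assumes X: "X > 0"
  shows "growth X n \<le> (1 + X) * (real (Suc n) * growth X (Suc n))"
proof (cases n)
  case (Suc m)
  have "2 * real (Suc m) / X * growth X (Suc m) \<le> growth X (Suc (Suc m))"
    using growth_pos[OF X, of m] by simp
  then have "2 * real (Suc m) * growth X (Suc m) \<le> X * growth X (Suc (Suc m))"
    using X by (simp add: field_simps)
  moreover have "1 * growth X (Suc m) \<le> 2 * real (Suc m) * growth X (Suc m)"
    using growth_pos[OF X, of "Suc m"] by (intro mult_right_mono) auto
  ultimately have "growth X (Suc m) \<le> X * growth X (Suc (Suc m))" by simp
  also have "\<dots> \<le> (1 + X) * (real (Suc (Suc m)) * growth X (Suc (Suc m)))"
    using mult_mono[of X "1 + X" "1 * growth X (Suc (Suc m))" "real (Suc (Suc m)) * growth X (Suc (Suc m))"]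
      growth_pos[OF X, of "Suc (Suc m)"] X by (simp add: mult_right_mono)
  finally show ?thesis using Suc by simp
qed (use X in simp)

text \<open>Powers of \<open>sgn z\<close> take the place of \<open>cis (n * Arg z)\<close>, so that
  the recurrence stays algebraic and no branch of the argument intervenes.\<close>

definition hankel_wave :: "nat \<Rightarrow> complex \<Rightarrow> complex" where
  "hankel_wave n z = hankel1 (int n) (cmod z) * sgn z ^ n"

lemma hankel1_nat: "hankel1 (int n) x = of_real (bessel_J_nat n x) + \<i> * of_real (bessel_Y_nat n x)"
  by (simp add: hankel1_def bessel_J_def bessel_Y_def)

lemma hankel1_recurrence:
  assumes "x > 0"
  shows "hankel1 (int (Suc (Suc n))) x
    = of_real (2 * real (Suc n) / x) * hankel1 (int (Suc n)) x - hankel1 (int n) x"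
proof -
  define q where "q = 2 * real (Suc n) / x"
  show ?thesis
    unfolding hankel1_nat bessel_J_nat_recurrence[OF assms] bessel_Y_nat_recurrence[OF assms] q_def[symmetric]
    by (simp add: algebra_simps)
qed

text \<open>The coefficient of the recurrence is largest at \<open>x = X\<close>, and the subtracted
  term is estimated by the triangle inequality; this is why \<open>growth\<close> has a plus
  sign.\<close>

lemma hankel1_decay:
  assumes X: "X > 0"
  shows "\<exists>B\<ge>0. \<forall>n. \<forall>x\<ge>X. norm (hankel1 (int n) x) \<le> B * growth X n / sqrt x"
proof -
  obtain B1 where B1: "B1 \<ge> 0" "\<And>x. x \<ge> X \<Longrightarrow> \<bar>bessel_J_nat 0 x\<bar> \<le> B1 / sqrt x"
    "\<And>x. x \<ge> X \<Longrightarrow> \<bar>bessel_J_nat 1 x\<bar> \<le> B1 / sqrt x"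
    using cylinder_decay[OF bessel_J_nat_0_deriv bessel_J_nat_1_deriv X] by auto
  obtain B2 where B2: "B2 \<ge> 0" "\<And>x. x \<ge> X \<Longrightarrow> \<bar>bessel_Y_nat 0 x\<bar> \<le> B2 / sqrt x"
    "\<And>x. x \<ge> X \<Longrightarrow> \<bar>bessel_Y_nat 1 x\<bar> \<le> B2 / sqrt x"
    using cylinder_decay[OF bessel_Y_nat_0_deriv bessel_Y_nat_1_deriv X] by auto
  define B where "B = B1 + B2"
  have le: "norm (hankel1 (int n) x) \<le> \<bar>bessel_J_nat n x\<bar> + \<bar>bessel_Y_nat n x\<bar>" for n x
    unfolding hankel1_nat by (rule order_trans[OF norm_triangle_ineq]) (simp add: norm_mult)
  have "norm (hankel1 (int n) x) \<le> B * growth X n / sqrt x" if x: "x \<ge> X" for n x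
  proof (induction n rule: induct_nat_012)
    case 0
    show ?case using le[of 0 x] B1(2)[OF x] B2(2)[OF x] by (simp add: B_def add_divide_distrib)
  next
    case 1
    show ?case using le[of 1 x] B1(3)[OF x] B2(3)[OF x] by (simp add: B_def add_divide_distrib)
  next
    case (ge2 n)
    have x0: "x > 0" using X x by simp
    let ?q = "\<lambda>x. 2 * real (Suc n) / x"
    have qx: "?q x \<ge> 0" using x0 by simp
    have "norm (of_real (?q x) * hankel1 (int (Suc n)) x) = ?q x * norm (hankel1 (int (Suc n)) x)"
      by (simp only: norm_mult norm_of_real abs_of_nonneg[OF qx])
    then have "norm (hankel1 (int (Suc (Suc n))) x) \<le> ?q x * norm (hankel1 (int (Suc n)) x) + norm (hankel1 (int n) x)"
      unfolding hankel1_recurrence[OF x0]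
      using norm_triangle_ineq4[of "of_real (?q x) * hankel1 (int (Suc n)) x" "hankel1 (int n) x"]
      by (simp only:)
    also have "\<dots> \<le> ?q X * (B * growth X (Suc n) / sqrt x) + B * growth X n / sqrt x"
      using ge2.IH X x x0 by (intro add_mono mult_mono divide_left_mono) auto
    also have "\<dots> = B * growth X (Suc (Suc n)) / sqrt x"
      by (simp add: distrib_left add_divide_distrib)
    finally show ?case .
  qed
  then show ?thesis using B1(1) B2(1) by (intro exI[of _ B]) (auto simp: B_def)
qed

text \<open>Every \<open>z\<close> is a root of \<open>t^2 - 2 Re z t + (cmod z)^2\<close>; here
  this equation is divided by \<open>(cmod z)^2\<close>.\<close>

lemma sgn_square: "sgn z ^ 2 = 2 * of_real (Re z / cmod z) * sgn z - 1" if "z \<noteq> 0" for z :: complex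
proof -
  have "z ^ 2 = 2 * of_real (Re z) * z - of_real (cmod z) ^ 2"
    using complex_norm_square[of z] complex_add_cnj[of z]
    by (simp add: power2_eq_square algebra_simps) (metis distrib_left mult.commute)
  then show ?thesis using that
    by (simp add: sgn_eq power_divide diff_divide_distrib power2_eq_square)
qed

text \<open>The minus sign of the Hankel recurrence meets
  \<open>sgn z ^ 2 = - 1 + O(1 / cmod z)\<close>. The wave of order \<open>n\<close> therefore
  returns with coefficient 1, and everything else has an extra factor
  \<open>1 / cmod z\<close>.\<close>

lemma hankel_wave_recurrence:
  assumes "z \<noteq> 0"
  shows "hankel_wave (Suc (Suc n)) z = hankel_wave n z + of_real (1 / cmod z) * sgn z *
    (2 * of_nat (Suc n) * hankel_wave (Suc n) z - 2 * of_real (Re z) * hankel_wave n z)"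
proof -
  define h1 h0 where "h1 = hankel1 (int (Suc n)) (cmod z)" and "h0 = hankel1 (int n) (cmod z)"
  define c :: complex where "c = of_real (1 / cmod z)"
  define q :: complex where "q = of_real (2 * real (Suc n) / cmod z)"
  have q: "q = 2 * c * of_nat (Suc n)" by (simp add: q_def c_def)
  have r: "of_real (Re z / cmod z) = c * of_real (Re z)" by (simp add: c_def)
  have rec: "hankel1 (int (Suc (Suc n))) (cmod z) = q * h1 - h0"
    unfolding q_def h1_def h0_def by (rule hankel1_recurrence) (use assms in simp)
  have "hankel_wave (Suc (Suc n)) z = q * h1 * sgn z ^ Suc n * sgn z - h0 * sgn z ^ n * (sgn z ^ 2)"
    unfolding hankel_wave_def rec by (simp add: algebra_simps power2_eq_square)
  also have "\<dots> = q * h1 * sgn z ^ Suc n * sgn z - h0 * sgn z ^ n * (2 * (c * of_real (Re z)) * sgn z - 1)"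
    unfolding sgn_square[OF assms] r ..
  also have "\<dots> = h0 * sgn z ^ n + c * sgn z *
    (2 * of_nat (Suc n) * (h1 * sgn z ^ Suc n) - 2 * of_real (Re z) * (h0 * sgn z ^ n))"
    unfolding q by (simp add: algebra_simps)
  finally show ?thesis unfolding hankel_wave_def h1_def h0_def c_def .
qed

lemma hankel_wave_lattice_sum:
  assumes delta: "\<delta> \<noteq> 0" and X: "X > 0"
    and le: "\<And>i. X \<le> cmod (vertical_pt w \<delta> i)"
    and beta: "norm \<beta> = 1" "\<beta> * cis \<bar>\<delta>\<bar> \<noteq> 1" "\<beta> * cis (- \<bar>\<delta>\<bar>) \<noteq> 1"
  shows "\<exists>K. \<forall>N. summable (\<lambda>i. \<beta> ^ i * hankel_wave N (vertical_pt w \<delta> i))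
     \<and> (\<forall>M. norm (\<Sum>i<M. \<beta> ^ i * hankel_wave N (vertical_pt w \<delta> i)) \<le> K * growth_model X N)"
proof -
  let ?z = "vertical_pt w \<delta>"
  have nz: "?z i \<noteq> 0" for i using le[of i] X by auto
  obtain B where B: "B \<ge> 0" "\<And>n x. x \<ge> X \<Longrightarrow> norm (hankel1 (int n) x) \<le> B * growth X n / sqrt x"
    using hankel1_decay[OF X] by blast
  define S where "S = (\<lambda>N M. \<Sum>i<M. \<beta> ^ i * hankel_wave N (?z i))"
  define q where "q = (\<lambda>i. 1 / (cmod (?z i) * sqrt (cmod (?z i))))"
  have q0: "q i \<ge> 0" for i by (simp add: q_def)
  have sq: "summable q" unfolding q_def by (rule vertical_pt_summable[OF delta])
  define r where "r = \<bar>Re w\<bar>"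
  define A where "A = (\<lambda>N. 2 * B * (real (Suc N) * growth X (Suc N) + r * growth X N))"
  define d where "d = (\<lambda>N i. \<beta> ^ i * (of_real (1 / cmod (?z i)) * sgn (?z i) *
    (2 * of_nat (Suc N) * hankel_wave (Suc N) (?z i) - 2 * of_real (Re w) * hankel_wave N (?z i))))"
  have wave_bound: "norm (hankel_wave N (?z i)) \<le> B * growth X N / sqrt (cmod (?z i))" for N i
    using B(2)[OF le, of N i] nz[of i] by (simp add: hankel_wave_def norm_mult norm_power norm_sgn)
  have d_bound: "norm (d N i) \<le> A N * q i" for N i
  proof -
    let ?u = "1 / sqrt (cmod (?z i))"
    have "norm (2 * of_nat (Suc N) * hankel_wave (Suc N) (?z i) - 2 * of_real (Re w) * hankel_wave N (?z i))
      \<le> 2 * real (Suc N) * norm (hankel_wave (Suc N) (?z i)) + 2 * r * norm (hankel_wave N (?z i))"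
      by (rule order_trans[OF norm_triangle_ineq4])
        (simp add: norm_mult r_def del: of_nat_Suc)
    also have "\<dots> \<le> 2 * real (Suc N) * (B * growth X (Suc N) * ?u) + 2 * r * (B * growth X N * ?u)"
      using wave_bound[of "Suc N" i] wave_bound[of N i] by (intro add_mono mult_left_mono) (auto simp: r_def)
    also have "\<dots> = A N * ?u" by (simp add: A_def algebra_simps add_divide_distrib)
    finally have "1 / cmod (?z i) * norm (2 * of_nat (Suc N) * hankel_wave (Suc N) (?z i)
        - 2 * of_real (Re w) * hankel_wave N (?z i)) \<le> 1 / cmod (?z i) * (A N * ?u)"
      by (intro mult_left_mono) auto
    moreover have "norm (sgn (?z i)) = 1" using nz[of i] by (simp add: norm_sgn)
    moreover have "norm (complex_of_real (1 / cmod (?z i))) = 1 / cmod (?z i)"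
      by (simp only: norm_of_real) simp
    ultimately have "norm (d N i) \<le> 1 / cmod (?z i) * (A N * ?u)"
      unfolding d_def by (simp only: norm_mult[of "\<beta> ^ i"] norm_mult[of "_ * sgn (?z i)"]
        norm_mult[of _ "sgn (?z i)"] norm_power beta(1) power_one mult_1_left mult_1_right)
    then show ?thesis by (simp add: q_def)
  qed
  have rec: "\<beta> ^ i * hankel_wave (Suc (Suc N)) (?z i) = \<beta> ^ i * hankel_wave N (?z i) + d N i" for N i
    unfolding d_def by (subst hankel_wave_recurrence[OF nz]) (simp add: distrib_left)
  have sd: "summable (d N)" for N
    by (rule summable_comparison_test[OF _ summable_mult[OF sq, of "A N"]]) (use d_bound in auto)
  have sum0: "summable (\<lambda>i. \<beta> ^ i * hankel_wave 0 (?z i))"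
    using summable_add[OF cylinder_lattice_sum(1)[OF delta bessel_J_nat_0_deriv bessel_J_nat_1_deriv nz beta]
       summable_mult[OF cylinder_lattice_sum(1)[OF delta bessel_Y_nat_0_deriv bessel_Y_nat_1_deriv nz beta], of \<i>]]
    by (simp add: hankel_wave_def hankel1_nat[of 0, simplified] algebra_simps)
  have sum1: "summable (\<lambda>i. \<beta> ^ i * hankel_wave 1 (?z i))"
    using summable_add[OF cylinder_lattice_sum(2)[OF delta bessel_J_nat_0_deriv bessel_J_nat_1_deriv nz beta]
       summable_mult[OF cylinder_lattice_sum(2)[OF delta bessel_Y_nat_0_deriv bessel_Y_nat_1_deriv nz beta], of \<i>]]
    by (simp add: hankel_wave_def hankel1_nat[of 1, simplified] algebra_simps)
  have summ: "summable (\<lambda>i. \<beta> ^ i * hankel_wave N (?z i))" for N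
  proof (induction N rule: induct_nat_012)
    case (ge2 n)
    show ?case unfolding rec by (intro summable_add ge2.IH(1) sd)
  qed (use sum0 sum1 in auto)
  \<comment> \<open>These bounds depend on \<open>N\<close>; they only start the induction, at the
    orders 0 and 1.\<close>
  have bd: "\<exists>T. \<forall>M. norm (S N M) \<le> T" for N
  proof -
    have "convergent (S N)" using summ[of N] unfolding summable_iff_convergent S_def .
    then have "Bseq (S N)" by (rule convergent_imp_Bseq)
    then show ?thesis by (rule BseqE) blast
  qed
  obtain T0 where T0: "\<forall>M. norm (S 0 M) \<le> T0" using bd[of 0] by (rule exE)
  obtain T1 where T1: "\<forall>M. norm (S 1 M) \<le> T1" using bd[of 1] by (rule exE)
  define Z where "Z = suminf q"
  have Z0: "Z \<ge> 0" unfolding Z_def by (intro suminf_nonneg sq q0)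
  \<comment> \<open>The last entry makes the correction \<open>A n * Z\<close> fit under
    \<open>G\<close> times the first summand in the recursion of \<open>growth\<close>, so that the
    same constant works at every order.\<close>
  define G where "G = max (max T0 T1) (Z * B * X * (1 + r * (1 + X)))"
  have r0: "r \<ge> 0" by (simp add: r_def)
  have G: "norm (S N M) \<le> G * growth X N" for N M
  proof (induction N rule: induct_nat_012)
    case 0 show ?case using T0[rule_format, of M] by (simp add: G_def)
  next
    case 1 show ?case using T1[rule_format, of M] by (simp add: G_def)
  next
    case (ge2 n)
    have S_step: "S (Suc (Suc n)) M = S n M + (\<Sum>i<M. d n i)"
      unfolding S_def rec by (rule sum.distrib)
    have "norm (\<Sum>i<M. d n i) \<le> A n * Z"
    proof -
      have "norm (\<Sum>i<M. d n i) \<le> (\<Sum>i<M. A n * q i)" by (intro sum_norm_le d_bound)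
      also have "\<dots> = A n * (\<Sum>i<M. q i)" by (simp add: sum_distrib_left)
      also have "\<dots> \<le> A n * Z" unfolding Z_def
        using sq q0 B(1) r0 growth_pos[OF X, of n] growth_pos[OF X, of "Suc n"]
        by (intro mult_left_mono sum_le_suminf) (auto simp: A_def)
      finally show ?thesis .
    qed
    then have "norm (S (Suc (Suc n)) M) \<le> G * growth X n + A n * Z"
      unfolding S_step using ge2.IH(1) norm_triangle_ineq[of "S n M" "\<Sum>i<M. d n i"] by linarith
    also have "A n * Z \<le> G * (2 * real (Suc n) / X * growth X (Suc n))"
    proof -
      let ?g = "real (Suc n) * growth X (Suc n)"
      have "r * growth X n \<le> r * ((1 + X) * ?g)"
        using growth_le_Suc[OF X, of n] r0 by (intro mult_left_mono)
      then have le: "?g + r * growth X n \<le> ?g + r * ((1 + X) * ?g)" by linarith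
      have "A n * Z \<le> 2 * B * (?g + r * ((1 + X) * ?g)) * Z"
        unfolding A_def by (rule mult_right_mono[OF mult_left_mono[OF le]]) (use B(1) Z0 in auto)
      also have "\<dots> = (Z * B * X * (1 + r * (1 + X))) * (2 / X * ?g)"
        using X by (simp add: field_simps)
      also have "\<dots> \<le> G * (2 / X * ?g)"
        using X growth_pos[OF X, of "Suc n"] by (intro mult_right_mono) (auto simp: G_def)
      finally show ?thesis by (simp only: times_divide_eq_left mult.assoc)
    qed
    finally show ?case by (simp add: algebra_simps)
  qed
  obtain K where K: "K > 0" "\<And>n. growth X n \<le> K * growth_model X n"
    using growth_le_model[OF X] by blast
  have "G \<ge> 0" using order_trans[OF norm_ge_zero T0[rule_format, of 0]] by (simp add: G_def)
  have "norm (S N M) \<le> (G * K) * growth_model X N" for N M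
    using G[of N M] mult_left_mono[OF K(2)[of N] \<open>G \<ge> 0\<close>] by (simp add: mult.assoc)
  then show ?thesis using summ unfolding S_def by blast
qed

section \<open>Interchanging the lattice sum with the tail of Graf's expansion\<close>

text \<open>The series over \<open>m\<close> may converge only conditionally, so there is no
  dominating double series. Tannery's theorem is applied to the partial sums over \<open>m\<close>
  instead, which \<open>b i\<close> dominates uniformly in their length.\<close>

lemma summable_interchange:
  fixes a :: "nat \<Rightarrow> nat \<Rightarrow> complex"
  assumes sa: "\<And>i. summable (a i)" and b: "\<And>i M. norm (\<Sum>m<M. a i m) \<le> b i" and sb: "summable b"
  shows "summable (\<lambda>i. a i m)" and "summable (\<lambda>m. \<Sum>i. a i m)" and "norm (\<Sum>m. \<Sum>i. a i m) \<le> suminf b"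
proof -
  have s: "summable (\<lambda>i. a i m)" for m
  proof (rule summable_comparison_test[OF _ summable_mult[OF sb, of 2]], intro exI allI impI)
    fix i :: nat
    \<comment> \<open>A single entry is a difference of two partial sums, hence the factor
      2.\<close>
    have "a i m = (\<Sum>m<Suc m. a i m) - (\<Sum>m<m. a i m)" by simp
    then show "norm (a i m) \<le> 2 * b i"
      using b[of i "Suc m"] b[of i m] norm_triangle_ineq4[of "\<Sum>m<Suc m. a i m" "\<Sum>m<m. a i m"] by simp
  qed
  show "summable (\<lambda>i. a i m)" by (rule s)
  have eq: "(\<Sum>m<M. \<Sum>i. a i m) = (\<Sum>i. \<Sum>m<M. a i m)" for M
    by (rule suminf_sum[symmetric]) (rule s)
  have "((\<lambda>M. \<Sum>i. \<Sum>m<M. a i m) \<longlonglongrightarrow> (\<Sum>i. \<Sum>m. a i m))"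
  proof (rule tannerys_theorem[THEN conjunct2, THEN conjunct2])
    show "(\<lambda>M. \<Sum>m<M. a i m) \<longlonglongrightarrow> (\<Sum>m. a i m)" for i by (rule summable_LIMSEQ[OF sa])
    show "eventually (\<lambda>(i, M). norm (\<Sum>m<M. a i m) \<le> b i) (at_top \<times>\<^sub>F sequentially)"
      by (intro always_eventually) (auto simp: b)
  qed (use sb in auto)
  then have lim: "(\<lambda>m. \<Sum>i. a i m) sums (\<Sum>i. \<Sum>m. a i m)"
    unfolding sums_def eq .
  then show "summable (\<lambda>m. \<Sum>i. a i m)" by (rule sums_summable)
  have "norm (\<Sum>m<M. \<Sum>i. a i m) \<le> suminf b" for M
    unfolding eq by (rule norm_suminf_le[OF b sb])
  then have "norm (\<Sum>i. \<Sum>m. a i m) \<le> suminf b"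
    by (intro LIMSEQ_le_const2[OF tendsto_norm[OF lim[unfolded sums_def]]]) auto
  then show "norm (\<Sum>m. \<Sum>i. a i m) \<le> suminf b" using sums_unique[OF lim] by simp
qed

section \<open>Waves of all integer orders and the two tails of Graf's expansion\<close>

definition graf_wave :: "int \<Rightarrow> complex \<Rightarrow> complex" where
  "graf_wave N z = hankel1 N (cmod z) * cis (of_int N * Arg z)"

lemma graf_wave_nonneg: "z \<noteq> 0 \<Longrightarrow> graf_wave (int n) z = hankel_wave n z"
  by (simp add: graf_wave_def hankel_wave_def cis_Arg[symmetric] Complex.DeMoivre)

lemma hankel1_minus: "hankel1 (- int n) x = (-1) ^ n * hankel1 (int n) x"
  by (cases "n = 0") (simp_all add: hankel1_def bessel_J_def bessel_Y_def algebra_simps)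

text \<open>A negative order reverses the phase, which amounts to conjugating the point. Conjugation
  turns a vertical half-lattice into one with step \<open>- \<delta>\<close>, while the
  non-resonance conditions see only \<open>\<bar>\<delta>\<bar>\<close>.\<close>

lemma graf_wave_minus: "z \<noteq> 0 \<Longrightarrow> graf_wave (- int n) z = (-1) ^ n * hankel_wave n (cnj z)"
proof -
  assume z: "z \<noteq> 0"
  have "sgn (cnj z) = cnj (cis (Arg z))" using z by (simp add: cis_Arg sgn_eq)
  then have "sgn (cnj z) ^ n = cis (- (real n * Arg z))"
    by (simp add: cis_cnj Complex.DeMoivre)
  then show ?thesis by (simp add: graf_wave_def hankel_wave_def hankel1_minus)
qed

lemma cnj_vertical_pt: "cnj (vertical_pt w \<delta> i) = vertical_pt (cnj w) (- \<delta>) i"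
  by (simp add: vertical_pt_def)

lemma graf_wave_lattice_sum:
  assumes delta: "\<delta> \<noteq> 0" and X: "X > 0"
    and le: "\<And>i. X \<le> cmod (vertical_pt w \<delta> i)"
    and beta: "norm \<beta> = 1" "\<beta> * cis \<bar>\<delta>\<bar> \<noteq> 1" "\<beta> * cis (- \<bar>\<delta>\<bar>) \<noteq> 1"
  shows "\<exists>K\<ge>0. \<forall>N. summable (\<lambda>i. \<beta> ^ i * graf_wave N (vertical_pt w \<delta> i))
     \<and> (\<forall>M. norm (\<Sum>i<M. \<beta> ^ i * graf_wave N (vertical_pt w \<delta> i)) \<le> K * growth_model X (nat \<bar>N\<bar>))"
proof -
  have nz: "vertical_pt w \<delta> i \<noteq> 0" for i using le[of i] X by auto
  obtain K1 where K1: "\<And>N. summable (\<lambda>i. \<beta> ^ i * hankel_wave N (vertical_pt w \<delta> i))"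
     "\<And>N M. norm (\<Sum>i<M. \<beta> ^ i * hankel_wave N (vertical_pt w \<delta> i)) \<le> K1 * growth_model X N"
    using hankel_wave_lattice_sum[OF delta X le beta] by blast
  have "X \<le> cmod (vertical_pt (cnj w) (- \<delta>) i)" for i
    using le[of i] by (simp add: cnj_vertical_pt[symmetric])
  then obtain K2 where K2: "\<And>N. summable (\<lambda>i. \<beta> ^ i * hankel_wave N (cnj (vertical_pt w \<delta> i)))"
     "\<And>N M. norm (\<Sum>i<M. \<beta> ^ i * hankel_wave N (cnj (vertical_pt w \<delta> i))) \<le> K2 * growth_model X N"
    using hankel_wave_lattice_sum[of "- \<delta>" X "cnj w" \<beta>] delta X beta
    by (auto simp: cnj_vertical_pt)
  define K where "K = max 0 (max K1 K2)"
  have "summable (\<lambda>i. \<beta> ^ i * graf_wave N (vertical_pt w \<delta> i))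
     \<and> (\<forall>M. norm (\<Sum>i<M. \<beta> ^ i * graf_wave N (vertical_pt w \<delta> i)) \<le> K * growth_model X (nat \<bar>N\<bar>))" for N
  proof (cases "N \<ge> 0")
    case True
    then obtain n where n: "N = int n" by (metis nonneg_int_cases)
    have "K1 * growth_model X n \<le> K * growth_model X n"
      using growth_model_pos[OF X, of n] by (intro mult_right_mono) (auto simp: K_def)
    then have "norm (\<Sum>i<M. \<beta> ^ i * hankel_wave n (vertical_pt w \<delta> i)) \<le> K * growth_model X n" for M
      using K1(2)[of n M] by (rule order_trans[rotated])
    then show ?thesis using K1(1)[of n] by (simp add: n graf_wave_nonneg[OF nz])
  next
    case False
    define n where "n = nat (- N)"
    have n: "N = - int n" using False by (simp add: n_def)
    have "K2 * growth_model X n \<le> K * growth_model X n"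
      using growth_model_pos[OF X, of n] by (intro mult_right_mono) (auto simp: K_def)
    then have bd: "norm (\<Sum>i<M. \<beta> ^ i * hankel_wave n (cnj (vertical_pt w \<delta> i))) \<le> K * growth_model X n" for M
      using K2(2)[of n M] by simp
    have eq: "\<beta> ^ i * graf_wave N (vertical_pt w \<delta> i) = (-1) ^ n * (\<beta> ^ i * hankel_wave n (cnj (vertical_pt w \<delta> i)))" for i
      by (simp add: n graf_wave_minus[OF nz])
    show ?thesis unfolding eq sum_distrib_left[symmetric]
      using bd K2(1)[of n] by (simp add: norm_mult norm_power n)
  qed
  then show ?thesis by (intro exI[of _ K]) (auto simp: K_def)
qed

lemma bessel_J_bound:
  assumes "x \<ge> 0"
  shows "\<bar>bessel_J n x\<bar> \<le> exp ((x / 2)\<^sup>2) * (x / 2) ^ nat \<bar>n\<bar> / fact (nat \<bar>n\<bar>)"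
  using bessel_J_nat_bound[OF assms] by (auto simp: bessel_J_def abs_mult power_abs)

text \<open>Up to a constant, this bounds \<open>H (n + q) * J q\<close> at arguments at least \<open>X\<close> and equal to \<open>2 * Y\<close>.\<close>
definition graf_majorant :: "real \<Rightarrow> real \<Rightarrow> int \<Rightarrow> nat \<Rightarrow> real" where
  "graf_majorant X Y n q = growth_model X (nat \<bar>n + int q\<bar>) * Y ^ q / fact q"

lemma graf_majorant_nonneg: "X > 0 \<Longrightarrow> Y \<ge> 0 \<Longrightarrow> graf_majorant X Y n q \<ge> 0"
  using growth_model_pos[of X "nat \<bar>n + int q\<bar>"] by (simp add: graf_majorant_def)

lemma summable_graf_majorant:
  assumes X: "X > 0" and Y: "Y \<ge> 0" and less: "2 * Y / X < 1"
  shows "summable (graf_majorant X Y n)"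
proof -
  define r where "r = 2 * Y / X"
  have r: "r \<ge> 0" "r < 1" using assms by (auto simp: r_def)
  define c where "c = (1 + r) / 2"
  have c: "c < 1" "r < c" "c > 0" using r by (auto simp: c_def)
  \<comment> \<open>The first threshold makes \<open>n + int q\<close> positive and so removes the
    absolute value in the order; the second gives
    \<open>r * (\<bar>n\<bar> + q) \<le> c * q\<close>, which bounds the ratio of consecutive
    terms.\<close>
  have "eventually (\<lambda>q. real q \<ge> max (\<bar>real_of_int n\<bar> + 1) (r * \<bar>real_of_int n\<bar> / (c - r))) sequentially"
    using filterlim_real_sequentially unfolding filterlim_at_top by blast
  then obtain N where N: "\<And>q. q \<ge> N \<Longrightarrow> real q \<ge> max (\<bar>real_of_int n\<bar> + 1) (r * \<bar>real_of_int n\<bar> / (c - r))"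
    unfolding eventually_sequentially by blast
  show ?thesis
  proof (rule summable_ratio_test[OF c(1)])
    fix q assume q: "N \<le> q"
    have q1: "real q \<ge> \<bar>real_of_int n\<bar> + 1" and q2: "real q \<ge> r * \<bar>real_of_int n\<bar> / (c - r)"
      using N[OF q] by auto
    have pos: "n + int q > 0" using q1 by linarith
    define m where "m = nat (n + int q)"
    have m: "m > 0" "nat \<bar>n + int q\<bar> = m" "nat \<bar>n + int (Suc q)\<bar> = Suc m" "real m = real_of_int n + real q"
      using pos by (auto simp: m_def)
    have "graf_majorant X Y n (Suc q) = r * real m / real (Suc q) * graf_majorant X Y n q"
      unfolding graf_majorant_def m growth_model_Suc[OF m(1)] r_def by (simp add: field_simps)
    also have "\<dots> \<le> c * graf_majorant X Y n q"
    proof (rule mult_right_mono[OF _ graf_majorant_nonneg[OF X Y]])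
      have "r * \<bar>real_of_int n\<bar> \<le> (c - r) * real q" using q2 c by (simp add: field_simps)
      moreover have "r * real m \<le> r * (\<bar>real_of_int n\<bar> + real q)"
        unfolding m using r by (intro mult_left_mono) auto
      ultimately have "r * real m \<le> c * real q" by (simp add: algebra_simps)
      also have "\<dots> \<le> c * real (Suc q)" using c by (intro mult_left_mono) auto
      finally show "r * real m / real (Suc q) \<le> c" by (simp add: pos_divide_le_eq)
    qed
    finally show "norm (graf_majorant X Y n (Suc q)) \<le> c * norm (graf_majorant X Y n q)"
      using graf_majorant_nonneg[OF X Y] by simp
  qed
qed

lemma half_lattice_graf_sum:
  assumes delta: "\<delta> \<noteq> 0" and X: "X > 0"
    and le: "\<And>i. X \<le> cmod (vertical_pt w \<delta> i)"
    and beta: "norm \<beta> = 1" "\<beta> * cis \<bar>\<delta>\<bar> \<noteq> 1" "\<beta> * cis (- \<bar>\<delta>\<bar>) \<noteq> 1"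
    and less: "cmod y < X"
  defines "B \<equiv> \<lambda>n p. \<Sum>i. graf_majorant X (cmod y / 2) n (p + 1 + i)"
  shows "\<exists>K\<ge>0. \<forall>n p. summable (\<lambda>i. \<beta> ^ i * graf_remainder n p (vertical_pt w \<delta> i) y)
    \<and> norm (\<Sum>i. \<beta> ^ i * graf_remainder n p (vertical_pt w \<delta> i) y) \<le> K * (B n p + B (- n) p)"
proof -
  let ?z = "vertical_pt w \<delta>"
  define Y where "Y = cmod y / 2"
  have Y: "Y \<ge> 0" "2 * Y / X < 1" using less X by (auto simp: Y_def)
  obtain K where K0: "K \<ge> 0" and Ks: "\<And>N. summable (\<lambda>i. \<beta> ^ i * graf_wave N (?z i))"
     and Kb: "\<And>N M. norm (\<Sum>i<M. \<beta> ^ i * graf_wave N (?z i)) \<le> K * growth_model X (nat \<bar>N\<bar>)"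
    using graf_wave_lattice_sum[OF delta X le beta] by blast
  define C where "C = K * exp (Y\<^sup>2)"
  define c where "c = (\<lambda>q. of_real (bessel_J q (cmod y)) * cis (- (of_int q * Arg y)))"
  have c: "norm (c q) \<le> exp (Y\<^sup>2) * Y ^ nat \<bar>q\<bar> / fact (nat \<bar>q\<bar>)" for q
    using bessel_J_bound[of "cmod y" q] by (simp add: c_def norm_mult Y_def)
  have graf_term_eq: "graf_term n z y q = graf_wave (n + q) z * c q" for n z q
    by (simp add: graf_term_def graf_wave_def c_def mult.assoc)
  \<comment> \<open>One argument for both tails: \<open>\<nu>\<close> enumerates the indices, and
    since only \<open>\<bar>n + \<nu> i\<bar>\<close> enters the bound, the lower tail for the order
    \<open>n\<close> is estimated like the upper tail for \<open>n' = - n\<close>.\<close>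
  have gen: "(\<forall>m. summable (\<lambda>i. graf_term n (?z m) y (\<nu> i))) \<and>
      summable (\<lambda>m. \<beta> ^ m * (\<Sum>i. graf_term n (?z m) y (\<nu> i))) \<and>
      norm (\<Sum>m. \<beta> ^ m * (\<Sum>i. graf_term n (?z m) y (\<nu> i))) \<le> C * B n' p"
    if \<nu>: "\<And>i. nat \<bar>\<nu> i\<bar> = p + 1 + i" "\<And>i. nat \<bar>n + \<nu> i\<bar> = nat \<bar>n' + int (p + 1 + i)\<bar>" for n n' p \<nu>
  proof -
    define a where "a = (\<lambda>i m. \<beta> ^ m * graf_wave (n + \<nu> i) (?z m) * c (\<nu> i))"
    define b where "b = (\<lambda>i. C * graf_majorant X Y n' (p + 1 + i))"
    have sa: "summable (a i)" for i unfolding a_def by (intro summable_mult2 Ks)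
    have ab: "norm (\<Sum>m<M. a i m) \<le> b i" for i M
    proof -
      have "norm (\<Sum>m<M. a i m) = norm (\<Sum>m<M. \<beta> ^ m * graf_wave (n + \<nu> i) (?z m)) * norm (c (\<nu> i))"
        unfolding a_def sum_distrib_right[symmetric] by (simp add: norm_mult)
      also have "\<dots> \<le> (K * growth_model X (nat \<bar>n + \<nu> i\<bar>)) * (exp (Y\<^sup>2) * Y ^ nat \<bar>\<nu> i\<bar> / fact (nat \<bar>\<nu> i\<bar>))"
        by (intro mult_mono Kb c) (use K0 growth_model_pos[OF X] less_imp_le in \<open>auto intro!: mult_nonneg_nonneg\<close>)
      also have "\<dots> = b i" unfolding \<nu> b_def C_def graf_majorant_def by simp
      finally show ?thesis .
    qed
    have sm: "summable (\<lambda>i. graf_majorant X Y n' (p + 1 + i))"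
      using summable_ignore_initial_segment[OF summable_graf_majorant[OF X Y, of n'], of "p + 1"]
      by (simp add: add.commute add.left_commute)
    have sb: "summable b" unfolding b_def by (rule summable_mult[OF sm])
    have suma: "summable (\<lambda>i. a i m)" for m by (rule summable_interchange(1)[OF sa ab sb])
    have nzp: "\<beta> ^ m \<noteq> 0" for m using beta(1) by auto
    have s: "summable (\<lambda>i. graf_term n (?z m) y (\<nu> i))" for m
    proof -
      have "graf_term n (?z m) y (\<nu> i) = inverse (\<beta> ^ m) * a i m" for i
        by (simp only: a_def graf_term_eq mult.assoc[symmetric] left_inverse[OF nzp] mult_1_left)
      then show ?thesis using summable_mult[OF suma[of m], of "inverse (\<beta> ^ m)"] by simp
    qed
    have eq: "\<beta> ^ m * (\<Sum>i. graf_term n (?z m) y (\<nu> i)) = (\<Sum>i. a i m)" for m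
      by (subst suminf_mult[OF s, symmetric]) (simp add: a_def graf_term_eq mult.assoc)
    have "suminf b = C * B n' p"
      unfolding b_def B_def Y_def[symmetric] by (rule suminf_mult[OF sm])
    then show ?thesis
      unfolding eq using s summable_interchange(2,3)[OF sa ab sb] by simp
  qed
  have main: "summable (\<lambda>i. \<beta> ^ i * graf_remainder n p (?z i) y)
    \<and> norm (\<Sum>i. \<beta> ^ i * graf_remainder n p (?z i) y) \<le> C * (B n p + B (- n) p)" for n p
  proof -
    have g1: "summable (\<lambda>m. \<beta> ^ m * (\<Sum>i. graf_term n (?z m) y (int p + 1 + int i)))"
      "norm (\<Sum>m. \<beta> ^ m * (\<Sum>i. graf_term n (?z m) y (int p + 1 + int i))) \<le> C * B n p"
      using gen[of "\<lambda>i. int p + 1 + int i" p n n] by (auto simp: nat_add_distrib algebra_simps)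
    have g2: "summable (\<lambda>m. \<beta> ^ m * (\<Sum>i. graf_term n (?z m) y (- int p - 1 - int i)))"
      "norm (\<Sum>m. \<beta> ^ m * (\<Sum>i. graf_term n (?z m) y (- int p - 1 - int i))) \<le> C * B (- n) p"
      using gen[of "\<lambda>i. - int p - 1 - int i" p n "- n"] by (auto simp: nat_add_distrib algebra_simps)
    have "\<beta> ^ i * graf_remainder n p (?z i) y
      = \<beta> ^ i * (\<Sum>k. graf_term n (?z i) y (int p + 1 + int k)) + \<beta> ^ i * (\<Sum>k. graf_term n (?z i) y (- int p - 1 - int k))" for i
      by (simp add: graf_remainder_def distrib_left)
    then show ?thesis
      using summable_add[OF g1(1) g2(1)] suminf_add[OF g1(1) g2(1), symmetric] g1(2) g2(2)
        norm_triangle_ineq[of "\<Sum>m. \<beta> ^ m * (\<Sum>i. graf_term n (?z m) y (int p + 1 + int i))"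
          "\<Sum>m. \<beta> ^ m * (\<Sum>i. graf_term n (?z m) y (- int p - 1 - int i))"]
      by (simp add: distrib_left)
  qed
  have "C \<ge> 0" using K0 by (simp add: C_def)
  then show ?thesis using main by blast
qed

section \<open>The truncation error\<close>

lemma fact_add_eq_prod:
  assumes "q > 0"
  shows "(fact (n + q - 1) :: real) = fact (q - 1) * (\<Prod>i<n. real q + real i)"
proof (induction n)
  case (Suc n)
  have "Suc n + q - 1 = Suc (n + q - 1)" using assms by simp
  then have "(fact (Suc n + q - 1) :: real) = real (n + q) * fact (n + q - 1)"
    using assms fact_reduce[of "n + q", where 'a = real] by simp
  then show ?case using Suc.IH by (simp add: algebra_simps)
qed simp

text \<open>Pairing the factors \<open>q + i\<close> and \<open>q + n - 1 - i\<close>, whose product is at most \<open>(3 q / 2)\<^sup>2\<close>.\<close>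
lemma prod_le_three_halves_power:
  assumes "n \<le> q"
  shows "(\<Prod>i<n. real q + real i) \<le> (3 * real q / 2) ^ n"
proof -
  let ?P = "\<Prod>i<n. real q + real i"
  have "?P = (\<Prod>i<n. real q + real (n - Suc i))"
    by (rule prod.nat_diff_reindex[symmetric])
  then have "?P ^ 2 = (\<Prod>i<n. (real q + real i) * (real q + real (n - Suc i)))"
    by (simp add: power2_eq_square prod.distrib)
  also have "\<dots> \<le> (\<Prod>i<n. (3 * real q / 2) ^ 2)"
  proof (intro prod_mono conjI)
    fix i assume i: "i \<in> {..<n}"
    have "4 * (a * b) \<le> (a + b) ^ 2" for a b :: real
      using zero_le_power2[of "a - b"] by (simp add: power2_eq_square algebra_simps)
    then have "4 * ((real q + real i) * (real q + real (n - Suc i)))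
        \<le> ((real q + real i) + (real q + real (n - Suc i))) ^ 2" .
    moreover have "real i + real (n - Suc i) = real (n - 1)" using i by (simp flip: of_nat_add)
    then have "(real q + real i) + (real q + real (n - Suc i)) = 2 * real q + real (n - 1)" by linarith
    ultimately have "4 * ((real q + real i) * (real q + real (n - Suc i))) \<le> (2 * real q + real (n - 1)) ^ 2"
      by (simp only:)
    also have "\<dots> \<le> (3 * real q) ^ 2"
      using assms by (intro power_mono) auto
    finally show "(real q + real i) * (real q + real (n - Suc i)) \<le> (3 * real q / 2) ^ 2"
      by (simp add: power2_eq_square)
  qed auto
  also have "\<dots> = ((3 * real q / 2) ^ n) ^ 2" by (simp add: power_mult[symmetric] mult.commute)
  finally show ?thesis by (rule power2_le_imp_le) simp
qed

lemma sum_power_fact_le_exp: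
  fixes x :: real assumes "x \<ge> 0" shows "(\<Sum>n\<le>p. x ^ n / fact n) \<le> exp x"
proof -
  have "(\<Sum>n\<le>p. inverse (fact n) * x ^ n) \<le> (\<Sum>n. inverse (fact n) * x ^ n)"
    using assms by (intro sum_le_suminf summable_exp) auto
  then show ?thesis by (simp add: exp_def field_simps)
qed

text \<open>After the factorials are replaced by \<open>(3 q / 2) ^ n / q\<close>, the sum over
  \<open>n\<close> is a partial sum of the series of \<open>exp (3 q s / X)\<close>. This is the
  \<open>q\<close>-th power of the exponential that appears in the rate.\<close>

lemma sum_graf_majorant_nonneg_order:
  assumes X: "X > 0" and Y: "Y \<ge> 0" and s: "s \<ge> 0" and q: "q > 0" "p \<le> q"
  shows "(\<Sum>n\<le>p. graf_majorant X Y (int n) q * (s ^ n / fact n)) \<le> (2 * Y / X * exp (3 * s / X)) ^ q / real q"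
proof -
  define a where "a = (2 * Y / X) ^ q / real q"
  define b where "b = 3 * real q * s / X"
  have a: "a \<ge> 0" using X Y by (simp add: a_def)
  have "(\<Sum>n\<le>p. graf_majorant X Y (int n) q * (s ^ n / fact n)) \<le> (\<Sum>n\<le>p. a * (b ^ n / fact n))"
  proof (rule sum_mono)
    fix n assume "n \<in> {..p}"
    then have n: "n \<le> q" using q by simp
    have "(fact (n + q - 1) :: real) \<le> fact (q - 1) * (3 * real q / 2) ^ n"
      unfolding fact_add_eq_prod[OF q(1)] by (intro mult_left_mono prod_le_three_halves_power n) auto
    then have f: "fact (n + q - 1) / fact q \<le> (3 * real q / 2) ^ n / real q"
      using q(1) by (simp add: fact_reduce[of q] divide_simps mult_ac)
    have e: "graf_majorant X Y (int n) q * (s ^ n / fact n)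
       = (fact (n + q - 1) / fact q) * ((2 * Y / X) ^ q * (2 * s / X) ^ n / fact n)"
      by (simp add: graf_majorant_def growth_model_def nat_add_distrib power_add power_mult_distrib power_divide mult_ac flip: of_nat_add)
    also have "\<dots> \<le> ((3 * real q / 2) ^ n / real q) * ((2 * Y / X) ^ q * (2 * s / X) ^ n / fact n)"
      using X Y s by (intro mult_right_mono f) auto
    also have "\<dots> = a * (((3 * real q / 2) * (2 * s / X)) ^ n / fact n)"
      unfolding a_def power_mult_distrib by simp
    also have "(3 * real q / 2) * (2 * s / X) = b" by (simp add: b_def)
    finally show "graf_majorant X Y (int n) q * (s ^ n / fact n) \<le> a * (b ^ n / fact n)" .
  qed
  also have "\<dots> = a * (\<Sum>n\<le>p. b ^ n / fact n)" by (simp add: sum_distrib_left)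
  also have "\<dots> \<le> a * exp b" using a X s by (intro mult_left_mono sum_power_fact_le_exp) (auto simp: b_def)
  also have "exp b = exp (3 * s / X) ^ q"
    by (simp add: b_def exp_of_nat_mult[symmetric] mult_ac)
  also have "a * exp (3 * s / X) ^ q = (2 * Y / X * exp (3 * s / X)) ^ q / real q"
    unfolding a_def power_mult_distrib by simp
  finally show ?thesis .
qed

text \<open>The Hankel order is now \<open>q - n\<close>, so the factorial is at most
  \<open>(q - 1)!\<close> and a power \<open>(X / 2) ^ n\<close> appears. The sum over
  \<open>n\<close> costs only a constant; the exponential of the rate is inserted to match the other
  sign.\<close>

lemma sum_graf_majorant_neg_order:
  assumes X: "X > 0" and Y: "Y \<ge> 0" and s: "s \<ge> 0" and q: "p < q"
  shows "(\<Sum>n\<le>p. graf_majorant X Y (- int n) q * (s ^ n / fact n))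
    \<le> exp (X * s / 2) * ((2 * Y / X * exp (3 * s / X)) ^ q / real q)"
proof -
  define a where "a = (2 * Y / X) ^ q / real q"
  define b where "b = X * s / 2"
  have a: "a \<ge> 0" using X Y by (simp add: a_def)
  have "(\<Sum>n\<le>p. graf_majorant X Y (- int n) q * (s ^ n / fact n)) \<le> (\<Sum>n\<le>p. a * (b ^ n / fact n))"
  proof (rule sum_mono)
    fix n assume "n \<in> {..p}"
    then have n: "n < q" using q by simp
    have na: "nat \<bar>- int n + int q\<bar> = q - n" using n by simp
    have "(fact (q - n - 1) :: real) \<le> fact (q - 1)" by (intro fact_mono) simp
    then have f: "fact (q - n - 1) / fact q \<le> 1 / real q"
      using n by (simp add: fact_reduce[of q] divide_simps mult_ac)
    have p: "(2 / X) ^ (q - n) = (2 / X) ^ q * (X / 2) ^ n"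
    proof -
      have "(2 / X) ^ q = (2 / X) ^ (q - n) * (2 / X) ^ n"
        using n by (simp add: power_add[symmetric])
      then show ?thesis using X by (simp add: power_divide)
    qed
    have "graf_majorant X Y (- int n) q * (s ^ n / fact n)
       = (fact (q - n - 1) / fact q) * ((2 * Y / X) ^ q * b ^ n / fact n)"
      unfolding graf_majorant_def na growth_model_def p b_def
      by (simp add: power_mult_distrib power_divide mult_ac)
    also have "\<dots> \<le> (1 / real q) * ((2 * Y / X) ^ q * b ^ n / fact n)"
      using X Y s by (intro mult_right_mono f) (auto simp: b_def)
    also have "\<dots> = a * (b ^ n / fact n)" by (simp add: a_def)
    finally show "graf_majorant X Y (- int n) q * (s ^ n / fact n) \<le> a * (b ^ n / fact n)" .
  qed
  also have "\<dots> = a * (\<Sum>n\<le>p. b ^ n / fact n)" by (simp add: sum_distrib_left)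
  also have "\<dots> \<le> a * exp b" using a X s by (intro mult_left_mono sum_power_fact_le_exp) (auto simp: b_def)
  also have "\<dots> \<le> ((2 * Y / X * exp (3 * s / X)) ^ q / real q) * exp b"
  proof (intro mult_right_mono)
    have "2 * Y / X * 1 \<le> 2 * Y / X * exp (3 * s / X)" using X Y s by (intro mult_left_mono) auto
    then show "a \<le> (2 * Y / X * exp (3 * s / X)) ^ q / real q"
      unfolding a_def using X Y by (intro divide_right_mono power_mono) auto
  qed auto
  finally show ?thesis by (simp add: b_def mult.commute)
qed

text \<open>Order 0 is counted twice, which is harmless for nonnegative terms.\<close>

lemma sum_symmetric_interval_le:
  fixes f :: "int \<Rightarrow> real"
  assumes "\<And>n. f n \<ge> 0"
  shows "(\<Sum>n\<in>{- int p..int p}. f n) \<le> (\<Sum>n\<le>p. f (int n)) + (\<Sum>n\<le>p. f (- int n))"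
proof -
  have sub: "{- int p..int p} \<subseteq> int ` {..p} \<union> (\<lambda>n. - int n) ` {..p}"
  proof
    fix n assume "n \<in> {- int p..int p}"
    then have "(n = int (nat n) \<and> nat n \<le> p) \<or> (n = - int (nat (- n)) \<and> nat (- n) \<le> p)" by auto
    then show "n \<in> int ` {..p} \<union> (\<lambda>n. - int n) ` {..p}" by blast
  qed
  have "(\<Sum>n\<in>{- int p..int p}. f n) \<le> sum f (int ` {..p} \<union> (\<lambda>n. - int n) ` {..p})"
    by (rule sum_mono2[OF _ sub]) (auto simp: assms)
  also have "\<dots> \<le> sum f (int ` {..p}) + sum f ((\<lambda>n. - int n) ` {..p})"
    using sum.union_inter[of "int ` {..p}" "(\<lambda>n. - int n) ` {..p}" f]
      sum_nonneg[of "int ` {..p} \<inter> (\<lambda>n. - int n) ` {..p}" f] assms by simp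
  also have "\<dots> = (\<Sum>n\<le>p. f (int n)) + (\<Sum>n\<le>p. f (- int n))"
    by (simp add: sum.reindex inj_on_def)
  finally show ?thesis .
qed

lemma sum_graf_tail_le:
  assumes X: "X > 0" and Y: "Y \<ge> 0" and s: "s \<ge> 0"
  defines "\<mu> \<equiv> 2 * Y / X * exp (3 * s / X)"
  defines "B \<equiv> \<lambda>n p. \<Sum>i. graf_majorant X Y n (p + 1 + i)"
  assumes mu: "\<mu> < 1"
  shows "\<exists>C\<ge>0. \<forall>p\<ge>1. (\<Sum>n\<in>{- int p..int p}. (B n p + B (- n) p) * (s ^ nat \<bar>n\<bar> / fact (nat \<bar>n\<bar>)))
    \<le> C * (\<mu> ^ p / real p)"
proof -
  define w where "w = (\<lambda>n::int. s ^ nat \<bar>n\<bar> / fact (nat \<bar>n\<bar>))"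
  have w: "w n \<ge> 0" for n using s by (simp add: w_def)
  define h where "h = (\<lambda>n q. graf_majorant X Y n q + graf_majorant X Y (- n) q)"
  \<comment> \<open>The 2 arises because \<open>h\<close> already pairs \<open>n\<close> with
    \<open>- n\<close> while the sum runs over both signs.\<close>
  define D where "D = 2 * (1 + exp (X * s / 2))"
  have D: "D \<ge> 0" by (simp add: D_def)
  have mu0: "\<mu> \<ge> 0" using X Y by (simp add: \<mu>_def)
  have less: "2 * Y / X < 1"
  proof -
    have "2 * Y / X * 1 \<le> \<mu>" unfolding \<mu>_def using X Y s by (intro mult_left_mono) auto
    then show ?thesis using mu by simp
  qed
  have hw: "(\<Sum>n\<in>{- int p..int p}. h n q * w n) \<le> D * (\<mu> ^ q / real q)" if "p < q" for p q
  proof -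
    have "(\<Sum>n\<in>{- int p..int p}. h n q * w n) \<le> (\<Sum>n\<le>p. h (int n) q * w (int n)) + (\<Sum>n\<le>p. h (- int n) q * w (- int n))"
      using graf_majorant_nonneg[OF X Y] w
      by (intro sum_symmetric_interval_le mult_nonneg_nonneg) (auto simp: h_def)
    also have "\<dots> = 2 * ((\<Sum>n\<le>p. graf_majorant X Y (int n) q * (s ^ n / fact n))
        + (\<Sum>n\<le>p. graf_majorant X Y (- int n) q * (s ^ n / fact n)))"
    proof -
      have e: "nat \<bar>int n\<bar> = n" "nat \<bar>- int n\<bar> = n" for n by simp_all
      have gen: "u + v + (v + u) = 2 * (u + v)" for u v :: real by simp
      show ?thesis
        by (simp only: h_def w_def e minus_minus distrib_right sum.distrib gen)
    qed
    also have "\<dots> \<le> 2 * (\<mu> ^ q / real q + exp (X * s / 2) * (\<mu> ^ q / real q))"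
      unfolding \<mu>_def using that
      by (intro mult_left_mono add_mono sum_graf_majorant_nonneg_order sum_graf_majorant_neg_order X Y s) auto
    finally show ?thesis by (simp add: D_def algebra_simps)
  qed
  have sm: "summable (\<lambda>i. graf_majorant X Y n (p + 1 + i))" for n p
    using summable_ignore_initial_segment[OF summable_graf_majorant[OF X Y less, of n], of "p + 1"]
    by (simp add: add.commute add.left_commute)
  have shw: "summable (\<lambda>i. h n (p + 1 + i) * w n)" for n p
    unfolding h_def by (intro summable_mult2 summable_add sm)
  have "(\<Sum>n\<in>{- int p..int p}. (B n p + B (- n) p) * w n) \<le> D / (1 - \<mu>) * (\<mu> ^ p / real p)"
    if p: "p \<ge> 1" for p
  proof -
    have "(\<Sum>n\<in>{- int p..int p}. (B n p + B (- n) p) * w n) = (\<Sum>n\<in>{- int p..int p}. \<Sum>i. h n (p + 1 + i) * w n)"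
    proof -
      have "(B n p + B (- n) p) * w n = (\<Sum>i. h n (p + 1 + i) * w n)" for n
        unfolding B_def h_def suminf_add[OF sm sm] by (rule suminf_mult2[OF summable_add[OF sm sm]])
      then show ?thesis by (simp only:)
    qed
    also have "\<dots> = (\<Sum>i. \<Sum>n\<in>{- int p..int p}. h n (p + 1 + i) * w n)"
      by (rule suminf_sum[symmetric]) (rule shw)
    also have "\<dots> \<le> (\<Sum>i. D * (\<mu> ^ p / real p) * \<mu> ^ i)"
    proof (rule suminf_le)
      fix i
      have "(\<Sum>n\<in>{- int p..int p}. h n (p + 1 + i) * w n) \<le> D * (\<mu> ^ (p + 1 + i) / real (p + 1 + i))"
        by (rule hw) simp
      \<comment> \<open>One power of \<open>\<mu>\<close> is given away and the denominators are
        frozen at \<open>p\<close>, which leaves a geometric series in \<open>i\<close>.\<close>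
      also have "\<dots> \<le> D * (\<mu> ^ (p + i) / real p)"
        using mu0 mu D p by (intro mult_left_mono frac_le power_decreasing) auto
      finally show "(\<Sum>n\<in>{- int p..int p}. h n (p + 1 + i) * w n) \<le> D * (\<mu> ^ p / real p) * \<mu> ^ i"
        by (simp add: power_add)
    next
      show "summable (\<lambda>i. \<Sum>n\<in>{- int p..int p}. h n (p + 1 + i) * w n)"
        by (intro summable_sum shw)
      show "summable (\<lambda>i. D * (\<mu> ^ p / real p) * \<mu> ^ i)"
        using mu0 mu by (intro summable_mult summable_geometric) simp
    qed
    also have "\<dots> = D * (\<mu> ^ p / real p) * (1 / (1 - \<mu>))"
    proof -
      have n: "norm \<mu> < 1" using mu0 mu by simp
      show ?thesis unfolding suminf_mult[OF summable_geometric[OF n]] suminf_geometric[OF n] ..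
    qed
    finally show ?thesis by (simp add: mult.commute)
  qed
  then show ?thesis unfolding w_def
    using D mu by (intro exI[of _ "D / (1 - \<mu>)"]) auto
qed

section \<open>Assembly of the two half-lattices and bounds for the moments\<close>

lemma cis_eq_1_imp: "cis t = 1 \<Longrightarrow> t \<ge> 0 \<Longrightarrow> \<exists>n::nat. t = 2 * real n * pi"
proof -
  assume "cis t = 1" and t: "t \<ge> 0"
  then have "cos t = 1" by (simp add: complex_eq_iff)
  then obtain n :: int where n: "t = of_int n * 2 * pi" using cos_one_2pi_int by blast
  have "0 \<le> real_of_int n * (2 * pi)" using t n by simp
  then have "0 \<le> real_of_int n" by (smt (verit) pi_gt_zero zero_le_mult_iff)
  then have "n \<ge> 0" by simp
  then have "t = 2 * real (nat n) * pi" using n by simp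
  then show ?thesis by blast
qed

lemma m2l_error_bound:
  fixes k H \<theta> r \<sigma> C\<^sub>0 :: real and x zD zC :: complex and M :: "int \<Rightarrow> complex"
  assumes k: "k > 0" and H: "H > 0"
    and res: "\<And>n::nat. k * H * (1 + sin \<theta>) \<noteq> 2 * real n * pi \<and> k * H * (1 - sin \<theta>) \<noteq> 2 * real n * pi"
    and r: "r > 0" "\<And>m::int. r \<le> cmod (zD - zC - of_int m * period_vector H)"
    and \<sigma>: "\<sigma> \<ge> 0" and C0: "C\<^sub>0 \<ge> 0"
    and M: "\<And>n. norm (M n) \<le> C\<^sub>0 * ((k * \<sigma> / 2) ^ nat \<bar>n\<bar> / fact (nat \<bar>n\<bar>))"
  defines "\<mu> \<equiv> cmod (x - zD) / r * exp (3 * \<sigma> / (2 * r))"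
  assumes mu: "\<mu> < 1"
  shows "\<forall>p n. bilateral_summable (m2l_summand k H \<theta> x zD zC p n)"
    and "\<exists>C\<ge>0. \<forall>p\<ge>1. norm (m2l_error k H \<theta> x zD zC M p) \<le> C * (\<mu> ^ p / real p)"
proof -
  define y where "y = of_real k * (zD - x)"
  have y: "cmod y = k * cmod (x - zD)" using k by (simp add: y_def norm_mult norm_minus_commute)
  define X where "X = k * r"
  have X: "X > 0" using k r by (simp add: X_def)
  define s where "s = k * \<sigma> / 2"
  have s: "s \<ge> 0" using k \<sigma> by (simp add: s_def)
  have mu_eq: "\<mu> = 2 * (cmod y / 2) / X * exp (3 * s / X)"
    using k r by (simp add: \<mu>_def y X_def s_def)
  \<comment> \<open>As the exponential is at least 1, a rate below 1 forces the condition under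
    which the tails of Graf's expansion converge.\<close>
  have less: "cmod y < X"
  proof -
    have "cmod (x - zD) / r * 1 \<le> \<mu>" unfolding \<mu>_def using r \<sigma> by (intro mult_left_mono) auto
    then have "cmod (x - zD) / r < 1" using mu by simp
    then show ?thesis using r k by (simp add: y X_def)
  qed
  define \<beta> where "\<beta> = cis (k * H * sin \<theta>)"
  define B where "B = (\<lambda>n p. \<Sum>i. graf_majorant X (cmod y / 2) n (p + 1 + i))"
  have ne1: "cis (k * H * (1 + sin \<theta>)) \<noteq> 1"
  proof -
    have "1 + sin \<theta> \<ge> 0" using sin_ge_minus_one[of \<theta>] by linarith
    then have "0 \<le> k * H * (1 + sin \<theta>)" using k H by simp
    then show ?thesis using cis_eq_1_imp[of "k * H * (1 + sin \<theta>)"] res by blast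
  qed
  have ne2: "cis (k * H * (1 - sin \<theta>)) \<noteq> 1"
  proof -
    have "0 \<le> k * H * (1 - sin \<theta>)" using k H by simp
    then show ?thesis using cis_eq_1_imp[of "k * H * (1 - sin \<theta>)"] res by blast
  qed
  have ne3: "cis (- t) \<noteq> 1" if "cis t \<noteq> 1" for t
    using that by (metis cis_cnj complex_cnj_one complex_cnj_cnj)
  \<comment> \<open>Each half-lattice meets two resonance conditions, one for each direction of
    rotation; passing to \<open>inverse \<beta>\<close> changes the sign of
    \<open>sin \<theta>\<close>.\<close>
  have b1: "\<beta> * cis \<bar>- (k * H)\<bar> \<noteq> 1" "\<beta> * cis (- \<bar>- (k * H)\<bar>) \<noteq> 1"
    using ne1 ne3[OF ne2] k H by (simp_all add: \<beta>_def cis_mult algebra_simps)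
  have b2: "inverse \<beta> * cis \<bar>k * H\<bar> \<noteq> 1" "inverse \<beta> * cis (- \<bar>k * H\<bar>) \<noteq> 1"
    using ne2 ne3[OF ne1] k H by (simp_all add: \<beta>_def cis_mult algebra_simps)
  have nb: "norm \<beta> = 1" "norm (inverse \<beta>) = 1" by (simp_all add: \<beta>_def norm_inverse)
  define z where "z = (\<lambda>m::int. of_real k * (zD - zC - of_int m * period_vector H))"
  have X_le: "X \<le> cmod (z m)" for m
    using r(2)[of m] k by (simp add: z_def norm_mult X_def)
  have pv: "period_vector H = \<i> * of_real H" by (simp add: period_vector_def complex_eq_iff)
  have lat1: "vertical_pt (of_real k * (zD - zC)) (- (k * H)) i = z (int i)" for i
    using k H by (simp add: vertical_pt_def z_def pv algebra_simps)
  \<comment> \<open>The half with negative \<open>m\<close> starts at \<open>m = -1\<close>: the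
    base point is moved by one period, and \<open>summand2\<close> gets an extra factor
    \<open>inverse \<beta>\<close>, which has modulus 1.\<close>
  have lat2: "vertical_pt (of_real k * (zD - zC + \<i> * of_real H)) (k * H) i = z (- int (Suc i))" for i
    using k H by (simp add: vertical_pt_def z_def pv algebra_simps)
  obtain K1 where K1: "K1 \<ge> 0" "\<And>n p. summable (\<lambda>i. \<beta> ^ i * graf_remainder n p (z (int i)) y)"
    "\<And>n p. norm (\<Sum>i. \<beta> ^ i * graf_remainder n p (z (int i)) y) \<le> K1 * (B n p + B (- n) p)"
    using half_lattice_graf_sum[of "- (k * H)" X "of_real k * (zD - zC)" \<beta> y] k H X X_le nb b1 less
    unfolding lat1 B_def by (auto simp del: abs_minus_cancel)
  obtain K2 where K2: "K2 \<ge> 0" "\<And>n p. summable (\<lambda>i. inverse \<beta> ^ i * graf_remainder n p (z (- int (Suc i))) y)"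
    "\<And>n p. norm (\<Sum>i. inverse \<beta> ^ i * graf_remainder n p (z (- int (Suc i))) y) \<le> K2 * (B n p + B (- n) p)"
    using half_lattice_graf_sum[of "k * H" X "of_real k * (zD - zC + \<i> * of_real H)" "inverse \<beta>" y] k H X X_le nb b2 less
    unfolding lat2 B_def by (auto simp del: of_nat_Suc)
  have summand1: "m2l_summand k H \<theta> x zD zC p n (int i) = \<beta> ^ i * graf_remainder n p (z (int i)) y" for p n i
    by (simp add: m2l_summand_def \<beta>_def z_def y_def)
  have summand2: "m2l_summand k H \<theta> x zD zC p n (- int (Suc i))
      = inverse \<beta> * (inverse \<beta> ^ i * graf_remainder n p (z (- int (Suc i))) y)" for p n i
  proof -
    have "\<beta> powi (- int (Suc i)) = inverse \<beta> * inverse \<beta> ^ i"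
      by (simp only: power_int_minus power_int_of_nat power_inverse power_Suc inverse_mult_distrib)
    then show ?thesis
      unfolding m2l_summand_def \<beta>_def[symmetric] z_def y_def by (simp only: mult.assoc)
  qed
  show "\<forall>p n. bilateral_summable (m2l_summand k H \<theta> x zD zC p n)"
    unfolding bilateral_summable_def summand1 summand2 by (intro allI conjI K1(2) summable_mult K2(2))
  define K where "K = K1 + K2"
  have bil: "norm (bilateral_suminf (m2l_summand k H \<theta> x zD zC p n)) \<le> K * (B n p + B (- n) p)" for p n
  proof -
    have "bilateral_suminf (m2l_summand k H \<theta> x zD zC p n) = (\<Sum>i. \<beta> ^ i * graf_remainder n p (z (int i)) y)
      + inverse \<beta> * (\<Sum>i. inverse \<beta> ^ i * graf_remainder n p (z (- int (Suc i))) y)"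
      unfolding bilateral_suminf_def summand1 summand2 suminf_mult[OF K2(2)] ..
    also have "norm \<dots> \<le> K1 * (B n p + B (- n) p) + K2 * (B n p + B (- n) p)"
      by (rule norm_triangle_le[OF add_mono[OF K1(3)]]) (unfold norm_mult nb mult_1_left, rule K2(3))
    finally show ?thesis by (simp add: K_def algebra_simps)
  qed
  have "\<exists>C\<ge>0. \<forall>p\<ge>1. (\<Sum>n\<in>{- int p..int p}. (B n p + B (- n) p) * (s ^ nat \<bar>n\<bar> / fact (nat \<bar>n\<bar>)))
      \<le> C * (\<mu> ^ p / real p)"
    unfolding B_def mu_eq by (rule sum_graf_tail_le) (use X s mu[unfolded mu_eq] in auto)
  then obtain C1 where C1: "C1 \<ge> 0" "\<And>p. p \<ge> 1 \<Longrightarrow>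
    (\<Sum>n\<in>{- int p..int p}. (B n p + B (- n) p) * (s ^ nat \<bar>n\<bar> / fact (nat \<bar>n\<bar>))) \<le> C1 * (\<mu> ^ p / real p)"
    by blast
  have K0: "K \<ge> 0" using K1(1) K2(1) by (simp add: K_def)
  show "\<exists>C\<ge>0. \<forall>p\<ge>1. norm (m2l_error k H \<theta> x zD zC M p) \<le> C * (\<mu> ^ p / real p)"
  proof (intro exI conjI allI impI)
    show "K * C\<^sub>0 * C1 \<ge> 0" using K0 C0 C1 by simp
    fix p :: nat assume p: "p \<ge> 1"
    have "norm (m2l_error k H \<theta> x zD zC M p)
      \<le> (\<Sum>n\<in>{- int p..int p}. (K * (B n p + B (- n) p)) * (C\<^sub>0 * (s ^ nat \<bar>n\<bar> / fact (nat \<bar>n\<bar>))))"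
      unfolding m2l_error_def
    proof (rule sum_norm_le)
      fix n
      show "norm (bilateral_suminf (m2l_summand k H \<theta> x zD zC p n) * M n)
        \<le> (K * (B n p + B (- n) p)) * (C\<^sub>0 * (s ^ nat \<bar>n\<bar> / fact (nat \<bar>n\<bar>)))"
        unfolding norm_mult s_def
        by (rule mult_mono[OF bil M order_trans[OF norm_ge_zero bil]]) simp
    qed
    also have "\<dots> = K * C\<^sub>0 * (\<Sum>n\<in>{- int p..int p}. (B n p + B (- n) p) * (s ^ nat \<bar>n\<bar> / fact (nat \<bar>n\<bar>)))"
      unfolding sum_distrib_left by (intro sum.cong refl) (simp only: mult_ac)
    also have "\<dots> \<le> K * C\<^sub>0 * (C1 * (\<mu> ^ p / real p))"
      using K0 C0 by (intro mult_left_mono C1(2) p) auto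
    finally show "norm (m2l_error k H \<theta> x zD zC M p) \<le> K * C\<^sub>0 * C1 * (\<mu> ^ p / real p)" by (simp add: mult.assoc)
  qed
qed

lemma multipole_moment_bound:
  assumes k: "k > 0" and ab: "a \<le> b" and \<sigma>: "\<And>s. s \<in> {a..b} \<Longrightarrow> cmod (g s - z) \<le> \<sigma>" "\<sigma> \<ge> 0"
    and \<Phi>: "\<And>s. s \<in> {a..b} \<Longrightarrow> norm (\<phi> (g s)) \<le> \<Phi>"
  shows "\<exists>C\<ge>0. \<forall>n. norm (multipole_moment k g a b \<phi> z n) \<le> C * ((k * \<sigma> / 2) ^ nat \<bar>n\<bar> / fact (nat \<bar>n\<bar>))"
proof (intro exI conjI allI)
  have \<Phi>0: "\<Phi> \<ge> 0" using order_trans[OF norm_ge_zero \<Phi>[of a]] ab by simp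
  define E where "E = exp ((k * \<sigma> / 2)\<^sup>2)"
  show "E * \<Phi> * (b - a) \<ge> 0" using \<Phi>0 ab by (simp add: E_def)
  fix n
  let ?w = "(k * \<sigma> / 2) ^ nat \<bar>n\<bar> / fact (nat \<bar>n\<bar>)"
  let ?f = "\<lambda>s. of_real (bessel_J n (k * cmod (g s - z))) * cis (- (of_int n * Arg (g s - z))) * \<phi> (g s)"
  have bd: "norm (?f s) \<le> E * \<Phi> * ?w" if s: "s \<in> {a..b}" for s
  proof -
    have le: "0 \<le> k * cmod (g s - z) / 2" "k * cmod (g s - z) / 2 \<le> k * \<sigma> / 2"
      using k \<sigma>(1)[OF s] by auto
    have "\<bar>bessel_J n (k * cmod (g s - z))\<bar> \<le> exp ((k * cmod (g s - z) / 2)\<^sup>2) * (k * cmod (g s - z) / 2) ^ nat \<bar>n\<bar> / fact (nat \<bar>n\<bar>)"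
      using k by (intro bessel_J_bound) simp
    also have "\<dots> \<le> E * (k * \<sigma> / 2) ^ nat \<bar>n\<bar> / fact (nat \<bar>n\<bar>)"
      unfolding E_def using power_mono[OF le(2) le(1)]
      by (intro divide_right_mono mult_mono) (simp_all add: le zero_le_power[OF le(1)])
    finally have "norm (?f s) \<le> (E * (k * \<sigma> / 2) ^ nat \<bar>n\<bar> / fact (nat \<bar>n\<bar>)) * \<Phi>"
      unfolding norm_mult by (intro mult_mono \<Phi>[OF s]) auto
    then show ?thesis by (simp add: mult_ac)
  qed
  have "norm (integral {a..b} ?f) \<le> E * \<Phi> * ?w * (b - a)"
  proof (cases "?f integrable_on {a..b}")
    case True
    have "0 \<le> E * \<Phi> * ?w" using \<Phi>0 k \<sigma>(2) by (simp add: E_def)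
    from has_integral_bound_real[OF this finite.emptyI integrable_integral[OF True]] bd ab
    show ?thesis by simp
  next
    \<comment> \<open>By convention the integral is then 0, which satisfies the bound.\<close>
    case False
    then show ?thesis using \<Phi>0 k \<sigma>(2) ab by (simp add: not_integrable_integral E_def)
  qed
  then show "norm (multipole_moment k g a b \<phi> z n) \<le> E * \<Phi> * (b - a) * ?w"
    unfolding multipole_moment_def by (simp add: mult_ac)
qed

section \<open>Geometry of well separated cells\<close>

lemma lattice_vectors_add: "v \<in> lattice_vectors U \<Longrightarrow> w \<in> lattice_vectors U \<Longrightarrow> v + w \<in> lattice_vectors U"
proof (cases U)
  case (Square a s)
  assume "v \<in> lattice_vectors U" "w \<in> lattice_vectors U"
  then obtain m n m' n' :: int where "v = of_int m * s + of_int n * (\<i> * s)" "w = of_int m' * s + of_int n' * (\<i> * s)"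
    by (auto simp: Square)
  then have "v + w = of_int (m + m') * s + of_int (n + n') * (\<i> * s)" by (simp add: algebra_simps)
  then show ?thesis unfolding Square lattice_vectors.simps by blast
next
  case (Hexagonal z u)
  let ?a = "u * (1 + cis (pi / 3))" and ?b = "u * (cis (pi / 3) + cis (2 * pi / 3))"
  assume "v \<in> lattice_vectors U" "w \<in> lattice_vectors U"
  then obtain m n m' n' :: int where "v = of_int m * ?a + of_int n * ?b" "w = of_int m' * ?a + of_int n' * ?b"
    by (auto simp: Hexagonal)
  then have "v + w = of_int (m + m') * ?a + of_int (n + n') * ?b" by (simp add: algebra_simps)
  then show ?thesis unfolding Hexagonal lattice_vectors.simps by blast
qed

lemma lattice_vectors_of_int_mult: "v \<in> lattice_vectors U \<Longrightarrow> of_int k * v \<in> lattice_vectors U"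
proof (cases U)
  case (Square a s)
  assume "v \<in> lattice_vectors U"
  then obtain m n :: int where "v = of_int m * s + of_int n * (\<i> * s)" by (auto simp: Square)
  then have "of_int k * v = of_int (k * m) * s + of_int (k * n) * (\<i> * s)" by (simp add: algebra_simps)
  then show ?thesis unfolding Square lattice_vectors.simps by blast
next
  case (Hexagonal z u)
  let ?a = "u * (1 + cis (pi / 3))" and ?b = "u * (cis (pi / 3) + cis (2 * pi / 3))"
  assume "v \<in> lattice_vectors U"
  then obtain m n :: int where "v = of_int m * ?a + of_int n * ?b" by (auto simp: Hexagonal)
  then have "of_int k * v = of_int (k * m) * ?a + of_int (k * n) * ?b" by (simp add: algebra_simps)
  then show ?thesis unfolding Hexagonal lattice_vectors.simps by blast
qed

lemma shift_shift: "shift v (shift w c) = shift (v + w) c"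
  by (simp add: shift_def o_def add.assoc)

lemma medium_cell_shift:
  "medium_cell U l c \<Longrightarrow> w \<in> lattice_vectors U \<Longrightarrow> medium_cell U l (shift w c)"
  unfolding medium_cell_def by (metis lattice_vectors_add shift_shift)

lemma midpoint_shift: "midpoint (w + a) (w + b) = w + midpoint a (b :: complex)"
  by (simp add: midpoint_def algebra_simps scaleR_2 scaleR_conv_of_real)

lemma children_shift: "children (shift w c) = shift w ` children c"
  by (cases c rule: children.cases) (simp_all add: shift_def midpoint_shift Let_def)

lemma medium_cell_children:
  assumes "medium_cell U l c" "d \<in> children c"
  shows "medium_cell U (Suc l) d"
proof -
  obtain w c0 where w: "w \<in> lattice_vectors U" "tree_cell (root_cell U) l c0" "c = shift w c0"
    using assms(1) by (auto simp: medium_cell_def)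
  then obtain d0 where "d0 \<in> children c0" "d = shift w d0" using assms(2) by (auto simp: children_shift)
  then show ?thesis using w tree_cell.subdivide unfolding medium_cell_def by blast
qed

lemma midpoint_in_hull: "a \<in> convex hull S \<Longrightarrow> b \<in> convex hull S \<Longrightarrow> midpoint a b \<in> convex hull S"
  for S :: "complex set"
  using convexD[OF convex_convex_hull, of a S b "1/2" "1/2"] by (simp add: midpoint_def scaleR_add_right)

lemma children_region:
  assumes "d \<in> children c" shows "region d \<subseteq> region c"
proof -
  have "set d \<subseteq> convex hull set c"
    using assms
    apply (cases c rule: children.cases)
    apply (simp_all add: Let_def)
      apply (elim disjE; simp; intro conjI midpoint_in_hull; rule hull_inc; simp)+
    done
  then show ?thesis unfolding region_def by (intro hull_minimal) auto
qed

text \<open>The absence of common vertices is all that will be extracted from separation; as the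
  vertices have integer coordinates, this is a condition on integers.\<close>

lemma not_adjacent_disjoint: "\<not> adjacent c d \<Longrightarrow> set c \<inter> set d = {}"
  unfolding adjacent_def region_def by (meson disjoint_iff hull_inc)

lemma region_dist_le:
  assumes "\<And>v. v \<in> set c \<Longrightarrow> cmod (v - z) \<le> r" "x \<in> region c"
  shows "cmod (x - z) \<le> r"
proof -
  have "region c \<subseteq> cball z r" unfolding region_def
    by (rule hull_minimal) (use assms(1) in \<open>auto simp: dist_norm norm_minus_commute\<close>)
  then show ?thesis using assms(2) by (auto simp: dist_norm norm_minus_commute)
qed

text \<open>The quadratic bound for \<open>exp\<close> holds only up to argument 1, where its value
  3 is too weak for a pair of triangles with first factor \<open>1 / 3\<close>. Applying it to a
  quarter of the argument remedies both.\<close>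

lemma exp_le_quartic:
  fixes x :: real assumes "0 \<le> x" "x \<le> 4" shows "exp x \<le> (1 + x / 4 + (x / 4)\<^sup>2) ^ 4"
proof -
  have "exp x = exp (x / 4) ^ 4" using exp_of_nat_mult[of 4 "x / 4"] by simp
  also have "\<dots> \<le> (1 + x / 4 + (x / 4)\<^sup>2) ^ 4" using assms by (intro power_mono exp_bound) auto
  finally show ?thesis .
qed

text \<open>With \<open>c\<close> a translate of the cell that contains the boundary element, this
  keeps the quotient in \<open>m2l_rate\<close> below 1 for the corresponding
  \<open>m\<close>.\<close>

definition contractive :: "cell \<Rightarrow> cell \<Rightarrow> bool" where
  "contractive c d \<longleftrightarrow> centroid d \<noteq> centroid c \<and> (\<forall>x\<in>region d. \<forall>y\<in>region c.
     cmod (x - centroid d) / cmod (centroid d - centroid c)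
       * exp (3 * cmod (y - centroid c) / (2 * cmod (centroid d - centroid c))) < 1)"

text \<open>\<open>A\<close> bounds the circumradius of \<open>d\<close>, and \<open>B\<close> three
  halves of that of \<open>c\<close>, both relative to the distance of the centroids; vertices
  suffice because discs are convex. Squared lengths are rational multiples of the squared mesh size,
  so the side conditions become rational arithmetic.\<close>

lemma contractiveI:
  fixes A B P Q R :: real
  assumes d: "\<And>v. v \<in> set d \<Longrightarrow> (cmod (v - centroid d))\<^sup>2 \<le> P"
    and c: "\<And>v. v \<in> set c \<Longrightarrow> (cmod (v - centroid c))\<^sup>2 \<le> Q"
    and R: "R \<le> (cmod (centroid d - centroid c))\<^sup>2" "R > 0"
    and AB: "A \<ge> 0" "0 \<le> B" "B \<le> 4" "A * (1 + B / 4 + (B / 4)\<^sup>2) ^ 4 < 1"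
    and PQ: "P \<le> A\<^sup>2 * R" "9 * Q \<le> 4 * B\<^sup>2 * R"
  shows "contractive c d"
proof -
  define r where "r = cmod (centroid d - centroid c)"
  have r: "r > 0" using R by (cases "centroid d = centroid c") (auto simp: r_def)
  have "cmod (v - centroid d) \<le> A * r" if "v \<in> set d" for v
  proof (rule power2_le_imp_le)
    have "(cmod (v - centroid d))\<^sup>2 \<le> A\<^sup>2 * R" using d[OF that] PQ by simp
    also have "\<dots> \<le> A\<^sup>2 * r\<^sup>2" using R by (intro mult_left_mono) (auto simp: r_def)
    finally show "(cmod (v - centroid d))\<^sup>2 \<le> (A * r)\<^sup>2" by (simp add: power_mult_distrib)
  qed (use AB r in auto)
  then have D: "cmod (x - centroid d) \<le> A * r" if "x \<in> region d" for x
    using region_dist_le that by blast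
  have "cmod (v - centroid c) \<le> 2 * B * r / 3" if "v \<in> set c" for v
  proof (rule power2_le_imp_le)
    have "(cmod (v - centroid c))\<^sup>2 \<le> 4 * B\<^sup>2 * R / 9" using c[OF that] PQ by simp
    also have "\<dots> \<le> 4 * B\<^sup>2 * r\<^sup>2 / 9" using R by (intro divide_right_mono mult_left_mono) (auto simp: r_def)
    finally show "(cmod (v - centroid c))\<^sup>2 \<le> (2 * B * r / 3)\<^sup>2" by (simp add: power_mult_distrib power_divide)
  qed (use AB r in auto)
  then have C: "cmod (y - centroid c) \<le> 2 * B * r / 3" if "y \<in> region c" for y
    using region_dist_le that by blast
  have "cmod (x - centroid d) / r * exp (3 * cmod (y - centroid c) / (2 * r)) < 1"
    if x: "x \<in> region d" and y: "y \<in> region c" for x y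
  proof -
    have "cmod (x - centroid d) / r \<le> A" using D[OF x] r by (simp add: field_simps)
    moreover have "3 * cmod (y - centroid c) / (2 * r) \<le> B" using C[OF y] r by (simp add: field_simps)
    then have "exp (3 * cmod (y - centroid c) / (2 * r)) \<le> (1 + B / 4 + (B / 4)\<^sup>2) ^ 4"
      using exp_le_quartic[OF AB(2,3)] by (meson exp_le_cancel_iff order_trans)
    ultimately have "cmod (x - centroid d) / r * exp (3 * cmod (y - centroid c) / (2 * r))
      \<le> A * (1 + B / 4 + (B / 4)\<^sup>2) ^ 4"
      using AB by (intro mult_mono) auto
    then show ?thesis using AB(4) by simp
  qed
  then show ?thesis unfolding contractive_def r_def[symmetric] using r by (auto simp: r_def)
qed

subsection \<open>Squares\<close>

text \<open>Integer coordinates with respect to \<open>\<tau>\<close> and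
  \<open>\<tau> * \<eta>\<close>, where \<open>\<eta>\<close> is \<open>\<i>\<close> for squares and
  \<open>eis_unit\<close> for triangles. Halving \<open>\<tau>\<close> doubles the coordinates, so
  cells of different levels can be compared on one grid.\<close>

definition lattice_pt :: "complex \<Rightarrow> complex \<Rightarrow> complex \<Rightarrow> int \<Rightarrow> int \<Rightarrow> complex" where
  "lattice_pt a \<tau> \<eta> x y = a + \<tau> * (of_int x + of_int y * \<eta>)"

lemma midpoint_lattice_pt:
  "midpoint (lattice_pt a \<tau> \<eta> x y) (lattice_pt a \<tau> \<eta> x' y') = lattice_pt a (\<tau> / 2) \<eta> (x + x') (y + y')"
  by (simp add: midpoint_def scaleR_conv_of_real lattice_pt_def field_simps)

lemma lattice_pt_double: "lattice_pt a \<tau> \<eta> x y = lattice_pt a (\<tau> / 2) \<eta> (2 * x) (2 * y)"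
  by (simp add: lattice_pt_def algebra_simps)

lemma add_lattice_pt:
  "w = \<tau> * (of_int m + of_int n * \<eta>) \<Longrightarrow> w + lattice_pt a \<tau> \<eta> x y = lattice_pt a \<tau> \<eta> (x + m) (y + n)"
  by (simp add: lattice_pt_def algebra_simps)

definition square_cell :: "complex \<Rightarrow> complex \<Rightarrow> int \<Rightarrow> int \<Rightarrow> cell" where
  "square_cell a \<tau> u v = [lattice_pt a \<tau> \<i> u v, lattice_pt a \<tau> \<i> (u + 1) v,
     lattice_pt a \<tau> \<i> (u + 1) (v + 1), lattice_pt a \<tau> \<i> u (v + 1)]"

lemma children_square_cell:
  "children (square_cell a \<tau> u v) = (\<lambda>(i, j). square_cell a (\<tau> / 2) (2 * u + i) (2 * v + j)) ` {(0, 0), (1, 0), (1, 1), (0, 1)}"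
proof -
  have e: "u + (u + 1) = 2 * u + 1" "u + 1 + u = 2 * u + 1" "u + u = 2 * u" "2 * (u + 1) = 2 * u + 1 + 1"
    "u + 1 + (u + 1) = 2 * u + 1 + 1" for u :: int by simp_all
  have "children (square_cell a \<tau> u v) =
    {square_cell a (\<tau> / 2) (2 * u) (2 * v), square_cell a (\<tau> / 2) (2 * u + 1) (2 * v),
     square_cell a (\<tau> / 2) (2 * u + 1) (2 * v + 1), square_cell a (\<tau> / 2) (2 * u) (2 * v + 1)}"
    unfolding square_cell_def children.simps Let_def midpoint_lattice_pt
    by (simp only: lattice_pt_double[of a \<tau>] e)
  also have "\<dots> = (\<lambda>(i, j). square_cell a (\<tau> / 2) (2 * u + i) (2 * v + j)) ` {(0, 0), (1, 0), (1, 1), (0, 1)}" by simp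
  finally show ?thesis .
qed

lemma tree_cell_square:
  assumes "tree_cell (root_cell (Square a s)) l c"
  shows "\<exists>u v. c = square_cell a (s / 2 ^ l) u v"
  using assms
proof induction
  case base
  have "root_cell (Square a s) = square_cell a (s / 2 ^ 0) 0 0" by (simp add: square_cell_def lattice_pt_def algebra_simps)
  then show ?case by blast
next
  case (subdivide l c d)
  then obtain u v where "c = square_cell a (s / 2 ^ l) u v" by blast
  with subdivide.hyps show ?case
    by (auto simp: children_square_cell mult.commute)
qed

lemma medium_cell_square:
  assumes "medium_cell (Square a s) l c"
  shows "\<exists>u v. c = square_cell a (s / 2 ^ l) u v"
proof -
  obtain w c0 where w: "w \<in> lattice_vectors (Square a s)" "tree_cell (root_cell (Square a s)) l c0" "c = shift w c0"
    using assms by (auto simp: medium_cell_def)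
  obtain m n :: int where mn: "w = of_int m * s + of_int n * (\<i> * s)" using w(1) by auto
  obtain u v where uv: "c0 = square_cell a (s / 2 ^ l) u v" using tree_cell_square[OF w(2)] by blast
  have we: "w = s / 2 ^ l * (of_int (2 ^ l * m) + of_int (2 ^ l * n) * \<i>)"
    by (simp add: mn field_simps)
  have "c = square_cell a (s / 2 ^ l) (u + 2 ^ l * m) (v + 2 ^ l * n)"
    unfolding w(3) uv square_cell_def shift_def list.map add_lattice_pt[OF we] by (simp add: algebra_simps)
  then show ?thesis by blast
qed

lemma centroid_square_cell:
  "centroid (square_cell a \<tau> u v) = lattice_pt a (\<tau> / 2) \<i> (2 * u + 1) (2 * v + 1)"
proof -
  have "sum_list (square_cell a \<tau> u v) = 4 * lattice_pt a (\<tau> / 2) \<i> (2 * u + 1) (2 * v + 1)"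
    by (simp add: square_cell_def lattice_pt_def algebra_simps)
  then show ?thesis by (simp add: centroid_def square_cell_def)
qed

lemma cmod_gauss: "(cmod (\<tau> * (of_int x + of_int y * \<i>)))\<^sup>2 = (cmod \<tau>)\<^sup>2 * of_int (x\<^sup>2 + y\<^sup>2)"
  by (simp add: norm_mult power_mult_distrib cmod_power2)

lemma square_cell_vertex_dist:
  assumes "p \<in> set (square_cell a \<tau> u v)"
  shows "(cmod (p - centroid (square_cell a \<tau> u v)))\<^sup>2 = (cmod \<tau>)\<^sup>2 / 2"
proof -
  obtain i j :: int where ij: "p = lattice_pt a \<tau> \<i> (u + i) (v + j)" "i \<in> {0, 1}" "j \<in> {0, 1}"
    using assms that[of 0 0] that[of 1 0] that[of 1 1] that[of 0 1] unfolding square_cell_def by auto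
  have "p - centroid (square_cell a \<tau> u v) = \<tau> / 2 * (of_int (2 * i - 1) + of_int (2 * j - 1) * \<i>)"
    unfolding ij(1) centroid_square_cell lattice_pt_def by (simp add: algebra_simps)
  moreover have "(2 * i - 1)\<^sup>2 + (2 * j - 1)\<^sup>2 = 2" using ij(2,3) by auto
  ultimately show ?thesis
    by (simp only: cmod_gauss) (simp add: norm_divide power_divide)
qed

text \<open>Offsets are read in binary: the quotients by 2 locate the parent, the residues select
  the child. These descendants are the cells to which the separation hypothesis is applied.\<close>

lemma square_descendants:
  assumes "medium_cell (Square a s) l (square_cell a \<tau> u v)" "0 \<le> i" "i < 2 ^ k" "0 \<le> j" "j < 2 ^ k"
  shows "medium_cell (Square a s) (l + k) (square_cell a (\<tau> / 2 ^ k) (2 ^ k * u + i) (2 ^ k * v + j))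
    \<and> region (square_cell a (\<tau> / 2 ^ k) (2 ^ k * u + i) (2 ^ k * v + j)) \<subseteq> region (square_cell a \<tau> u v)"
  using assms(2-5)
proof (induction k arbitrary: i j)
  case 0
  then have "i = 0" "j = 0" by auto
  then show ?case using assms(1) by simp
next
  case (Suc k)
  define i' j' where "i' = i div 2" and "j' = j div 2"
  have ij: "0 \<le> i'" "i' < 2 ^ k" "0 \<le> j'" "j' < 2 ^ k" using Suc.prems by (auto simp: i'_def j'_def)
  let ?c = "square_cell a (\<tau> / 2 ^ k) (2 ^ k * u + i') (2 ^ k * v + j')"
  let ?d = "square_cell a (\<tau> / 2 ^ Suc k) (2 ^ Suc k * u + i) (2 ^ Suc k * v + j)"
  have e: "2 ^ Suc k * u + i = 2 * (2 ^ k * u + i') + i mod 2" "2 ^ Suc k * v + j = 2 * (2 ^ k * v + j') + j mod 2"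
    by (simp_all add: i'_def j'_def algebra_simps)
  have t: "\<tau> / 2 ^ Suc k = \<tau> / 2 ^ k / 2" by simp
  have "(i mod 2, j mod 2) \<in> {(0, 0), (1, 0), (1, 1), (0, 1)}" by auto
  then have "?d \<in> children ?c" unfolding children_square_cell e t by (rule rev_image_eqI) simp
  with Suc.IH[OF ij] have "medium_cell (Square a s) (Suc (l + k)) ?d" "region ?d \<subseteq> region (square_cell a \<tau> u v)"
    using medium_cell_children children_region[of ?d ?c] by blast+
  then show ?case by (simp only: add_Suc_right)
qed

lemma contractive_square:
  assumes s: "s \<noteq> 0" and d: "medium_cell (Square a s) ld d" and c: "medium_cell (Square a s) lc c"
    and l: "lc \<le> ld" "ld - lc \<le> 2"
    and sep: "\<And>e. medium_cell (Square a s) ld e \<Longrightarrow> region e \<subseteq> region c \<Longrightarrow> \<not> adjacent d e"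
  shows "contractive c d"
proof -
  define k where "k = ld - lc"
  have ld: "ld = lc + k" and k: "k \<le> 2" using l by (auto simp: k_def)
  define \<tau> where "\<tau> = s / 2 ^ ld"
  have tau: "\<tau> \<noteq> 0" "cmod \<tau> > 0" using s by (auto simp: \<tau>_def)
  have tau_c: "s / 2 ^ lc = \<tau> * 2 ^ k" by (simp add: \<tau>_def ld power_add)
  obtain u v where uv: "d = square_cell a \<tau> u v" using medium_cell_square[OF d] by (auto simp: \<tau>_def)
  obtain x y where xy: "c = square_cell a (\<tau> * 2 ^ k) x y" using medium_cell_square[OF c] by (auto simp: tau_c)
  define m where "m = u - 2 ^ k * x"
  define n where "n = v - 2 ^ k * y"
  have no: "\<not> (m \<in> {i - 1, i, i + 1} \<and> n \<in> {j - 1, j, j + 1})" if ij: "0 \<le> i" "i < 2 ^ k" "0 \<le> j" "j < 2 ^ k" for i j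
  proof
    assume mn: "m \<in> {i - 1, i, i + 1} \<and> n \<in> {j - 1, j, j + 1}"
    let ?e = "square_cell a \<tau> (2 ^ k * x + i) (2 ^ k * y + j)"
    have "\<not> adjacent d ?e"
      using square_descendants[of a s lc "\<tau> * 2 ^ k" x y i k j] c ij sep by (simp add: xy ld)
    then have "set d \<inter> set ?e = {}" by (rule not_adjacent_disjoint)
    moreover have "u = 2 ^ k * x + m" "v = 2 ^ k * y + n" by (simp_all add: m_def n_def)
    ultimately show False using mn by (auto simp: uv square_cell_def algebra_simps)
  qed
  \<comment> \<open>Clamping \<open>m\<close> and \<open>n\<close> to the range from 0 to
    \<open>2 ^ k - 1\<close> selects the subcell of \<open>c\<close> nearest to \<open>d\<close>; if
    the claim failed, the two would share a vertex.\<close>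
  have far: "m \<le> - 2 \<or> m \<ge> 2 ^ k + 1 \<or> n \<le> - 2 \<or> n \<ge> 2 ^ k + 1"
  proof (rule ccontr)
    assume "\<not> ?thesis"
    then have b: "- 1 \<le> m" "m \<le> 2 ^ k" "- 1 \<le> n" "n \<le> 2 ^ k" by auto
    have p: "(1 :: int) \<le> 2 ^ k" by simp
    define i where "i = max 0 (min m (2 ^ k - 1))"
    define j where "j = max 0 (min n (2 ^ k - 1))"
    have "0 \<le> i" "i < 2 ^ k" "0 \<le> j" "j < 2 ^ k" "m \<in> {i - 1, i, i + 1}" "n \<in> {j - 1, j, j + 1}"
      using b p by (auto simp: i_def j_def)
    then show False using no[of i j] by blast
  qed
  \<comment> \<open>The difference of the centroids in units of \<open>\<tau> / 2\<close>, which
    makes it integral.\<close>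
  define X :: int where "X = 2 * m + 1 - 2 ^ k"
  define Y :: int where "Y = 2 * n + 1 - 2 ^ k"
  have diff: "centroid d - centroid c = \<tau> / 2 * (of_int X + of_int Y * \<i>)"
    unfolding uv xy centroid_square_cell lattice_pt_def X_def Y_def m_def n_def by (simp add: algebra_simps)
  have "\<bar>X\<bar> \<ge> 2 ^ k + 3 \<or> \<bar>Y\<bar> \<ge> 2 ^ k + 3" using far by (auto simp: X_def Y_def)
  then have XY: "(2 ^ k + 3)\<^sup>2 \<le> X\<^sup>2 + Y\<^sup>2"
  proof
    assume "\<bar>X\<bar> \<ge> 2 ^ k + 3"
    then have "(2 ^ k + 3)\<^sup>2 \<le> \<bar>X\<bar>\<^sup>2" by (intro power_mono) auto
    then show ?thesis unfolding power2_abs using zero_le_power2[of Y] by linarith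
  next
    assume "\<bar>Y\<bar> \<ge> 2 ^ k + 3"
    then have "(2 ^ k + 3)\<^sup>2 \<le> \<bar>Y\<bar>\<^sup>2" by (intro power_mono) auto
    then show ?thesis unfolding power2_abs using zero_le_power2[of X] by linarith
  qed
  have XY': "(2 ^ k + 3)\<^sup>2 \<le> real_of_int (X\<^sup>2 + Y\<^sup>2)"
    using of_int_le_iff[of "(2 ^ k + 3)\<^sup>2" "X\<^sup>2 + Y\<^sup>2", where 'a = real, THEN iffD2, OF XY] by simp
  define t where "t = (cmod \<tau>)\<^sup>2"
  have t: "t > 0" using tau by (simp add: t_def)
  have R: "t / 4 * (2 ^ k + 3)\<^sup>2 \<le> (cmod (centroid d - centroid c))\<^sup>2"
    using mult_left_mono[OF XY', of "t / 4"] t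
    unfolding diff cmod_gauss by (simp add: norm_divide power_divide t_def)
  have P: "(cmod (w - centroid d))\<^sup>2 \<le> t / 2" if "w \<in> set d" for w
    using square_cell_vertex_dist that by (simp add: uv t_def)
  have Q: "(cmod (w - centroid c))\<^sup>2 \<le> t * (2 ^ k)\<^sup>2 / 2" if "w \<in> set c" for w
    using square_cell_vertex_dist that by (simp add: xy t_def norm_mult power_mult_distrib norm_power)
  consider "k = 0" | "k = 1" | "k = 2" using k by linarith
  then show ?thesis
  proof cases
    case 1
    \<comment> \<open>In each case the two numbers are the square roots of \<open>P / R\<close> and
      \<open>9 Q / (4 R)\<close>, slightly enlarged; here these roots are \<open>1 / sqrt 8\<close>
      and \<open>3 / sqrt 32\<close>.\<close>
    show ?thesis
      by (rule contractiveI[OF P Q R, of "36/100" "54/100"])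
        (use t in \<open>simp_all add: 1 power2_eq_square power_numeral_reduce\<close>)
  next
    case 2
    show ?thesis
      by (rule contractiveI[OF P Q R, of "29/100" "86/100"])
        (use t in \<open>simp_all add: 2 power2_eq_square power_numeral_reduce\<close>)
  next
    case 3
    show ?thesis
      by (rule contractiveI[OF P Q R, of "21/100" "122/100"])
        (use t in \<open>simp_all add: 3 power2_eq_square power_numeral_reduce\<close>)
  qed
qed

subsection \<open>Hexagons and triangles\<close>

definition eis_unit :: complex where "eis_unit = cis (pi / 3)"

lemma eis_unit_simps: "Re eis_unit = 1 / 2" "Im eis_unit = sqrt 3 / 2"
  by (simp_all add: eis_unit_def cos_60 sin_60)

lemma eis_unit_square: "eis_unit ^ 2 = eis_unit - 1"
  by (simp add: complex_eq_iff eis_unit_simps power2_eq_square)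

lemma eis_unit_power: "eis_unit ^ 3 = - 1" "eis_unit ^ 4 = - eis_unit" "eis_unit ^ 5 = 1 - eis_unit"
proof -
  have "eis_unit ^ 3 = eis_unit * eis_unit ^ 2" by (simp add: power2_eq_square power3_eq_cube)
  also have "\<dots> = eis_unit ^ 2 - eis_unit" by (simp add: eis_unit_square right_diff_distrib power2_eq_square[symmetric])
  finally show 3: "eis_unit ^ 3 = - 1" by (simp add: eis_unit_square)
  have "eis_unit ^ 4 = eis_unit * eis_unit ^ 3" "eis_unit ^ 5 = eis_unit ^ 2 * eis_unit ^ 3" by (simp_all add: power_add[symmetric] flip: power_Suc)
  then show "eis_unit ^ 4 = - eis_unit" "eis_unit ^ 5 = 1 - eis_unit" by (simp_all add: 3 eis_unit_square)
qed

lemma cmod_eisenstein: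
  "(cmod (\<tau> * (of_int x + of_int y * eis_unit)))\<^sup>2 = (cmod \<tau>)\<^sup>2 * of_int (x\<^sup>2 + x * y + y\<^sup>2)"
proof -
  have "(cmod (of_int x + of_int y * eis_unit))\<^sup>2 = of_int (x\<^sup>2 + x * y + y\<^sup>2)"
    unfolding cmod_power2 by (simp add: eis_unit_simps) (simp add: power2_eq_square algebra_simps)
  then show ?thesis by (simp only: norm_mult power_mult_distrib)
qed

text \<open>The triangle is spanned by the edge \<open>p + q * eis_unit\<close> and its rotation by
  60 degrees, which has coordinates \<open>(- q, p + q)\<close> because
  \<open>eis_unit ^ 2 = eis_unit - 1\<close>.\<close>

definition tri_cell :: "complex \<Rightarrow> complex \<Rightarrow> int \<Rightarrow> int \<Rightarrow> int \<Rightarrow> int \<Rightarrow> cell" where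
  "tri_cell a \<tau> x y p q = [lattice_pt a \<tau> eis_unit x y, lattice_pt a \<tau> eis_unit (x + p) (y + q), lattice_pt a \<tau> eis_unit (x - q) (y + p + q)]"

text \<open>The successive powers of \<open>eis_unit\<close>, in the vertex order of
  \<open>root_cell\<close>.\<close>

definition hex_units :: "(int \<times> int) list" where
  "hex_units = [(1, 0), (0, 1), (- 1, 1), (- 1, 0), (0, - 1), (1, - 1)]"

definition hex_cell :: "complex \<Rightarrow> complex \<Rightarrow> int \<Rightarrow> int \<Rightarrow> cell" where
  "hex_cell a \<tau> x y = map (\<lambda>(p, q). lattice_pt a \<tau> eis_unit (x + p) (y + q)) hex_units"

lemma root_cell_hexagonal: "root_cell (Hexagonal z v) = hex_cell z v 0 0"
proof -
  have "cis (real j * pi / 3) = eis_unit ^ j" for j by (simp add: eis_unit_def Complex.DeMoivre)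
  moreover have "[0..<6] = [0, 1, 2, 3, 4, 5 :: nat]" by (simp add: upt_rec)
  ultimately show ?thesis
    by (simp add: hex_cell_def hex_units_def lattice_pt_def eis_unit_square eis_unit_power algebra_simps)
qed

lemma children_hex_cell:
  "children (hex_cell a \<tau> x y) = (\<lambda>(p, q). tri_cell a \<tau> x y p q) ` set hex_units"
proof -
  have "midpoint (lattice_pt a \<tau> eis_unit (x + 1) (y + 0)) (lattice_pt a \<tau> eis_unit (x + - 1) (y + 0)) = lattice_pt a \<tau> eis_unit x y"
    unfolding midpoint_lattice_pt lattice_pt_double[of a \<tau> eis_unit x y] by simp
  then show ?thesis
    by (simp add: hex_cell_def hex_units_def tri_cell_def Let_def)
qed

text \<open>Three children keep the orientation; the central one starts at the midpoint of the side
  opposite the first vertex and has its edges reversed.\<close>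

lemma children_tri_cell:
  "children (tri_cell a \<tau> x y p q) = {tri_cell a (\<tau> / 2) (2 * x) (2 * y) p q,
    tri_cell a (\<tau> / 2) (2 * x + p) (2 * y + q) p q,
    tri_cell a (\<tau> / 2) (2 * x - q) (2 * y + p + q) p q,
    tri_cell a (\<tau> / 2) (2 * x + p - q) (2 * y + p + 2 * q) (- p) (- q)}"
proof -
  note eqI = arg_cong2[where f = insert] arg_cong2[where f = Cons] arg_cong2[where f = "lattice_pt _ _ _"]
  show ?thesis
    unfolding tri_cell_def children.simps midpoint_lattice_pt
    by (simp only: lattice_pt_double[of a \<tau>]) (intro eqI refl; simp)
qed

lemma uminus_hex_units: "(p, q) \<in> set hex_units \<Longrightarrow> (- p, - q) \<in> set hex_units"
  by (auto simp: hex_units_def)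

text \<open>The triangles of level 1 have the side of the hexagon, so the exponent of 2 lags one
  behind the level.\<close>

lemma tree_cell_hexagonal:
  assumes "tree_cell (root_cell (Hexagonal z v)) l c"
  shows "case l of 0 \<Rightarrow> c = hex_cell z v 0 0
    | Suc k \<Rightarrow> \<exists>x y p q. (p, q) \<in> set hex_units \<and> c = tri_cell z (v / 2 ^ k) x y p q"
  using assms
proof induction
  case base
  show ?case by (simp only: nat.case root_cell_hexagonal)
next
  case (subdivide l c d)
  show ?case
  proof (cases l)
    case 0
    then have "d \<in> (\<lambda>(p, q). tri_cell z v 0 0 p q) ` set hex_units"
      using subdivide by (simp add: children_hex_cell)
    then obtain p q where "(p, q) \<in> set hex_units" "d = tri_cell z v 0 0 p q" by auto
    then show ?thesis unfolding 0 nat.case by (intro exI conjI) auto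
  next
    case (Suc k)
    then obtain x y p q where c: "(p, q) \<in> set hex_units" "c = tri_cell z (v / 2 ^ k) x y p q"
      using subdivide.IH by auto
    have "v / 2 ^ Suc k = v / 2 ^ k / 2" by simp
    then show ?thesis unfolding Suc nat.case
      using subdivide.hyps(2) c(1) uminus_hex_units[OF c(1)] unfolding c(2) children_tri_cell by (simp only: insert_iff empty_iff) blast
  qed
qed

lemma lattice_vector_hexagonal:
  assumes "w \<in> lattice_vectors (Hexagonal z v)"
  obtains m n :: int where "w = v * (of_int (m - n) + of_int (m + 2 * n) * eis_unit)"
proof -
  obtain m n :: int where "w = of_int m * (v * (1 + cis (pi / 3))) + of_int n * (v * (cis (pi / 3) + cis (2 * pi / 3)))"
    using assms by auto
  moreover have "cis (2 * pi / 3) = eis_unit - 1"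
    unfolding eis_unit_square[symmetric] by (simp add: eis_unit_def Complex.DeMoivre)
  ultimately have "w = of_int m * (v * (1 + eis_unit)) + of_int n * (v * (eis_unit + (eis_unit - 1)))"
    by (simp only: eis_unit_def[symmetric])
  then show ?thesis by (intro that[of m n]) (simp add: algebra_simps)
qed

lemma medium_cell_hexagon:
  assumes "medium_cell (Hexagonal z v) 0 c"
  obtains m n :: int where "c = hex_cell z v (m - n) (m + 2 * n)"
proof -
  obtain w c0 where w: "w \<in> lattice_vectors (Hexagonal z v)" "tree_cell (root_cell (Hexagonal z v)) 0 c0" "c = shift w c0"
    using assms unfolding medium_cell_def by blast
  obtain m n where mn: "w = v * (of_int (m - n) + of_int (m + 2 * n) * eis_unit)"
    using lattice_vector_hexagonal[OF w(1)] by blast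
  have "c0 = hex_cell z v 0 0" using tree_cell_hexagonal[OF w(2)] by simp
  then have "c = hex_cell z v (m - n) (m + 2 * n)"
    by (simp add: w(3) hex_cell_def hex_units_def shift_def add_lattice_pt[OF mn] add.commute)
  then show ?thesis by (rule that)
qed

lemma medium_cell_triangle:
  assumes "medium_cell (Hexagonal z v) (Suc l) c"
  obtains x y p q where "(p, q) \<in> set hex_units" "c = tri_cell z (v / 2 ^ l) x y p q"
proof -
  obtain w c0 where w: "w \<in> lattice_vectors (Hexagonal z v)" "tree_cell (root_cell (Hexagonal z v)) (Suc l) c0" "c = shift w c0"
    using assms unfolding medium_cell_def by blast
  obtain m n where mn: "w = v * (of_int (m - n) + of_int (m + 2 * n) * eis_unit)"
    using lattice_vector_hexagonal[OF w(1)] by blast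
  have we: "w = v / 2 ^ l * (of_int (2 ^ l * (m - n)) + of_int (2 ^ l * (m + 2 * n)) * eis_unit)"
    by (simp add: mn field_simps)
  obtain x y p q where c0: "(p, q) \<in> set hex_units" "c0 = tri_cell z (v / 2 ^ l) x y p q"
    using tree_cell_hexagonal[OF w(2)] by auto
  then have "c = tri_cell z (v / 2 ^ l) (x + 2 ^ l * (m - n)) (y + 2 ^ l * (m + 2 * n)) p q"
    unfolding w(3) c0(2) tri_cell_def shift_def list.map add_lattice_pt[OF we] by (simp add: algebra_simps)
  then show ?thesis using c0(1) that by blast
qed

text \<open>A normal form that forgets the order of the vertices and reduces the six values of
  \<open>(p, q)\<close> to the two orientations \<open>e = 1\<close> and
  \<open>e = -1\<close>.\<close>

definition triangle_at :: "complex \<Rightarrow> complex \<Rightarrow> int \<Rightarrow> int \<Rightarrow> int \<Rightarrow> cell \<Rightarrow> bool" where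
  "triangle_at a \<tau> x y e c \<longleftrightarrow> e \<in> {1, - 1} \<and> length c = 3
    \<and> set c = {lattice_pt a \<tau> eis_unit x y, lattice_pt a \<tau> eis_unit (x + e) y, lattice_pt a \<tau> eis_unit x (y + e)}
    \<and> centroid c = lattice_pt a (\<tau> / 3) eis_unit (3 * x + e) (3 * y + e)"

text \<open>Exactly one vertex has its two edges along 1 and \<open>eis_unit\<close>, or along their
  negatives; this corner is the witness in each case.\<close>

lemma triangle_at_tri_cell:
  assumes "(p, q) \<in> set hex_units"
  shows "\<exists>X Y e. triangle_at a \<tau> X Y e (tri_cell a \<tau> x y p q)"
proof -
  have cen: "centroid (tri_cell a \<tau> x y p q) = lattice_pt a (\<tau> / 3) eis_unit (3 * x + p - q) (3 * y + p + 2 * q)"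
  proof -
    have "sum_list (tri_cell a \<tau> x y p q) = 3 * lattice_pt a (\<tau> / 3) eis_unit (3 * x + p - q) (3 * y + p + 2 * q)"
      by (simp add: tri_cell_def lattice_pt_def algebra_simps)
    then show ?thesis by (simp add: centroid_def tri_cell_def)
  qed
  have len: "length (tri_cell a \<tau> x y p q) = 3" by (simp add: tri_cell_def)
  consider "(p, q) = (1, 0)" | "(p, q) = (0, 1)" | "(p, q) = (- 1, 1)" | "(p, q) = (- 1, 0)"
    | "(p, q) = (0, - 1)" | "(p, q) = (1, - 1)"
    using assms by (auto simp: hex_units_def)
  then show ?thesis
  proof cases
    case 1
    then show ?thesis unfolding triangle_at_def cen len
      by (intro exI[of _ x] exI[of _ y] exI[of _ 1]) (auto simp: tri_cell_def)
  next
    case 2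
    then show ?thesis unfolding triangle_at_def cen len
      by (intro exI[of _ x] exI[of _ "y + 1"] exI[of _ "- 1"]) (auto simp: tri_cell_def algebra_simps)
  next
    case 3
    then show ?thesis unfolding triangle_at_def cen len
      by (intro exI[of _ "x - 1"] exI[of _ y] exI[of _ 1]) (auto simp: tri_cell_def algebra_simps)
  next
    case 4
    then show ?thesis unfolding triangle_at_def cen len
      by (intro exI[of _ x] exI[of _ y] exI[of _ "- 1"]) (auto simp: tri_cell_def)
  next
    case 5
    then show ?thesis unfolding triangle_at_def cen len
      by (intro exI[of _ x] exI[of _ "y - 1"] exI[of _ 1]) (auto simp: tri_cell_def algebra_simps)
  next
    case 6
    then show ?thesis unfolding triangle_at_def cen len
      by (intro exI[of _ "x + 1"] exI[of _ y] exI[of _ "- 1"]) (auto simp: tri_cell_def algebra_simps)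
  qed
qed

lemma triangle_at_vertex_dist:
  assumes "triangle_at a \<tau> x y e c" "w \<in> set c"
  shows "(cmod (w - centroid c))\<^sup>2 \<le> (cmod \<tau>)\<^sup>2 / 3"
proof -
  have e: "e \<in> {1, - 1}" and cen: "centroid c = lattice_pt a (\<tau> / 3) eis_unit (3 * x + e) (3 * y + e)"
    using assms(1) by (auto simp: triangle_at_def)
  obtain i j where ij: "w = lattice_pt a \<tau> eis_unit (x + i) (y + j)" "(i, j) \<in> {(0, 0), (e, 0), (0, e)}"
    using assms that[of 0 0] that[of e 0] that[of 0 e] by (auto simp: triangle_at_def)
  have "w - centroid c = \<tau> / 3 * (of_int (3 * i - e) + of_int (3 * j - e) * eis_unit)"
    unfolding ij(1) cen lattice_pt_def by (simp add: algebra_simps)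
  moreover have "(3 * i - e)\<^sup>2 + (3 * i - e) * (3 * j - e) + (3 * j - e)\<^sup>2 = 3" using ij(2) e by auto
  ultimately show ?thesis by (simp only: cmod_eisenstein) (simp add: norm_divide power_divide)
qed

text \<open>Four times the form is \<open>3 x^2 + (x + 2 y)^2\<close>, and
  \<open>3 * 6^2 = 4 * 27\<close>. No squared distance needed for the triangles exceeds 27 in these
  units, so one bound makes all the checks finite.\<close>

lemma eisenstein_norm_bound:
  fixes x y :: int
  assumes "x\<^sup>2 + x * y + y\<^sup>2 < 27" shows "\<bar>x\<bar> \<le> 5" "\<bar>y\<bar> \<le> 5"
proof -
  have *: "\<bar>x\<bar> \<le> 5" if "x\<^sup>2 + x * y + y\<^sup>2 < 27" for x y :: int
  proof (rule ccontr)
    assume "\<not> \<bar>x\<bar> \<le> 5"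
    then have "6\<^sup>2 \<le> \<bar>x\<bar>\<^sup>2" by (intro power_mono) auto
    then have "36 \<le> x\<^sup>2" by simp
    moreover define N S where "N = x\<^sup>2 + x * y + y\<^sup>2" and "S = (x + 2 * y)\<^sup>2"
    moreover have "4 * N = 3 * x\<^sup>2 + S" by (simp add: N_def S_def power2_eq_square algebra_simps)
    moreover have "S \<ge> 0" by (simp add: S_def)
    ultimately show False using that by linarith
  qed
  show "\<bar>x\<bar> \<le> 5" by (rule *[OF assms])
  show "\<bar>y\<bar> \<le> 5" by (rule *[of y x]) (use assms in \<open>simp add: algebra_simps\<close>)
qed

text \<open>Disjointness is phrased as a test on lists, so that the finite checks can be
  evaluated.\<close>

definition far_apart :: "(int \<times> int) list \<Rightarrow> (int \<times> int) list \<Rightarrow> bool" where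
  "far_apart P Q \<longleftrightarrow> list_all (\<lambda>a. \<not> List.member Q a) P"

lemma far_apart_iff: "far_apart P Q \<longleftrightarrow> set P \<inter> set Q = {}"
  by (auto simp: far_apart_def list_all_iff)

text \<open>Coordinates are relative to the corner of the second triangle, and the form is nine
  times the squared centroid distance in units of \<open>cmod \<tau>\<close>. Larger
  \<open>m\<close> or \<open>n\<close> need no check, since a coordinate above 5 already makes the
  form at least 27.\<close>

lemma triangle_triangle_check:
  "\<forall>m\<in>set [-3..3]. \<forall>n\<in>set [-3..3]. \<forall>e\<in>set [1, -1]. \<forall>f\<in>set [1, -1].
    far_apart [(m, n), (m + e, n), (m, n + e)] [(0, 0), (f, 0), (0, f)] \<longrightarrow>
    15 \<le> (3 * m + e - f)\<^sup>2 + (3 * m + e - f) * (3 * n + e - f) + (3 * n + e - f :: int)\<^sup>2"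
  by code_simp

text \<open>The six points are the corners and edge midpoints of a triangle of twice the side, that
  is, the vertices of its children.\<close>

lemma triangle_big_triangle_check:
  "\<forall>m\<in>set [-3..3]. \<forall>n\<in>set [-3..3]. \<forall>e\<in>set [1, -1]. \<forall>f\<in>set [1, -1].
    far_apart [(m, n), (m + e, n), (m, n + e)] [(0, 0), (f, 0), (2 * f, 0), (0, f), (0, 2 * f), (f, f)] \<longrightarrow>
    27 \<le> (3 * m + e - 2 * f)\<^sup>2 + (3 * m + e - 2 * f) * (3 * n + e - 2 * f) + (3 * n + e - 2 * f :: int)\<^sup>2"
  by code_simp

text \<open>The seven points are the vertices of the six children of the hexagon, its centre
  included.\<close>

lemma triangle_hexagon_check:
  "\<forall>m\<in>set [-3..3]. \<forall>n\<in>set [-3..3]. \<forall>e\<in>set [1, -1].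
    far_apart [(m, n), (m + e, n), (m, n + e)] ((0, 0) # hex_units) \<longrightarrow>
    24 \<le> (3 * m + e)\<^sup>2 + (3 * m + e) * (3 * n + e) + (3 * n + e :: int)\<^sup>2"
  by code_simp

lemma centroid_hex_cell: "centroid (hex_cell a \<tau> x y) = lattice_pt a \<tau> eis_unit x y"
proof -
  have "sum_list (hex_cell a \<tau> x y) = 6 * lattice_pt a \<tau> eis_unit x y"
    by (simp add: hex_cell_def hex_units_def lattice_pt_def algebra_simps)
  then show ?thesis by (simp add: centroid_def hex_cell_def hex_units_def)
qed

lemma hex_cell_vertex_dist:
  assumes "w \<in> set (hex_cell a \<tau> x y)"
  shows "(cmod (w - centroid (hex_cell a \<tau> x y)))\<^sup>2 \<le> (cmod \<tau>)\<^sup>2"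
proof -
  obtain p q where pq: "(p, q) \<in> set hex_units" "w = lattice_pt a \<tau> eis_unit (x + p) (y + q)"
    using assms by (auto simp: hex_cell_def)
  have "w - centroid (hex_cell a \<tau> x y) = \<tau> * (of_int p + of_int q * eis_unit)"
    unfolding pq(2) centroid_hex_cell lattice_pt_def by (simp add: algebra_simps)
  moreover have "p\<^sup>2 + p * q + q\<^sup>2 = 1" using pq(1) by (auto simp: hex_units_def)
  ultimately show ?thesis by (simp only: cmod_eisenstein of_int_1 mult_1_right order_refl)
qed

text \<open>The case \<open>p = q\<close> covers the corners themselves.\<close>

lemma midpoint_in_child:
  assumes "length c = 3" "p \<in> set c" "q \<in> set c"
  shows "\<exists>e\<in>children c. midpoint p q \<in> set e"
proof -
  obtain x y z where c: "c = [x, y, z]"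
    using assms(1) by (auto simp: length_Suc_conv numeral_3_eq_3)
  show ?thesis using assms(2,3) by (auto simp: c midpoint_sym)
qed

lemma contractive_hexagonal:
  assumes v: "v \<noteq> 0" and d: "medium_cell (Hexagonal z v) ld d" and c: "medium_cell (Hexagonal z v) lc c"
    and l: "lc \<le> ld" "ld - lc \<le> 1"
    and sep: "\<And>e. medium_cell (Hexagonal z v) ld e \<Longrightarrow> region e \<subseteq> region c \<Longrightarrow> \<not> adjacent d e"
  shows "contractive c d"
proof (cases ld)
  case 0
  then have lc: "lc = 0" using l by simp
  obtain m n where dm: "d = hex_cell z v (m - n) (m + 2 * n)" using medium_cell_hexagon d 0 by blast
  obtain m' n' where cm: "c = hex_cell z v (m' - n') (m' + 2 * n')" using medium_cell_hexagon c lc by blast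
  define X Y where "X = m - n - (m' - n')" and "Y = m + 2 * n - (m' + 2 * n')"
  define i j where "i = m - m'" and "j = n - n'"
  have XY: "X = i - j" "Y = i + 2 * j" by (simp_all add: X_def Y_def i_def j_def)
  have disj: "set d \<inter> set c = {}"
    by (rule not_adjacent_disjoint[OF sep]) (use c 0 lc in auto)
  have N: "X\<^sup>2 + X * Y + Y\<^sup>2 = 3 * (i\<^sup>2 + i * j + j\<^sup>2)" by (simp add: XY power2_eq_square algebra_simps)
  \<comment> \<open>A smaller value would mean equal or neighbouring hexagons, which share a vertex;
    the bound 5 on the coordinates leaves a finite check.\<close>
  have "2 \<le> i\<^sup>2 + i * j + j\<^sup>2"
  proof (rule ccontr)
    assume "\<not> ?thesis"
    then have small: "i\<^sup>2 + i * j + j\<^sup>2 < 2" by simp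
    have bd: "\<bar>i\<bar> \<le> 5" "\<bar>j\<bar> \<le> 5" using eisenstein_norm_bound[of i j] small by auto
    have chk: "\<forall>i\<in>set [-5..5]. \<forall>j\<in>set [-5..5]. i\<^sup>2 + i * j + j\<^sup>2 < (2::int) \<longrightarrow>
      (\<exists>(p, q)\<in>set hex_units. List.member hex_units (i - j + p, i + 2 * j + q))"
      by code_simp
    have "\<exists>(p, q)\<in>set hex_units. List.member hex_units (i - j + p, i + 2 * j + q)"
      by (rule chk[rule_format]) (use bd small in auto)
    then obtain p q where pq: "(p, q) \<in> set hex_units" "(i - j + p, i + 2 * j + q) \<in> set hex_units"
      by auto
    have "lattice_pt z v eis_unit (m - n + p) (m + 2 * n + q) \<in> set d"
      unfolding dm hex_cell_def using pq(1) by force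
    moreover have "lattice_pt z v eis_unit (m' - n' + (i - j + p)) (m' + 2 * n' + (i + 2 * j + q)) \<in> set c"
      unfolding cm hex_cell_def using pq(2) by force
    moreover have "m' - n' + (i - j + p) = m - n + p" "m' + 2 * n' + (i + 2 * j + q) = m + 2 * n + q"
      by (simp_all add: i_def j_def)
    ultimately show False using disj by auto
  qed
  then have "6 \<le> X\<^sup>2 + X * Y + Y\<^sup>2" unfolding N by simp
  then have N6: "6 \<le> real_of_int (X\<^sup>2 + X * Y + Y\<^sup>2)" by linarith
  define t where "t = (cmod v)\<^sup>2"
  have t: "t > 0" using v by (simp add: t_def)
  have "centroid d - centroid c = v * (of_int X + of_int Y * eis_unit)"
    unfolding dm cm centroid_hex_cell lattice_pt_def X_def Y_def by (simp add: algebra_simps)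
  then have R: "t * 6 \<le> (cmod (centroid d - centroid c))\<^sup>2"
    using mult_left_mono[OF N6, of t] t by (simp only: cmod_eisenstein t_def)
  have P: "(cmod (w - centroid d))\<^sup>2 \<le> t" if "w \<in> set d" for w
    using hex_cell_vertex_dist that by (simp add: dm t_def)
  have Q: "(cmod (w - centroid c))\<^sup>2 \<le> t" if "w \<in> set c" for w
    using hex_cell_vertex_dist that by (simp add: cm t_def)
  show ?thesis
    by (rule contractiveI[OF P Q R, of "41/100" "62/100"]) (use t in \<open>simp_all add: power2_eq_square power_numeral_reduce\<close>)
next
  case (Suc k)
  define \<tau> where "\<tau> = v / 2 ^ k"
  define t where "t = (cmod \<tau>)\<^sup>2"
  have t: "t > 0" using v by (simp add: t_def \<tau>_def)
  obtain x y e where dt: "triangle_at z \<tau> x y e d"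
    using medium_cell_triangle[OF d[unfolded Suc]] triangle_at_tri_cell unfolding \<tau>_def by metis
  then have e: "e \<in> {1, - 1}" and dset: "set d = {lattice_pt z \<tau> eis_unit x y, lattice_pt z \<tau> eis_unit (x + e) y, lattice_pt z \<tau> eis_unit x (y + e)}"
    and dcen: "centroid d = lattice_pt z (\<tau> / 3) eis_unit (3 * x + e) (3 * y + e)" by (auto simp: triangle_at_def)
  have P: "(cmod (w - centroid d))\<^sup>2 \<le> t / 3" if "w \<in> set d" for w
    using triangle_at_vertex_dist[OF dt that] by (simp add: t_def)
  have d_avoids: "set d \<inter> set e = {}" if "medium_cell (Hexagonal z v) ld e" "region e \<subseteq> region c" for e
    by (rule not_adjacent_disjoint[OF sep[OF that]])
  have child_avoids: "set d \<inter> set e = {}" if "Suc lc = ld" "e \<in> children c" for e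
    using d_avoids medium_cell_children[OF c that(2)] children_region[OF that(2)] that(1) by simp
  have far: "far_apart [(m, n), (m + e, n), (m, n + e)] Q"
    if "m = x - x'" "n = y - y'" "\<And>a b. (a, b) \<in> set Q \<Longrightarrow> lattice_pt z \<tau> eis_unit (x' + a) (y' + b) \<notin> set d" for m n x' y' Q
  proof -
    have mem: "lattice_pt z \<tau> eis_unit (x' + a) (y' + b) \<in> set d" if "(a, b) \<in> set [(m, n), (m + e, n), (m, n + e)]" for a b
      using that \<open>m = x - x'\<close> \<open>n = y - y'\<close> by (auto simp: dset)
    show ?thesis unfolding far_apart_iff
    proof (rule equals0I)
      fix u assume u: "u \<in> set [(m, n), (m + e, n), (m, n + e)] \<inter> set Q"
      obtain a b where "u = (a, b)" by (cases u)
      then show False using u mem that(3) by blast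
    qed
  qed
  \<comment> \<open>The partner of the triangle \<open>d\<close> is a triangle of the same size, a
    hexagon, or a triangle of twice the side.\<close>
  consider "lc = ld" | "lc = 0" "k = 0" | k' where "k = Suc k'" "lc = Suc k'"
    using l Suc by (cases "lc = ld"; cases k) auto
  then show ?thesis
  proof cases
    case 1
    obtain x' y' f where ct: "triangle_at z \<tau> x' y' f c"
      using medium_cell_triangle[OF c[unfolded 1 Suc]] triangle_at_tri_cell unfolding \<tau>_def by metis
    then have f: "f \<in> {1, - 1}" and cset: "set c = {lattice_pt z \<tau> eis_unit x' y', lattice_pt z \<tau> eis_unit (x' + f) y', lattice_pt z \<tau> eis_unit x' (y' + f)}"
      and ccen: "centroid c = lattice_pt z (\<tau> / 3) eis_unit (3 * x' + f) (3 * y' + f)" by (auto simp: triangle_at_def)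
    have disj: "set d \<inter> set c = {}" using d_avoids c 1 by simp
    define m n where "m = x - x'" and "n = y - y'"
    have fa: "far_apart [(m, n), (m + e, n), (m, n + e)] [(0, 0), (f, 0), (0, f)]"
      by (rule far[OF m_def n_def]) (use disj in \<open>auto simp: cset\<close>)
    define X Y where "X = 3 * m + e - f" and "Y = 3 * n + e - f"
    have N: "15 \<le> X\<^sup>2 + X * Y + Y\<^sup>2"
    proof (rule ccontr)
      assume n15: "\<not> ?thesis"
      then have "\<bar>X\<bar> \<le> 5" "\<bar>Y\<bar> \<le> 5" using eisenstein_norm_bound[of X Y] by auto
      then have "m \<in> set [-3..3]" "n \<in> set [-3..3]" using e f by (auto simp: X_def Y_def)
      then show False using triangle_triangle_check[rule_format, OF _ _ _ _ fa] e f n15 by (auto simp: X_def Y_def)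
    qed
    then have N': "15 \<le> real_of_int (X\<^sup>2 + X * Y + Y\<^sup>2)" by linarith
    have "centroid d - centroid c = \<tau> / 3 * (of_int X + of_int Y * eis_unit)"
      unfolding dcen ccen lattice_pt_def X_def Y_def m_def n_def by (simp add: algebra_simps)
    then have R: "t / 9 * 15 \<le> (cmod (centroid d - centroid c))\<^sup>2"
      using mult_left_mono[OF N', of "t / 9"] t by (simp only: cmod_eisenstein) (simp add: t_def norm_divide power_divide)
    have Q: "(cmod (w - centroid c))\<^sup>2 \<le> t / 3" if "w \<in> set c" for w
      using triangle_at_vertex_dist[OF ct that] by (simp add: t_def)
    show ?thesis
      by (rule contractiveI[OF P Q R, of "45/100" "68/100"]) (use t in \<open>simp_all add: power2_eq_square power_numeral_reduce\<close>)
  next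
    case 2
    then have tv: "\<tau> = v" by (simp add: \<tau>_def)
    obtain m' n' where cm0: "c = hex_cell z v (m' - n') (m' + 2 * n')" using medium_cell_hexagon c 2(1) by blast
    define x' y' where "x' = m' - n'" and "y' = m' + 2 * n'"
    have cm: "c = hex_cell z \<tau> x' y'" by (simp add: cm0 x'_def y'_def tv)
    have child: "set d \<inter> set (tri_cell z \<tau> x' y' p q) = {}" if "(p, q) \<in> set hex_units" for p q
      by (rule child_avoids) (use that 2 Suc in \<open>force simp: cm children_hex_cell\<close>)+
    define m n where "m = x - x'" and "n = y - y'"
    have fa: "far_apart [(m, n), (m + e, n), (m, n + e)] ((0, 0) # hex_units)"
    proof (rule far[OF m_def n_def])
      fix a b assume "(a, b) \<in> set ((0, 0) # hex_units)"
      then consider "a = 0" "b = 0" | "(a, b) \<in> set hex_units" by auto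
      then show "lattice_pt z \<tau> eis_unit (x' + a) (y' + b) \<notin> set d"
      proof cases
        case 1
        then show ?thesis using child[of 1 0] by (auto simp: tri_cell_def hex_units_def)
      next
        case 2
        then show ?thesis using child[OF 2] by (auto simp: tri_cell_def)
      qed
    qed
    define X Y where "X = 3 * m + e" and "Y = 3 * n + e"
    have N: "24 \<le> X\<^sup>2 + X * Y + Y\<^sup>2"
    proof (rule ccontr)
      assume n15: "\<not> ?thesis"
      then have "\<bar>X\<bar> \<le> 5" "\<bar>Y\<bar> \<le> 5" using eisenstein_norm_bound[of X Y] by auto
      then have "m \<in> set [-3..3]" "n \<in> set [-3..3]" using e by (auto simp: X_def Y_def)
      then show False using triangle_hexagon_check[rule_format, OF _ _ _ fa] e n15 by (auto simp: X_def Y_def)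
    qed
    then have N': "24 \<le> real_of_int (X\<^sup>2 + X * Y + Y\<^sup>2)" by linarith
    have "centroid d - centroid c = \<tau> / 3 * (of_int X + of_int Y * eis_unit)"
      unfolding dcen cm centroid_hex_cell lattice_pt_def X_def Y_def m_def n_def by (simp add: algebra_simps)
    then have R: "t / 9 * 24 \<le> (cmod (centroid d - centroid c))\<^sup>2"
      using mult_left_mono[OF N', of "t / 9"] t by (simp only: cmod_eisenstein) (simp add: t_def norm_divide power_divide)
    have Q: "(cmod (w - centroid c))\<^sup>2 \<le> t" if "w \<in> set c" for w
      using hex_cell_vertex_dist that by (simp add: cm t_def)
    show ?thesis
      by (rule contractiveI[OF P Q R, of "36/100" "93/100"]) (use t in \<open>simp_all add: power2_eq_square power_numeral_reduce\<close>)
  next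
    case 3
    have tau2: "v / 2 ^ k' = \<tau> * 2" by (simp add: \<tau>_def 3(1))
    obtain x' y' f where ct: "triangle_at z (\<tau> * 2) x' y' f c"
      using medium_cell_triangle[OF c[unfolded 3(2)]] triangle_at_tri_cell unfolding tau2 by metis
    then have f: "f \<in> {1, - 1}" and len: "length c = 3"
      and cset: "set c = {lattice_pt z (\<tau> * 2) eis_unit x' y', lattice_pt z (\<tau> * 2) eis_unit (x' + f) y', lattice_pt z (\<tau> * 2) eis_unit x' (y' + f)}"
      and ccen: "centroid c = lattice_pt z (\<tau> * 2 / 3) eis_unit (3 * x' + f) (3 * y' + f)" by (auto simp: triangle_at_def)
    have mid: "midpoint p q \<notin> set d" if pq: "p \<in> set c" "q \<in> set c" for p q
    proof -
      obtain w where "w \<in> children c" "midpoint p q \<in> set w" using midpoint_in_child[OF len pq] by blast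
      then show ?thesis using child_avoids 3 Suc by blast
    qed
    have mid': "lattice_pt z \<tau> eis_unit X Y \<notin> set d"
      if "lattice_pt z (\<tau> * 2) eis_unit i j \<in> set c" "lattice_pt z (\<tau> * 2) eis_unit i' j' \<in> set c" "X = i + i'" "Y = j + j'" for i j i' j' X Y
      using mid[OF that(1,2)] by (simp add: midpoint_lattice_pt that(3,4))
    define m n where "m = x - 2 * x'" and "n = y - 2 * y'"
    have fa: "far_apart [(m, n), (m + e, n), (m, n + e)] [(0, 0), (f, 0), (2 * f, 0), (0, f), (0, 2 * f), (f, f)]"
    proof (rule far[OF m_def n_def])
      fix a b assume "(a, b) \<in> set [(0, 0), (f, 0), (2 * f, 0), (0, f), (0, 2 * f), (f, f)]"
      then show "lattice_pt z \<tau> eis_unit (2 * x' + a) (2 * y' + b) \<notin> set d"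
        using mid'[of x' y' x' y' "2 * x'" "2 * y'"] mid'[of x' y' "x' + f" y' "2 * x' + f" "2 * y'"]
          mid'[of "x' + f" y' "x' + f" y' "2 * x' + 2 * f" "2 * y'"]
          mid'[of x' y' x' "y' + f" "2 * x'" "2 * y' + f"]
          mid'[of x' "y' + f" x' "y' + f" "2 * x'" "2 * y' + 2 * f"]
          mid'[of "x' + f" y' x' "y' + f" "2 * x' + f" "2 * y' + f"]
        by (auto simp: cset)
    qed
    define X Y where "X = 3 * m + e - 2 * f" and "Y = 3 * n + e - 2 * f"
    have N: "27 \<le> X\<^sup>2 + X * Y + Y\<^sup>2"
    proof (rule ccontr)
      assume n15: "\<not> ?thesis"
      then have "\<bar>X\<bar> \<le> 5" "\<bar>Y\<bar> \<le> 5" using eisenstein_norm_bound[of X Y] by auto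
      then have "m \<in> set [-3..3]" "n \<in> set [-3..3]" using e f by (auto simp: X_def Y_def)
      then show False using triangle_big_triangle_check[rule_format, OF _ _ _ _ fa] e f n15 by (auto simp: X_def Y_def)
    qed
    then have N': "27 \<le> real_of_int (X\<^sup>2 + X * Y + Y\<^sup>2)" by linarith
    have "centroid d - centroid c = \<tau> / 3 * (of_int X + of_int Y * eis_unit)"
      unfolding dcen ccen lattice_pt_def X_def Y_def m_def n_def by (simp add: algebra_simps)
    then have R: "t / 9 * 27 \<le> (cmod (centroid d - centroid c))\<^sup>2"
      using mult_left_mono[OF N', of "t / 9"] t by (simp only: cmod_eisenstein) (simp add: t_def norm_divide power_divide)
    have Q: "(cmod (w - centroid c))\<^sup>2 \<le> 4 * t / 3" if "w \<in> set c" for w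
      using triangle_at_vertex_dist[OF ct that] by (simp add: t_def norm_mult power_mult_distrib)
    \<comment> \<open>The narrowest case: both ratios are attained exactly, and strictness comes
      from \<open>(1 + 1/4 + 1/16) ^ 4 < 3\<close>.\<close>
    show ?thesis
      by (rule contractiveI[OF P Q R, of "1/3" "1"]) (use t in \<open>simp_all add: power2_eq_square power_numeral_reduce\<close>)
  qed
qed

section \<open>Translates, arcs and the main theorem\<close>

lemma centroid_shift: "c \<noteq> [] \<Longrightarrow> centroid (shift w c) = w + centroid c"
proof -
  assume "c \<noteq> []"
  moreover have "sum_list (shift w c) = of_nat (length c) * w + sum_list c"
    by (induction c) (simp_all add: shift_def algebra_simps)
  ultimately show ?thesis by (simp add: centroid_def shift_def add_divide_distrib)
qed

lemma region_shift: "region (shift w c) = (+) w ` region c"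
  by (simp add: region_def shift_def convex_hull_translation)

lemma contractive_translate:
  assumes "periodic_medium U H" "medium_cell U lD D" "medium_cell U lC C" "well_separated U H lC C lD D"
  shows "contractive (shift (of_int m * period_vector H) C) D"
proof -
  let ?C = "shift (of_int m * period_vector H) C"
  have c: "medium_cell U lC ?C"
    using assms(1,3) by (intro medium_cell_shift lattice_vectors_of_int_mult) (simp_all add: periodic_medium_def)
  have l: "lC \<le> lD" "lD - lC \<le> max_level_difference U"
    and sep: "\<And>e. medium_cell U lD e \<Longrightarrow> region e \<subseteq> region ?C \<Longrightarrow> \<not> adjacent D e"
    using assms(4) by (auto simp: well_separated_def)
  show ?thesis
  proof (cases U)
    case (Square a s)
    show ?thesis
      by (rule contractive_square[of s a lD D lC])
        (use assms(1,2) c l sep in \<open>simp_all add: Square periodic_medium_def\<close>)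
  next
    case (Hexagonal z v)
    show ?thesis
      by (rule contractive_hexagonal[of v z lD D lC])
        (use assms(1,2) c l sep in \<open>simp_all add: Hexagonal periodic_medium_def\<close>)
  qed
qed

text \<open>For \<open>\<bar>m\<bar> \<ge> 2\<close> the vertical shift is at least
  \<open>2 * H\<close> while \<open>\<bar>Im a\<bar> \<le> H\<close>, so the height cannot decrease
  in modulus; the real part is unchanged.\<close>

lemma nearest_translate:
  assumes H: "H > 0" "cmod a \<le> H" and m: "m \<notin> {-1, 0, 1 :: int}"
  shows "cmod a \<le> cmod (a - of_int m * period_vector H)"
proof -
  have "2 * H \<le> of_int \<bar>m\<bar> * H"
    using m H(1) by (intro mult_right_mono) auto
  then have "2 * H \<le> \<bar>of_int m * H\<bar>" using H(1) by (simp add: abs_mult)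
  moreover have "\<bar>Im a\<bar> \<le> H" using abs_Im_le_cmod[of a] H(2) by simp
  ultimately have "\<bar>Im a\<bar> \<le> \<bar>Im a - of_int m * H\<bar>" by linarith
  then have "(Im a)\<^sup>2 \<le> (Im a - of_int m * H)\<^sup>2" by (simp only: abs_le_square_iff)
  then show ?thesis by (simp add: cmod_def period_vector_def)
qed

section \<open>Arc-length curves and their elements\<close>

lemma closed_curve_lipschitz:
  assumes "closed_curve g L" "0 \<le> a" "a \<le> b" "b \<le> L"
  shows "dist (g a) (g b) \<le> b - a"
proof (cases "a = b")
  case False
  \<comment> \<open>The trivial division expresses that a chord is no longer than its arc.\<close>
  have "{{a..b}} division_of {a..b}" using assms(3) by (intro division_of_self[of a b, unfolded box_real]) auto
  then have "ereal (\<Sum>K\<in>{{a..b}}. dist (g (Inf K)) (g (Sup K))) \<le> curve_length g a b"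
    unfolding curve_length_def by (intro SUP_upper) simp
  then show ?thesis using assms by (simp add: closed_curve_def)
qed simp

lemma closed_curve_continuous:
  assumes "closed_curve g L" shows "continuous_on {0..L} g"
proof (rule continuous_onI)
  fix x e :: real assume x: "x \<in> {0..L}" and e: "e > 0"
  have "dist (g x') (g x) \<le> e" if "x' \<in> {0..L}" "dist x' x < e" for x'
    using closed_curve_lipschitz[OF assms, of x x'] closed_curve_lipschitz[OF assms, of x' x] x that
    by (cases "x \<le> x'") (auto simp: dist_real_def dist_commute)
  then show "\<exists>d>0. \<forall>x'\<in>{0..L}. dist x' x < d \<longrightarrow> dist (g x') (g x) \<le> e" using e by blast
qed

lemma subdivision_bounds:
  assumes "subdivision L N t" "j < N"
  shows "0 \<le> t j" "t j < t (Suc j)" "t (Suc j) \<le> L"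
proof -
  have step: "t i < t (Suc i)" if "i < N" for i using assms(1) that by (simp add: subdivision_def)
  have mono: "i \<le> n \<Longrightarrow> n \<le> N \<Longrightarrow> t i \<le> t n" for i n
  proof (induction n)
    case (Suc n)
    then show ?case using step[of n] by (cases "i = Suc n") auto
  qed simp
  show "0 \<le> t j" "t j < t (Suc j)" "t (Suc j) \<le> L"
    using mono[of 0 j] step[of j] mono[of "Suc j" N] assms by (auto simp: subdivision_def)
qed

theorem theorem2:
  fixes k H \<theta> L lam :: real
    and U :: unit_lattice
    and C D :: cell
    and lC lD N j :: nat
    and \<gamma> :: "real \<Rightarrow> complex"
    and t :: "nat \<Rightarrow> real"
    and \<phi> :: "complex \<Rightarrow> complex"
    and x :: complex
    and \<Delta> :: "complex set"
  assumes "k > 0" and "H > 0"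
    and "periodic_medium U H"
    and "medium_cell U lD D" and "medium_cell U lC C"
    and "well_separated U H lC C lD D"
    and "closed_curve \<gamma> L" and "subdivision L N t" and "j < N"
    and "\<Delta> = \<gamma> ` {t j..t (Suc j)}" and "\<Delta> \<subseteq> region C"
    and "continuous_on (\<gamma> ` {0..L}) \<phi>"
    and "x \<in> region D"
    and "\<forall>n::nat. k * H * (1 + sin \<theta>) \<noteq> 2 * real n * pi \<and> k * H * (1 - sin \<theta>) \<noteq> 2 * real n * pi"
    and "H \<ge> cmod (centroid D - centroid C)"
    and "lam = Max {m2l_rate H x (centroid D) (centroid C) \<Delta> (-1),
                    m2l_rate H x (centroid D) (centroid C) \<Delta> 0,
                    m2l_rate H x (centroid D) (centroid C) \<Delta> 1}"
  shows "(\<forall>p n. bilateral_summable (m2l_summand k H \<theta> x (centroid D) (centroid C) p n)) \<and>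
    (\<lambda>p. cmod (m2l_error k H \<theta> x (centroid D) (centroid C)
                 (multipole_moment k \<gamma> (t j) (t (Suc j)) \<phi> (centroid C)) p))
      \<in> O(\<lambda>p. lam ^ p / real p)"
  proof -
  let ?zD = "centroid D" and ?zC = "centroid C" and ?h = "period_vector H"
  let ?M = "multipole_moment k \<gamma> (t j) (t (Suc j)) \<phi> ?zC"
  note per = \<open>periodic_medium U H\<close>
  note tj = subdivision_bounds[OF \<open>subdivision L N t\<close> \<open>j < N\<close>]
  have sub: "{t j..t (Suc j)} \<subseteq> {0..L}" using tj by auto
  have \<gamma>: "continuous_on {0..L} \<gamma>" by (rule closed_curve_continuous) fact
  have \<Delta>: "\<Delta> \<noteq> {}" "compact \<Delta>"
    using tj compact_continuous_image[OF continuous_on_subset[OF \<gamma> sub]]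
    by (auto simp: \<open>\<Delta> = \<gamma> ` {t j..t (Suc j)}\<close>)
  have "continuous_on \<Delta> (\<lambda>y. cmod (y - ?zC))" by (intro continuous_intros)
  \<comment> \<open>A farthest point of the arc maximises the exponential for all \<open>m\<close>
    simultaneously.\<close>
  then obtain y where y: "y \<in> \<Delta>" "\<And>y'. y' \<in> \<Delta> \<Longrightarrow> cmod (y' - ?zC) \<le> cmod (y - ?zC)"
    using continuous_attains_sup[OF \<Delta>(2,1)] by blast
  define \<sigma> where "\<sigma> = cmod (y - ?zC)"
  define r where "r m = cmod (?zD - ?zC - of_int m * ?h)" for m :: int
  have "C \<noteq> []" using \<open>\<Delta> \<subseteq> region C\<close> y(1) by (auto simp: region_def)
  have con: "r m > 0 \<and> cmod (x - ?zD) / r m * exp (3 * \<sigma> / (2 * r m)) < 1" for m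
  proof -
    let ?w = "of_int m * ?h"
    have c: "contractive (shift ?w C) D"
      using contractive_translate[OF per \<open>medium_cell U lD D\<close> \<open>medium_cell U lC C\<close>
          \<open>well_separated U H lC C lD D\<close>] .
    have cen: "centroid (shift ?w C) = ?w + ?zC" by (rule centroid_shift) fact
    have r: "cmod (?zD - (?w + ?zC)) = r m" by (simp add: r_def algebra_simps)
    have s: "cmod (?w + y - (?w + ?zC)) = \<sigma>" by (simp add: \<sigma>_def)
    have "?w + y \<in> region (shift ?w C)" using y(1) \<open>\<Delta> \<subseteq> region C\<close> by (auto simp: region_shift)
    then have "cmod (x - ?zD) / r m * exp (3 * cmod (?w + y - (?w + ?zC)) / (2 * r m)) < 1"
      using c \<open>x \<in> region D\<close> unfolding contractive_def cen r by blast
    moreover have "?zD \<noteq> ?w + ?zC" using c unfolding contractive_def cen by blast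
    then have "r m > 0" unfolding r[symmetric] by simp
    ultimately show ?thesis unfolding s by blast
  qed
  obtain m0 where m0: "m0 \<in> {-1, 0, 1}" "\<And>m. m \<in> {-1, 0, 1} \<Longrightarrow> r m0 \<le> r m"
    using ex_is_arg_min_if_finite[of "{-1, 0, 1 :: int}" r] unfolding is_arg_min_linorder by auto
  have r_min: "r m0 \<le> r m" for m
  proof (cases "m \<in> {-1, 0, 1}")
    case False
    have "r m0 \<le> r 0" by (rule m0(2)) simp
    also have "\<dots> \<le> r m"
      using nearest_translate[OF \<open>H > 0\<close> \<open>H \<ge> cmod (?zD - ?zC)\<close> False] by (simp add: r_def)
    finally show ?thesis .
  qed (rule m0(2))
  \<comment> \<open>The rate of the nearest translate: since \<open>r m0\<close> bounds all
    distances from below, \<open>m2l_error_bound\<close> yields this base, and \<open>m0\<close> is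
    one of the indices over which \<open>lam\<close> is the maximum.\<close>
  define \<mu> where "\<mu> = cmod (x - ?zD) / r m0 * exp (3 * \<sigma> / (2 * r m0))"
  have mu: "0 \<le> \<mu>" "\<mu> < 1" using con[of m0] by (auto simp: \<mu>_def)
  have "\<mu> \<le> m2l_rate H x ?zD ?zC \<Delta> m0"
    unfolding m2l_rate_def Let_def \<mu>_def \<sigma>_def r_def[symmetric]
  proof (rule cSUP_upper[OF y(1)], rule bdd_aboveI2)
    fix y' assume "y' \<in> \<Delta>"
    then show "cmod (x - ?zD) / r m0 * exp (3 * cmod (y' - ?zC) / (2 * r m0))
      \<le> cmod (x - ?zD) / r m0 * exp (3 * cmod (y - ?zC) / (2 * r m0))"
      using con[of m0] y(2) by (intro mult_left_mono) (auto intro!: divide_right_mono)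
  qed
  also have "\<dots> \<le> lam" unfolding \<open>lam = _\<close> using m0(1) by (intro Max_ge) auto
  finally have lam: "\<mu> \<le> lam" .
  have "compact (\<phi> ` \<gamma> ` {0..L})"
    by (rule compact_continuous_image[OF \<open>continuous_on (\<gamma> ` {0..L}) \<phi>\<close> compact_continuous_image[OF \<gamma> compact_Icc]])
  then obtain \<Phi> where \<Phi>: "\<And>s. s \<in> {0..L} \<Longrightarrow> norm (\<phi> (\<gamma> s)) \<le> \<Phi>"
    unfolding compact_eq_bounded_closed bounded_iff by blast
  have "\<exists>C\<ge>0. \<forall>n. norm (?M n) \<le> C * ((k * \<sigma> / 2) ^ nat \<bar>n\<bar> / fact (nat \<bar>n\<bar>))"
  proof (rule multipole_moment_bound[OF \<open>k > 0\<close>])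
    show "cmod (\<gamma> s - ?zC) \<le> \<sigma>" if "s \<in> {t j..t (Suc j)}" for s
      unfolding \<sigma>_def by (rule y(2)) (use that in \<open>simp add: \<open>\<Delta> = \<gamma> ` {t j..t (Suc j)}\<close>\<close>)
    show "norm (\<phi> (\<gamma> s)) \<le> \<Phi>" if "s \<in> {t j..t (Suc j)}" for s using \<Phi> sub that by blast
  qed (use tj in \<open>auto simp: \<sigma>_def\<close>)
  then obtain C0 where C0: "C0 \<ge> 0" "\<And>n. norm (?M n) \<le> C0 * ((k * \<sigma> / 2) ^ nat \<bar>n\<bar> / fact (nat \<bar>n\<bar>))"
    by blast
  have res: "k * H * (1 + sin \<theta>) \<noteq> 2 * real n * pi \<and> k * H * (1 - sin \<theta>) \<noteq> 2 * real n * pi" for n :: nat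
    using \<open>\<forall>n::nat. k * H * (1 + sin \<theta>) \<noteq> _ n \<and> _ n\<close> by blast
  have \<sigma>0: "\<sigma> \<ge> 0" by (simp add: \<sigma>_def)
  have r0: "0 < r m0" using con by blast
  have r_le: "r m0 \<le> cmod (?zD - ?zC - of_int m * ?h)" for m
    using r_min[of m] unfolding r_def[of m] .
  note main = m2l_error_bound[OF \<open>k > 0\<close> \<open>H > 0\<close> res r0 r_le \<sigma>0 C0 mu(2)[unfolded \<mu>_def], folded \<mu>_def]
  obtain K where K: "K \<ge> 0" "\<And>p. p \<ge> 1 \<Longrightarrow> norm (m2l_error k H \<theta> x ?zD ?zC ?M p) \<le> K * (\<mu> ^ p / real p)"
    using main(2) by blast
  have "norm (cmod (m2l_error k H \<theta> x ?zD ?zC ?M p)) \<le> K * norm (lam ^ p / real p)" if "p \<ge> 1" for p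
  proof -
    have "\<mu> ^ p / real p \<le> lam ^ p / real p"
      using lam mu(1) by (intro divide_right_mono power_mono) auto
    then have "K * (\<mu> ^ p / real p) \<le> K * (lam ^ p / real p)" using K(1) by (rule mult_left_mono)
    also have "\<dots> \<le> K * norm (lam ^ p / real p)"
      unfolding real_norm_def by (rule mult_left_mono[OF abs_ge_self K(1)])
    finally show ?thesis using K(2)[OF that] by simp
  qed
  then have "(\<lambda>p. cmod (m2l_error k H \<theta> x ?zD ?zC ?M p)) \<in> O(\<lambda>p. lam ^ p / real p)"
    by (intro bigoI[where c = K] eventually_sequentiallyI[of 1])
  then show ?thesis using main(1) by blast
qed

end
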